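(* Let $T \in \overline{\mathcal{AN}(H)}$ be quasinormal. Then there exist reducing subspaces $H_1, H_\infty, H_2$ of $T$ such that $H = H_1 \oplus H_\infty \oplus H_2$ and $$T = \bigoplus_{i=1}^{n} \alpha_i U_i \ \oplus\ \alpha V_\infty \ \oplus\ \bigoplus_{j=1}^{m} \beta_j V_j$$ for some $n, m \in \mathbb{N} \cup \{\infty\}$, where (i) $\sigma_{ess}(|T|) = \{\alpha\}$, $\alpha \geq 0$, $H_\infty = N(|T| - \alpha I)$ and $V_\infty \in \mathcal{B}(H_\infty)$ is an isometry; (ii) $(\alpha, \|T\|] \cap \sigma(|T|) = \{\alpha_i\}_{i=1}^{n}$, $H_1 = \bigoplus_{i=1}^{n} N(|T| - \alpha_i I)$ and $U_i \in \mathcal{B}(N(|T| - \alpha_i I))$ is a unitary operator for every $i$; (iii) $[m(T), \alpha) \cap \sigma(|T|) = \{\beta_j\}_{j=1}^{m}$, $H_2 = \bigoplus_{j=1}^{m} N(|T| - \beta_j I)$ and $V_j \in \mathcal{B}(N(|T| - \beta_j I))$ is a unitary operator for every $j$.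
   Context: $H$ is an infinite-dimensional complex Hilbert space and $\mathcal{B}(H)$ the bounded linear operators on $H$. $N(\cdot)$ denotes the null space, $\sigma(\cdot)$ the spectrum, $|T| = (T^*T)^{1/2}$, and $m(T) = \inf\{\|Tx\| : \|x\| = 1\}$. $T \in \mathcal{B}(H)$ is norm attaining if $\|Tx\| = \|T\|$ for some unit vector $x$; $\mathcal{AN}(H)$ is the set of $T \in \mathcal{B}(H)$ such that $T|_M : M \to H$ is norm attaining for every nonzero closed subspace $M$ of $H$; $\overline{\mathcal{AN}(H)}$ is its closure in the operator norm. $T$ is quasinormal if $T$ commutes with $T^*T$. $T$ is Fredholm if $R(T)$ is closed and $N(T)$, $N(T^* )$ are finite dimensional; $\sigma_{ess}(T) = \{\lambda \in \mathbb{C} : T - \lambda I \text{ is not Fredholm}\}$. The $\alpha_i$ are distinct, the $\beta_j$ are distinct. Either of the families $\{\alpha_i\}$, $\{\beta_j\}$ may be empty (i.e. $n=0$ or $m=0$), in which case the corresponding summand is absent and the corresponding subspace is $\{0\}$; $H_\infty$ may also be $\{0\}$. *)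

theory Defs
  imports "HOL-Analysis.Analysis" "HOL-Library.Extended_Nat"
begin

section \<open>Complex Hilbert spaces\<close>

text \<open>A complex inner product space is based on its underlying real inner product space, so that
  \<open>norm x = sqrt (inner x x) = sqrt (Re (cinner x x))\<close> and the library of real normed spaces
  (in particular the operator norm on \<open>'a \<Rightarrow>\<^sub>L 'a\<close>) is available. The form \<open>cinner\<close> is linear in its
  first argument; it is positive definite because \<open>inner\<close> is.\<close>

class complex_inner = real_inner +
  fixes scaleC :: "complex \<Rightarrow> 'a \<Rightarrow> 'a" (infixr \<open>*\<^sub>C\<close> 75)
    and cinner :: "'a \<Rightarrow> 'a \<Rightarrow> complex"
  assumes scaleC_add_right: "c *\<^sub>C (x + y) = c *\<^sub>C x + c *\<^sub>C y"
    and scaleC_add_left: "(c + d) *\<^sub>C x = c *\<^sub>C x + d *\<^sub>C x"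
    and scaleC_scaleC: "c *\<^sub>C d *\<^sub>C x = (c * d) *\<^sub>C x"
    and scaleC_of_real: "complex_of_real r *\<^sub>C x = r *\<^sub>R x"
    and cinner_add_left: "cinner (x + y) z = cinner x z + cinner y z"
    and cinner_scaleC_left: "cinner (c *\<^sub>C x) y = c * cinner x y"
    and cinner_commute: "cinner x y = cnj (cinner y x)"
    and inner_eq_Re_cinner: "inner x y = Re (cinner x y)"

class complex_hilbert = complex_inner + banach

lemma vector_space_scaleC: "vector_space (scaleC :: complex \<Rightarrow> 'a \<Rightarrow> 'a::complex_inner)"
proof
  show "1 *\<^sub>C x = x" for x :: 'a
    using scaleC_of_real[of 1 x] by simp
qed (simp_all add: scaleC_add_right scaleC_add_left scaleC_scaleC)

lemma norm_scaleC: "norm (c *\<^sub>C x) = cmod c * norm (x :: 'a::complex_inner)"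
proof -
  have "cinner x (c *\<^sub>C x) = cnj c * cinner x x"
    using cinner_commute[of x "c *\<^sub>C x"] cinner_commute[of x x] cinner_scaleC_left[of c x x]
    by simp
  then have "cinner (c *\<^sub>C x) (c *\<^sub>C x) = complex_of_real ((cmod c)\<^sup>2) * cinner x x"
    by (simp add: cinner_scaleC_left complex_norm_square mult.assoc del: of_real_power)
  then have "inner (c *\<^sub>C x) (c *\<^sub>C x) = (cmod c)\<^sup>2 * inner x x"
    by (simp add: inner_eq_Re_cinner del: of_real_power)
  then show ?thesis
    by (simp add: norm_eq_sqrt_inner real_sqrt_mult)
qed

definition csubspace :: "'a::complex_inner set \<Rightarrow> bool"
  where "csubspace = module.subspace scaleC"

definition cspan :: "'a::complex_inner set \<Rightarrow> 'a set"
  where "cspan = module.span scaleC"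

definition finite_cdim :: "'a::complex_inner set \<Rightarrow> bool"
  where "finite_cdim S \<longleftrightarrow> (\<exists>B. finite B \<and> S \<subseteq> cspan B)"

definition closed_csubspace :: "'a::complex_inner set \<Rightarrow> bool"
  where "closed_csubspace M \<longleftrightarrow> csubspace M \<and> closed M"

definition ortho_compl :: "'a::complex_inner set \<Rightarrow> 'a set"
  where "ortho_compl M = {y. \<forall>x\<in>M. cinner x y = 0}"

section \<open>Bounded linear operators\<close>

text \<open>The library type \<open>'a \<Rightarrow>\<^sub>L 'a\<close> consists of the bounded real-linear operators with the operator
  norm; the bounded complex-linear operators form the set \<open>BH\<close>.\<close>

definition BH :: "('a::complex_hilbert \<Rightarrow>\<^sub>L 'a) set"
  where "BH = {T. \<forall>c x. blinfun_apply T (c *\<^sub>C x) = c *\<^sub>C blinfun_apply T x}"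

definition scalar_op :: "complex \<Rightarrow> 'a::complex_hilbert \<Rightarrow>\<^sub>L 'a"
  where "scalar_op c = Blinfun (\<lambda>x. c *\<^sub>C x)"

lemma bounded_linear_scaleC: "bounded_linear (\<lambda>x :: 'a::complex_inner. c *\<^sub>C x)"
proof (rule bounded_linear_intro[where K = "cmod c"])
  show "c *\<^sub>C (r *\<^sub>R x) = r *\<^sub>R (c *\<^sub>C x)" for r and x :: 'a
    by (simp add: scaleC_scaleC mult.commute flip: scaleC_of_real)
qed (simp_all add: scaleC_add_right norm_scaleC mult.commute)

lemma scalar_op_apply [simp]: "blinfun_apply (scalar_op c) x = c *\<^sub>C x"
  by (simp add: scalar_op_def bounded_linear_Blinfun_apply bounded_linear_scaleC)

definition adj :: "('a::complex_hilbert \<Rightarrow>\<^sub>L 'a) \<Rightarrow> 'a \<Rightarrow>\<^sub>L 'a"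
  where "adj T = (THE S. S \<in> BH \<and>
           (\<forall>x y. cinner (blinfun_apply T x) y = cinner x (blinfun_apply S y)))"

definition positive_op :: "('a::complex_hilbert \<Rightarrow>\<^sub>L 'a) \<Rightarrow> bool"
  where "positive_op T \<longleftrightarrow> T \<in> BH \<and> (\<forall>x. cinner (blinfun_apply T x) x \<in> \<real>\<^sub>\<ge>\<^sub>0)"

text \<open>The modulus \<open>|T|\<close>: the unique positive square root of \<open>T\<^sup>*T\<close>.\<close>

definition abs_op :: "('a::complex_hilbert \<Rightarrow>\<^sub>L 'a) \<Rightarrow> 'a \<Rightarrow>\<^sub>L 'a"
  where "abs_op T = (THE P. positive_op P \<and> P o\<^sub>L P = adj T o\<^sub>L T)"

definition null_space :: "('a::complex_hilbert \<Rightarrow>\<^sub>L 'a) \<Rightarrow> 'a set"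
  where "null_space T = {x. blinfun_apply T x = 0}"

definition eigenspace :: "('a::complex_hilbert \<Rightarrow>\<^sub>L 'a) \<Rightarrow> real \<Rightarrow> 'a set"
  where "eigenspace T r = null_space (T - scalar_op (complex_of_real r))"

definition spectrum :: "('a::complex_hilbert \<Rightarrow>\<^sub>L 'a) \<Rightarrow> complex set"
  where "spectrum T = {c. \<not> (\<exists>S\<in>BH. S o\<^sub>L (T - scalar_op c) = id_blinfun \<and>
                                     (T - scalar_op c) o\<^sub>L S = id_blinfun)}"

definition Fredholm :: "('a::complex_hilbert \<Rightarrow>\<^sub>L 'a) \<Rightarrow> bool"
  where "Fredholm T \<longleftrightarrow> closed (range (blinfun_apply T)) \<and>
           finite_cdim (null_space T) \<and> finite_cdim (null_space (adj T))"

definition ess_spectrum :: "('a::complex_hilbert \<Rightarrow>\<^sub>L 'a) \<Rightarrow> complex set"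
  where "ess_spectrum T = {c. \<not> Fredholm (T - scalar_op c)}"

definition min_modulus :: "('a::complex_hilbert \<Rightarrow>\<^sub>L 'a) \<Rightarrow> real"
  where "min_modulus T = (INF x\<in>{x. norm x = 1}. norm (blinfun_apply T x))"

definition quasinormal :: "('a::complex_hilbert \<Rightarrow>\<^sub>L 'a) \<Rightarrow> bool"
  where "quasinormal T \<longleftrightarrow> T \<in> BH \<and> T o\<^sub>L (adj T o\<^sub>L T) = (adj T o\<^sub>L T) o\<^sub>L T"

definition restr_norm :: "'a::complex_hilbert set \<Rightarrow> ('a \<Rightarrow>\<^sub>L 'a) \<Rightarrow> real"
  where "restr_norm M T = (SUP x\<in>{x\<in>M. norm x = 1}. norm (blinfun_apply T x))"

definition norm_attaining_on :: "'a::complex_hilbert set \<Rightarrow> ('a \<Rightarrow>\<^sub>L 'a) \<Rightarrow> bool"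
  where "norm_attaining_on M T \<longleftrightarrow>
           (\<exists>x\<in>M. norm x = 1 \<and> norm (blinfun_apply T x) = restr_norm M T)"

text \<open>As \<open>BH\<close> is closed in \<open>'a \<Rightarrow>\<^sub>L 'a\<close>, the closure of \<open>AN\<close> in \<open>'a \<Rightarrow>\<^sub>L 'a\<close> is its closure in \<open>BH\<close>.\<close>

definition AN :: "('a::complex_hilbert \<Rightarrow>\<^sub>L 'a) set"
  where "AN = {T \<in> BH. \<forall>M. closed_csubspace M \<and> M \<noteq> {0} \<longrightarrow> norm_attaining_on M T}"

definition reducing :: "('a::complex_hilbert \<Rightarrow>\<^sub>L 'a) \<Rightarrow> 'a set \<Rightarrow> bool"
  where "reducing T M \<longleftrightarrow> closed_csubspace M \<and>
           blinfun_apply T ` M \<subseteq> M \<and> blinfun_apply T ` ortho_compl M \<subseteq> ortho_compl M"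

section \<open>Operators on a closed subspace and direct sums\<close>

text \<open>A bounded operator on a closed subspace \<open>M\<close> is represented by a function on the whole space
  of which only the values on \<open>M\<close> matter.\<close>

definition bounded_op_on :: "'a::complex_hilbert set \<Rightarrow> ('a \<Rightarrow> 'a) \<Rightarrow> bool"
  where "bounded_op_on M A \<longleftrightarrow> A ` M \<subseteq> M \<and>
           (\<forall>x\<in>M. \<forall>y\<in>M. A (x + y) = A x + A y) \<and>
           (\<forall>c. \<forall>x\<in>M. A (c *\<^sub>C x) = c *\<^sub>C A x) \<and>
           (\<exists>K. \<forall>x\<in>M. norm (A x) \<le> K * norm x)"

definition isometry_op_on :: "'a::complex_hilbert set \<Rightarrow> ('a \<Rightarrow> 'a) \<Rightarrow> bool"
  where "isometry_op_on M V \<longleftrightarrow> bounded_op_on M V \<and> (\<forall>x\<in>M. norm (V x) = norm x)"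

text \<open>Here \<open>W\<close> is the adjoint of \<open>U\<close> in the Hilbert space \<open>M\<close>.\<close>

definition unitary_op_on :: "'a::complex_hilbert set \<Rightarrow> ('a \<Rightarrow> 'a) \<Rightarrow> bool"
  where "unitary_op_on M U \<longleftrightarrow> bounded_op_on M U \<and>
           (\<exists>W. bounded_op_on M W \<and> (\<forall>x\<in>M. \<forall>y\<in>M. cinner (U x) y = cinner x (W y)) \<and>
                (\<forall>x\<in>M. W (U x) = x \<and> U (W x) = x))"

text \<open>\<open>direct_sum I M S\<close>: the closed subspace \<open>S\<close> is the orthogonal Hilbert space direct sum of the
  closed subspaces \<open>M i\<close>, \<open>i \<in> I\<close>; for \<open>I = {}\<close> this means \<open>S = {0}\<close>.\<close>

definition direct_sum :: "'i set \<Rightarrow> ('i \<Rightarrow> 'a::complex_hilbert set) \<Rightarrow> 'a set \<Rightarrow> bool"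
  where "direct_sum I M S \<longleftrightarrow>
           closed_csubspace S \<and> (\<forall>i\<in>I. closed_csubspace (M i)) \<and>
           (\<forall>i\<in>I. \<forall>j\<in>I. i \<noteq> j \<longrightarrow> (\<forall>x\<in>M i. \<forall>y\<in>M j. cinner x y = 0)) \<and>
           S = {x. \<exists>f. (\<forall>i\<in>I. f i \<in> M i) \<and> (f has_sum x) I}"

text \<open>\<open>op_direct_sum I M A S B\<close>: \<open>S\<close> is the direct sum of the \<open>M i\<close>, and on \<open>S\<close> the operator \<open>B\<close> is
  the direct sum of the operators \<open>A i\<close> on \<open>M i\<close>.\<close>

definition op_direct_sum ::
    "'i set \<Rightarrow> ('i \<Rightarrow> 'a::complex_hilbert set) \<Rightarrow> ('i \<Rightarrow> 'a \<Rightarrow> 'a) \<Rightarrow> 'a set \<Rightarrow> ('a \<Rightarrow> 'a) \<Rightarrow> bool"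
  where "op_direct_sum I M A S B \<longleftrightarrow>
           direct_sum I M S \<and> bounded_op_on S B \<and> (\<forall>i\<in>I. bounded_op_on (M i) (A i)) \<and>
           (\<forall>f x. (\<forall>i\<in>I. f i \<in> M i) \<and> (f has_sum x) I \<longrightarrow> ((\<lambda>i. A i (f i)) has_sum B x) I)"

text \<open>The index set \<open>{1, \<dots>, n}\<close>, which is \<open>{1, 2, \<dots>}\<close> for \<open>n = \<infinity>\<close> and empty for \<open>n = 0\<close>.\<close>

definition upto_enat :: "enat \<Rightarrow> nat set"
  where "upto_enat n = {i. 1 \<le> i \<and> enat i \<le> n}"

end

theory Submission
  imports Defs
begin

text \<open>Let \<open>T\<close> be a limit of absolutely norm attaining operators. If \<open>a < b\<close>, it is impossible that every
  finite set of vectors has a unit vector \<open>x\<close> orthogonal to it with \<open>\<parallel>T x\<parallel> \<le> a\<close> and also one with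
  \<open>\<parallel>T x\<parallel> \<ge> b\<close>: mixing such vectors gives, for an absolutely norm attaining operator near \<open>T\<close>, a closed
  subspace on which it has no maximizer. Hence there is \<open>\<alpha>\<close> such that \<open>\<parallel>T x\<parallel>\<close> is close to \<open>\<alpha> \<parallel>x\<parallel>\<close> off
  finite-dimensional subspaces, which means that \<open>|T| - \<alpha>\<close> is compact in the sense that it is small
  off finite-dimensional subspaces. So \<open>|T|\<close> is diagonalizable, with finitely many eigenvalues,
  counted with multiplicity, away from \<open>\<alpha>\<close>. As \<open>T\<close> is quasinormal, \<open>T\<close> and \<open>T\<^sup>*\<close> commute with \<open>|T|\<close>,
  so every eigenspace of \<open>|T|\<close> reduces \<open>T\<close>, and there \<open>T\<close> is a multiple of an isometry, which is unitary
  if the eigenspace is finite dimensional.\<close>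

section \<open>Real Hilbert spaces\<close>

text \<open>Finite codimension is always expressed by finitely many conditions
  \<open>inner c x = 0\<close> in the underlying real space; a complex condition is two of them. A
  finite set \<open>C\<close> may be enlarged freely, for instance by its images under an operator.

  Norm attainment is lost in the limit, whereas a gap between two values of the norm survives small
  perturbations; so only the gap is carried to the closure.

  That \<open>norm (T x)\<close> is close to \<alpha> times \<open>norm x\<close> controls merely
  the quadratic form of |T|^2 - \<alpha>^2. Symmetry turns this into a norm bound, and the factor
  |T| + \<alpha>, which is bounded below by \<alpha>, is then divided out; hence the separate case
  \<alpha> = 0.

  For complex c other than \<alpha>, |T| - c is bounded below off a finite-dimensional subspace.
  This one fact settles eigenvalues, spectrum and the Fredholm property away from \<alpha>. At
  \<alpha>, either the eigenspace is infinite dimensional, or eigenvalues accumulate there and the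
  range is not closed; so \<alpha> is the only point of the essential spectrum, and on its
  eigenspace only an isometry can be expected.\<close>

lemma linear_coeff_eq_0_if_quadratic_nonneg:
  fixes b c :: real
  assumes "\<And>t. 0 \<le> 2 * t * b + t\<^sup>2 * c"
  shows "b = 0"
proof (rule ccontr)
  assume "b \<noteq> 0"
  \<comment> \<open>At \<open>t = - b / k\<close> the quadratic equals
    \<open>b\<^sup>2 / k\<^sup>2 * (c - 2 * k)\<close>, so any positive \<open>k\<close> with
    \<open>c < 2 * k\<close> will do.\<close>
  define k where "k = \<bar>c\<bar> + 1"
  have k: "k > 0" "c < 2 * k" by (auto simp: k_def)
  have "0 \<le> 2 * (- b / k) * b + (- b / k)\<^sup>2 * c" by (rule assms)
  also have "\<dots> = b\<^sup>2 / k\<^sup>2 * (c - 2 * k)"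
    using k by (simp add: field_simps power2_eq_square)
  also have "\<dots> < 0"
    using k \<open>b \<noteq> 0\<close> by (intro mult_pos_neg) simp_all
  finally show False by simp
qed

lemma projection_exists:
  fixes M :: "'a::{real_inner,banach} set"
  assumes "subspace M" "closed M"
  obtains p where "p \<in> M" "\<And>y. y \<in> M \<Longrightarrow> inner y (x - p) = 0"
proof -
  define S where "S = (\<lambda>y. (norm (x - y))\<^sup>2) ` M"
  define d where "d = Inf S"
  have ne: "S \<noteq> {}" using subspace_0[OF assms(1)] by (auto simp: S_def)
  have bd: "bdd_below S" unfolding S_def by (rule bdd_belowI[where m=0]) auto
  have dle: "d \<le> (norm (x - y))\<^sup>2" if "y \<in> M" for y
    unfolding d_def by (rule cInf_lower[OF _ bd]) (use that in \<open>auto simp: S_def\<close>)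
  have "\<exists>y\<in>M. (norm (x - y))\<^sup>2 < d + inverse (real (Suc n))" for n
  proof -
    have "Inf S < d + inverse (real (Suc n))" by (simp add: d_def)
    then show ?thesis using cInf_lessD[OF ne] by (auto simp: S_def)
  qed
  then obtain y where yM: "\<And>n. y n \<in> M"
    and yd: "\<And>n. (norm (x - y n))\<^sup>2 < d + inverse (real (Suc n))"
    by metis
  \<comment> \<open>The midpoint of \<open>u\<close> and \<open>v\<close> lies in \<open>M\<close>,
    so its squared distance from \<open>x\<close> is at least \<open>d\<close>; the parallelogram
    law turns this into the estimate that makes a minimizing sequence Cauchy.\<close>
  have par: "(norm (u - v))\<^sup>2 \<le> 2 * ((norm (x - u))\<^sup>2 - d) + 2 * ((norm (x - v))\<^sup>2 - d)"
    if "u \<in> M" "v \<in> M" for u v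
  proof -
    have "(1/2) *\<^sub>R (u + v) \<in> M"
      using that assms(1) by (simp add: subspace_add subspace_scale)
    then have "d \<le> (norm (x - (1/2) *\<^sub>R (u + v)))\<^sup>2" by (rule dle)
    moreover have "(norm (u - v))\<^sup>2 = 2 * (norm (x - u))\<^sup>2 + 2 * (norm (x - v))\<^sup>2
        - 4 * (norm (x - (1/2) *\<^sub>R (u + v)))\<^sup>2"
      unfolding power2_norm_eq_inner by (simp add: inner_simps inner_commute algebra_simps)
    ultimately show ?thesis by simp
  qed
  have "Cauchy y"
  proof (rule metric_CauchyI)
    fix e :: real assume "e > 0"
    then obtain N where N: "inverse (real (Suc N)) < e\<^sup>2 / 4"
      using reals_Archimedean[of "e\<^sup>2 / 4"] by auto
    have lt: "(norm (x - y n))\<^sup>2 - d < e\<^sup>2 / 4" if "n \<ge> N" for n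
    proof -
      have "inverse (real (Suc n)) \<le> inverse (real (Suc N))" using that by (simp add: field_simps)
      then show ?thesis using yd[of n] N by linarith
    qed
    have "dist (y m) (y n) < e" if "m \<ge> N" "n \<ge> N" for m n
    proof -
      have "(norm (y m - y n))\<^sup>2 < e\<^sup>2"
        using par[OF yM yM, of m n] lt[OF that(1)] lt[OF that(2)] by argo
      then show ?thesis using \<open>e > 0\<close> by (simp add: dist_norm power_less_imp_less_base)
    qed
    then show "\<exists>N. \<forall>m\<ge>N. \<forall>n\<ge>N. dist (y m) (y n) < e" by blast
  qed
  then obtain p where p: "y \<longlonglongrightarrow> p" using Cauchy_convergent_iff convergent_def by blast
  have pM: "p \<in> M" using closed_sequentially[OF assms(2) _ p] yM by blast
  have "(norm (x - p))\<^sup>2 \<le> d"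
  proof (rule LIMSEQ_le)
    show "(\<lambda>n. (norm (x - y n))\<^sup>2) \<longlonglongrightarrow> (norm (x - p))\<^sup>2" by (intro tendsto_intros p)
    show "(\<lambda>n. d + inverse (real (Suc n))) \<longlonglongrightarrow> d"
      using tendsto_add[OF tendsto_const LIMSEQ_inverse_real_of_nat, of d] by simp
    show "\<exists>N. \<forall>n\<ge>N. (norm (x - y n))\<^sup>2 \<le> d + inverse (real (Suc n))"
      using yd less_imp_le by blast
  qed
  then have pd: "(norm (x - p))\<^sup>2 = d" using dle[OF pM] by simp
  have "inner z (x - p) = 0" if "z \<in> M" for z
  proof -
    \<comment> \<open>Moving from the minimizer \<open>p\<close> to \<open>p + t *\<^sub>R z\<close>
      inside \<open>M\<close> cannot decrease the distance to \<open>x\<close>; the inner product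
      is, up to sign, the linear coefficient.\<close>
    have "0 \<le> 2 * t * (- inner z (x - p)) + t\<^sup>2 * (norm z)\<^sup>2" for t
    proof -
      have "p + t *\<^sub>R z \<in> M" using pM that assms(1) by (simp add: subspace_add subspace_scale)
      then have "(norm (x - p))\<^sup>2 \<le> (norm (x - (p + t *\<^sub>R z)))\<^sup>2" using dle pd by simp
      also have "\<dots> = (norm (x - p))\<^sup>2 - 2 * t * inner z (x - p) + t\<^sup>2 * (norm z)\<^sup>2"
        unfolding power2_norm_eq_inner
        by (simp add: inner_simps inner_commute algebra_simps power2_eq_square)
      finally show ?thesis by simp
    qed
    from linear_coeff_eq_0_if_quadratic_nonneg[OF this] show ?thesis by simp
  qed
  with pM show thesis by (rule that)
qed

lemma riesz_representation:
  fixes f :: "'a::{real_inner,banach} \<Rightarrow> real"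
  assumes "bounded_linear f"
  shows "\<exists>z. \<forall>x. f x = inner x z"
proof (cases "\<forall>x. f x = 0")
  case True
  then show ?thesis by (intro exI[of _ 0]) simp
next
  case False
  interpret f: bounded_linear f by fact
  obtain u where u: "f u \<noteq> 0" using False by blast
  define M where "M = {x. f x = 0}"
  have "subspace M" by (auto simp: M_def subspace_def f.zero f.add f.scaleR)
  moreover have "closed M" unfolding M_def
    by (intro closed_Collect_eq continuous_intros linear_continuous_on assms)
  ultimately obtain p where p: "p \<in> M" "\<And>y. y \<in> M \<Longrightarrow> inner y (u - p) = 0"
    using projection_exists[of M u] by metis
  define w where "w = u - p"
  have fw: "f w \<noteq> 0" using p u by (simp add: w_def f.diff M_def)
  then have "w \<noteq> 0" using f.zero by auto
  have "f x = inner x ((f w / inner w w) *\<^sub>R w)" for x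
  proof -
    have "x - (f x / f w) *\<^sub>R w \<in> M" using fw by (simp add: M_def f.diff f.scaleR)
    then have "inner x w = f x / f w * inner w w"
      using p(2) by (fastforce simp: inner_diff_left simp flip: w_def)
    then show ?thesis using fw \<open>w \<noteq> 0\<close> by simp
  qed
  then show ?thesis by blast
qed

lemma real_adjoint_exists:
  fixes T :: "'a::{real_inner,banach} \<Rightarrow>\<^sub>L 'a"
  shows "\<exists>S :: 'a \<Rightarrow>\<^sub>L 'a. \<forall>x y. inner (T x) y = inner x (S y)"
proof -
  have "\<exists>z. \<forall>x. inner (T x) y = inner x z" for y
    by (rule riesz_representation)
      (intro bounded_linear_compose[OF bounded_linear_inner_left blinfun.bounded_linear_right])
  then obtain S where S: "\<And>x y. inner (T x) y = inner x (S y)" by metis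
  have "bounded_linear S"
  proof (rule bounded_linear_intro[where K = "norm T"])
    show "S (x + y) = S x + S y" for x y
      by (rule vector_eq_ldot[THEN iffD1]) (simp add: inner_add_right flip: S)
    show "S (r *\<^sub>R x) = r *\<^sub>R S x" for r x
      by (rule vector_eq_ldot[THEN iffD1]) (simp flip: S)
    show "norm (S x) \<le> norm x * norm T" for x
    proof (cases "S x = 0")
      case False
      have "norm (S x) * norm (S x) = inner (T (S x)) x"
        by (simp add: S flip: power2_norm_eq_inner power2_eq_square)
      also have "\<dots> \<le> norm (T (S x)) * norm x" by (rule norm_cauchy_schwarz)
      also have "\<dots> \<le> norm T * norm (S x) * norm x"
        by (intro mult_right_mono norm_blinfun) auto
      finally show ?thesis using False by (simp add: mult_ac)
    qed simp
  qed
  then show ?thesis using S by (intro exI[of _ "Blinfun S"]) (simp add: bounded_linear_Blinfun_apply)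
qed

text \<open>One condition costs at most one dimension, since its kernel and a single vector
  \<open>u\<close> together span the space. This supplies test vectors: whatever finite set an
  estimate excludes, a nonzero vector is left on which the estimate holds.\<close>

lemma inf_dim_orthogonal:
  fixes F :: "'a::real_inner set"
  assumes "finite C" "subspace F" "\<not> (\<exists>B. finite B \<and> F \<subseteq> span B)"
  shows "\<exists>x\<in>F. x \<noteq> 0 \<and> (\<forall>c\<in>C. inner c x = 0)"
  using assms
proof (induction C arbitrary: F rule: finite_induct)
  case empty
  have "\<not> F \<subseteq> span {}" using empty by blast
  then show ?case by auto
next
  case (insert c C)
  define F' where "F' = {x\<in>F. inner c x = 0}"
  have "subspace F'" using insert.prems(1)
    by (auto simp: F'_def subspace_def inner_add_right)
  moreover have "\<not> (\<exists>B. finite B \<and> F' \<subseteq> span B)"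
  proof
    assume "\<exists>B. finite B \<and> F' \<subseteq> span B"
    then obtain B where B: "finite B" "F' \<subseteq> span B" by blast
    obtain u where u: "u \<in> F" "inner c u \<noteq> 0"
      using B insert.prems(2) unfolding F'_def by (metis (mono_tags, lifting) mem_Collect_eq subset_iff)
    have "x \<in> span (insert u B)" if "x \<in> F" for x
    proof -
      let ?t = "inner c x / inner c u"
      have "x - ?t *\<^sub>R u \<in> F'"
        using that u insert.prems(1) by (simp add: F'_def subspace_diff subspace_scale inner_diff_right)
      then have "x - ?t *\<^sub>R u \<in> span (insert u B)"
        using B(2) span_mono[of B "insert u B"] by blast
      moreover have "?t *\<^sub>R u \<in> span (insert u B)" by (simp add: span_base span_scale)
      ultimately show ?thesis using span_add by fastforce
    qed
    then show False using insert.prems(2) B(1) by blast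
  qed
  ultimately obtain x where "x \<in> F'" "x \<noteq> 0" "\<forall>c\<in>C. inner c x = 0" using insert.IH by blast
  then show ?case by (auto simp: F'_def)
qed

text \<open>\<open>R x\<close> is the finite set of constraints that a chosen \<open>x\<close>
  imposes, through \<open>Q\<close>, on all later choices. The recursion carries a finite set
  containing all constraints accumulated so far, so each choice has only finitely many to meet. It
  produces both orthogonal sequences and sequences of distinct eigenvalues.\<close>

lemma greedy_sequence:
  fixes P :: "nat \<Rightarrow> 'a \<Rightarrow> bool" and R :: "'a \<Rightarrow> 'b set" and Q :: "'b \<Rightarrow> 'a \<Rightarrow> bool"
  assumes ex: "\<And>n C. finite C \<Longrightarrow> \<exists>x. P n x \<and> (\<forall>c\<in>C. Q c x)"
    and fin: "\<And>x. finite (R x)"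
  shows "\<exists>X. \<forall>n. P n (X n) \<and> (\<forall>j<n. \<forall>c\<in>R (X j). Q c (X n))"
proof -
  have "\<exists>Y. \<forall>n. (\<exists>x. fst (Y n) = x \<and> P n x \<and> finite (snd (Y n)) ) \<and>
      (R (fst (Y n)) \<union> snd (Y n) \<subseteq> snd (Y (Suc n)) \<and> (\<forall>c\<in>snd (Y (Suc n)). Q c (fst (Y (Suc n)))))"
  proof (rule dependent_nat_choice)
    show "\<exists>y. \<exists>x. fst y = x \<and> P 0 x \<and> finite (snd y :: 'b set)" using ex[of "{}" 0] by auto
  next
    fix y :: "'a \<times> 'b set" and n
    assume y: "\<exists>x. fst y = x \<and> P n x \<and> finite (snd y)"
    let ?C = "R (fst y) \<union> snd y"
    obtain x where "P (Suc n) x" "\<forall>c\<in>?C. Q c x" using ex[of ?C "Suc n"] fin y by auto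
    then show "\<exists>z. (\<exists>x. fst z = x \<and> P (Suc n) x \<and> finite (snd z)) \<and>
        (R (fst y) \<union> snd y \<subseteq> snd z \<and> (\<forall>c\<in>snd z. Q c (fst z)))"
      using fin y by (intro exI[of _ "(x, ?C)"]) auto
  qed
  then obtain Y where Y: "\<And>n. P n (fst (Y n))"
      "\<And>n. R (fst (Y n)) \<union> snd (Y n) \<subseteq> snd (Y (Suc n))"
      "\<And>n. \<forall>c\<in>snd (Y (Suc n)). Q c (fst (Y (Suc n)))" by metis
  have sub: "R (fst (Y j)) \<subseteq> snd (Y n)" if "j < n" for j n
    using that
  proof (induction n)
    case (Suc n)
    then show ?case using Y(2)[of n] by (cases "j = n") auto
  qed simp
  have "\<forall>c\<in>R (fst (Y j)). Q c (fst (Y n))" if "j < n" for j n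
    using sub[OF that] Y(3)[of "n - 1"] that by auto
  then show ?thesis using Y(1) by (intro exI[of _ "\<lambda>n. fst (Y n)"]) auto
qed

lemma bounded_below_image_closed:
  fixes L :: "'a::real_inner \<Rightarrow>\<^sub>L 'b::real_normed_vector"
  assumes "complete W" "subspace W" "\<delta> > 0" "\<And>x. x \<in> W \<Longrightarrow> \<delta> * norm x \<le> norm (L x)"
  shows "complete (L ` W)"
proof (rule complete_isometric_image[OF \<open>\<delta> > 0\<close> assms(2) blinfun.bounded_linear_right])
qed (use assms in auto)

text \<open>Induction on \<open>C\<close>: adding one constraint enlarges the space by at most one dimension, and the
  image of the larger space stays at positive distance from the closed image of the smaller one.\<close>

lemma bounded_below_if_injective:
  fixes L :: "'a::{real_inner,banach} \<Rightarrow>\<^sub>L 'b::banach"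
  assumes "finite C" "subspace W" "closed W" "\<epsilon> > 0"
    and "\<And>x. x \<in> W \<Longrightarrow> \<forall>c\<in>C. inner c x = 0 \<Longrightarrow> \<epsilon> * norm x \<le> norm (L x)"
    and "\<And>x. x \<in> W \<Longrightarrow> L x = 0 \<Longrightarrow> x = 0"
  shows "\<exists>\<delta>>0. \<forall>x\<in>W. \<delta> * norm x \<le> norm (L x)"
  using assms
proof (induction C arbitrary: W rule: finite_induct)
  case empty
  then show ?case by auto
next
  case (insert c C)
  define W' where "W' = {x\<in>W. inner c x = 0}"
  have sW': "subspace W'" using insert.prems(1)
    by (auto simp: W'_def subspace_def inner_add_right)
  have cW': "closed W'"
  proof -
    have "W' = W \<inter> {x. inner c x = 0}" by (auto simp: W'_def)
    moreover have "closed {x. inner c x = 0}" by (intro closed_Collect_eq continuous_intros)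
    ultimately show ?thesis using insert.prems(2) by (simp add: closed_Int)
  qed
  obtain \<delta> where d: "\<delta> > 0" "\<And>x. x \<in> W' \<Longrightarrow> \<delta> * norm x \<le> norm (L x)"
    using insert.IH[OF sW' cW' \<open>\<epsilon> > 0\<close>] insert.prems(4,5) by (auto simp: W'_def)
  show ?case
  proof (cases "\<forall>x\<in>W. inner c x = 0")
    case True
    then have "W' = W" by (auto simp: W'_def)
    then show ?thesis using d by blast
  next
    case False
    then obtain u where u: "u \<in> W" "inner c u \<noteq> 0" by blast
    have "complete (L ` W')"
      using bounded_below_image_closed[OF _ sW' d] cW' by (simp add: complete_eq_closed)
    then have cl: "closed (L ` W')" by (simp add: complete_imp_closed)
    have "L u \<notin> L ` W'"
    proof
      assume "L u \<in> L ` W'"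
      then obtain w where w: "w \<in> W'" "L u = L w" by blast
      then have "u - w = 0"
        using u insert.prems(1) by (intro insert.prems(5)) (auto simp: blinfun.diff_right W'_def subspace_diff)
      then show False using u w by (simp add: W'_def)
    qed
    moreover have "L ` W' \<noteq> {}" using subspace_0[OF sW'] by blast
    ultimately have "0 < infdist (L u) (L ` W')" using cl infdist_pos_not_in_closed by metis
    then obtain r where r: "r > 0" "\<And>y. y \<in> L ` W' \<Longrightarrow> r \<le> dist (L u) y"
      using infdist_le by metis
    \<comment> \<open>\<open>r\<close> bounds the distance from \<open>L u\<close> to the image of
      \<open>W'\<close> from below; after division by \<open>t\<close>, the image of
      \<open>w + t *\<^sub>R u\<close> controls the coefficient of \<open>u\<close>.\<close>
    have rt: "\<bar>t\<bar> * r \<le> norm (L (w + t *\<^sub>R u))" if "w \<in> W'" for w t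
    proof (cases "t = 0")
      case False
      have "(- 1 / t) *\<^sub>R w \<in> W'" using that sW' by (rule subspace_scale[rotated])
      then have "r \<le> norm (L u - L ((- 1 / t) *\<^sub>R w))" using r(2) by (simp add: dist_norm)
      then have "\<bar>t\<bar> * r \<le> \<bar>t\<bar> * norm (L u - L ((- 1 / t) *\<^sub>R w))"
        by (rule mult_left_mono) simp
      also have "\<dots> = norm (t *\<^sub>R (L u - L ((- 1 / t) *\<^sub>R w)))" by simp
      also have "t *\<^sub>R (L u - L ((- 1 / t) *\<^sub>R w)) = L (w + t *\<^sub>R u)"
        using False by (simp add: blinfun.scaleR_right blinfun.add_right blinfun.diff_right blinfun.minus_right
            scaleR_diff_right scaleR_add_right)
      finally show ?thesis .
    qed simp
    \<comment> \<open>\<open>\<bar>t\<bar>\<close> is at most \<open>norm (L x) / r\<close>, and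
      \<open>norm w\<close> at most
      \<open>(norm (L x) + \<bar>t\<bar> * norm (L u)) / \<delta>\<close>; \<open>k\<close> collects
      what \<open>norm w + \<bar>t\<bar> * norm u\<close> then costs per unit of
      \<open>norm (L x)\<close>.\<close>
    define k where "k = 1 / \<delta> + (norm (L u) / \<delta> + norm u) / r"
    have k: "k > 0" using d(1) r(1) unfolding k_def by (intro add_pos_nonneg) auto
    have "norm x \<le> k * norm (L x)" if "x \<in> W" for x
    proof -
      define t where "t = inner c x / inner c u"
      define w where "w = x - t *\<^sub>R u"
      have w: "w \<in> W'"
        using that u insert.prems(1)
        by (simp add: W'_def w_def t_def subspace_diff subspace_scale inner_diff_right)
      have x: "x = w + t *\<^sub>R u" by (simp add: w_def)
      have t: "\<bar>t\<bar> \<le> norm (L x) / r" using rt[OF w, of t] r(1) by (simp add: x field_simps)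
      have "\<delta> * norm w \<le> norm (L w)" using d(2) w by blast
      also have "L w = L x - t *\<^sub>R L u"
        by (simp add: x blinfun.add_right blinfun.scaleR_right)
      also have "norm \<dots> \<le> norm (L x) + \<bar>t\<bar> * norm (L u)"
        using norm_triangle_ineq4[of "L x" "t *\<^sub>R L u"] by simp
      finally have w': "norm w \<le> (norm (L x) + \<bar>t\<bar> * norm (L u)) / \<delta>"
        using d(1) by (simp add: field_simps)
      have "norm x \<le> norm w + \<bar>t\<bar> * norm u"
        using norm_triangle_ineq[of w "t *\<^sub>R u"] by (simp add: x)
      also have "\<dots> \<le> norm (L x) / \<delta> + \<bar>t\<bar> * (norm (L u) / \<delta> + norm u)"
        using w' by (simp add: field_simps add_divide_distrib)
      also have "\<dots> \<le> norm (L x) / \<delta> + norm (L x) / r * (norm (L u) / \<delta> + norm u)"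
        using d(1) by (intro add_left_mono mult_right_mono t) simp
      also have "\<dots> = k * norm (L x)" by (simp add: k_def field_simps)
      finally show ?thesis .
    qed
    then show ?thesis using k by (intro exI[of _ "1 / k"]) (auto simp: field_simps)
  qed
qed

section \<open>Complex inner products\<close>

interpretation scaleC: vector_space "scaleC :: complex \<Rightarrow> 'a \<Rightarrow> 'a::complex_inner"
  by (rule vector_space_scaleC)

text \<open>The form is determined by its real part, the imaginary part being the real product with
  \<open>\<i> *\<^sub>C y\<close>. Complex orthogonality thereby becomes two real
  conditions.\<close>

lemma cinner_eq_Complex: "cinner x y = Complex (inner x y) (inner x (\<i> *\<^sub>C y))"
proof -
  have "cinner x (\<i> *\<^sub>C y) = - \<i> * cinner x y"
    using cinner_commute[of x "\<i> *\<^sub>C y"] cinner_commute[of x y]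
    by (simp add: cinner_scaleC_left)
  then show ?thesis by (simp add: complex_eq_iff inner_eq_Re_cinner)
qed

lemma cinner_eq_0_iff: "cinner x y = 0 \<longleftrightarrow> inner x y = 0 \<and> inner x (\<i> *\<^sub>C y) = 0"
  by (simp add: cinner_eq_Complex complex_eq_iff)

lemma cinner_eq_0_commute: "cinner x y = 0 \<longleftrightarrow> cinner y x = 0"
  by (metis cinner_commute complex_cnj_zero_iff)

lemma cinner_zero_left [simp]: "cinner 0 x = 0"
  and cinner_zero_right [simp]: "cinner x 0 = 0"
  by (simp_all add: cinner_eq_0_iff)

lemma cinner_add_right: "cinner x (y + z) = cinner x y + cinner x z"
  by (simp add: cinner_eq_Complex complex_eq_iff inner_add_right scaleC.scale_right_distrib)

lemma cinner_diff_right: "cinner x (y - z) = cinner x y - cinner x z"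
  by (simp add: cinner_eq_Complex complex_eq_iff inner_diff_right scaleC.scale_right_diff_distrib)

lemma cinner_diff_left: "cinner (x - y) z = cinner x z - cinner y z"
  by (simp add: cinner_eq_Complex complex_eq_iff inner_diff_left)

lemma cinner_scaleC_right: "cinner x (c *\<^sub>C y) = cnj c * cinner x y"
  by (metis cinner_commute cinner_scaleC_left complex_cnj_mult)

lemma cinner_scaleR_left: "cinner (r *\<^sub>R x) y = of_real r * cinner x y"
  by (metis cinner_scaleC_left scaleC_of_real)

lemma cinner_scaleR_right: "cinner x (r *\<^sub>R y) = of_real r * cinner x y"
  by (metis cinner_scaleC_right complex_cnj_complex_of_real scaleC_of_real)

lemma cinner_self: "cinner x x = of_real ((norm x)\<^sup>2)"
proof -
  have "Im (cinner x x) = 0" using cinner_commute[of x x] by (simp add: complex_eq_iff)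
  then show ?thesis by (simp add: complex_eq_iff power2_norm_eq_inner flip: inner_eq_Re_cinner)
qed

lemma cinner_self_eq_0 [simp]: "cinner x x = 0 \<longleftrightarrow> x = 0"
  by (simp add: cinner_self)

lemma inner_scaleC_ii: "inner (\<i> *\<^sub>C x) (\<i> *\<^sub>C y) = inner x y"
  by (simp add: inner_eq_Re_cinner cinner_scaleC_left cinner_scaleC_right)

lemma inner_scaleC_ii_right: "inner x (\<i> *\<^sub>C y) = - inner (\<i> *\<^sub>C x) y"
  by (simp add: inner_eq_Re_cinner cinner_scaleC_left cinner_scaleC_right)

lemma csubspace_iff:
  "csubspace M \<longleftrightarrow> 0 \<in> M \<and> (\<forall>x\<in>M. \<forall>y\<in>M. x + y \<in> M) \<and> (\<forall>c. \<forall>x\<in>M. c *\<^sub>C x \<in> M)"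
  by (simp add: csubspace_def scaleC.subspace_def)

lemma csubspace_imp_subspace: "csubspace M \<Longrightarrow> subspace M"
  unfolding csubspace_iff subspace_def by (metis scaleC_of_real)

text \<open>A complex spanning set \<open>B\<close> becomes a real one once all
  \<open>\<i> *\<^sub>C b\<close> are added, and a real span lies in the complex span. Dimension
  arguments can therefore be carried out over the reals.\<close>

lemma finite_cdim_iff_span: "finite_cdim S \<longleftrightarrow> (\<exists>B. finite B \<and> S \<subseteq> span B)"
proof
  assume "finite_cdim S"
  then obtain B where B: "finite B" "S \<subseteq> cspan B" by (auto simp: finite_cdim_def)
  let ?B = "B \<union> scaleC \<i> ` B"
  have ii: "\<i> *\<^sub>C x \<in> span ?B" if "x \<in> span ?B" for x
    using that
  proof (induction rule: span_induct)
    case base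
    show ?case
      unfolding subspace_def
      by (auto simp: scaleC.scale_right_distrib span_add span_zero span_scale scaleC_scaleC mult.commute
          simp flip: scaleC_of_real) (metis mult.commute scaleC_of_real scaleC_scaleC span_scale)
  next
    case (step x)
    then show ?case
    proof
      assume "x \<in> scaleC \<i> ` B"
      then obtain y where "y \<in> B" "\<i> *\<^sub>C x = (-1) *\<^sub>C y" by (auto simp: scaleC_scaleC)
      then show ?case by (auto intro: span_base span_neg)
    qed (auto intro: span_base)
  qed
  have "scaleC.subspace (span ?B)"
  proof (rule scaleC.subspaceI)
    fix c x assume x: "x \<in> span ?B"
    have "c *\<^sub>C x = Re c *\<^sub>R x + Im c *\<^sub>R (\<i> *\<^sub>C x)"
      using complex_eq[of c] by (metis mult.commute scaleC_add_left scaleC_of_real scaleC_scaleC)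
    then show "c *\<^sub>C x \<in> span ?B" using ii x by (simp add: span_add span_scale)
  qed (auto intro: span_zero span_add)
  moreover have "B \<subseteq> span ?B" by (auto intro: span_base)
  ultimately have "cspan B \<subseteq> span ?B" unfolding cspan_def by (intro scaleC.span_minimal)
  then show "\<exists>B. finite B \<and> S \<subseteq> span B" using B by (intro exI[of _ ?B]) auto
next
  assume "\<exists>B. finite B \<and> S \<subseteq> span B"
  then obtain B where B: "finite B" "S \<subseteq> span B" by blast
  have "csubspace (cspan B)" by (simp add: csubspace_def cspan_def)
  then have "span B \<subseteq> cspan B"
    by (intro span_minimal csubspace_imp_subspace) (auto simp: cspan_def scaleC.span_base)
  then show "finite_cdim S" using B by (auto simp: finite_cdim_def)
qed

text \<open>Since \<open>M\<close> is stable under \<open>\<i>\<close>, real orthogonality to all of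
  \<open>M\<close> already kills the imaginary parts. Residuals of real projections are thus
  orthogonal in the complex sense.\<close>

lemma mem_ortho_compl_iff:
  assumes "csubspace M"
  shows "y \<in> ortho_compl M \<longleftrightarrow> (\<forall>x\<in>M. inner x y = 0)"
proof -
  have "inner x (\<i> *\<^sub>C y) = 0" if "\<forall>x\<in>M. inner x y = 0" "x \<in> M" for x
    using assms that by (simp add: inner_scaleC_ii_right csubspace_iff)
  then show ?thesis by (auto simp: ortho_compl_def cinner_eq_0_iff)
qed

lemma closed_csubspace_ortho_compl [simp]: "closed_csubspace (ortho_compl M)"
proof -
  have "csubspace (ortho_compl M)"
    by (auto simp: csubspace_iff ortho_compl_def cinner_add_right cinner_scaleC_right)
  moreover have "ortho_compl M = (\<Inter>x\<in>M. {y. inner x y = 0} \<inter> {y. - inner (\<i> *\<^sub>C x) y = 0})"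
    by (auto simp: ortho_compl_def cinner_eq_0_iff inner_scaleC_ii_right)
  moreover have "closed \<dots>"
    by (intro closed_INT ballI closed_Int closed_Collect_eq continuous_intros)
  ultimately show ?thesis by (simp add: closed_csubspace_def)
qed

lemma ortho_compl_antimono: "M \<subseteq> N \<Longrightarrow> ortho_compl N \<subseteq> ortho_compl M"
  by (auto simp: ortho_compl_def)

lemma subset_ortho_compl_iff: "M \<subseteq> ortho_compl N \<longleftrightarrow> (\<forall>x\<in>M. \<forall>y\<in>N. cinner x y = 0)"
  by (auto simp: ortho_compl_def cinner_eq_0_commute)

lemma subset_ortho_compl_ortho_compl: "M \<subseteq> ortho_compl (ortho_compl M)"
  unfolding subset_ortho_compl_iff by (auto simp: ortho_compl_def cinner_eq_0_commute)

lemma ortho_compl_Int: "x \<in> ortho_compl M \<Longrightarrow> x \<in> ortho_compl (ortho_compl M) \<Longrightarrow> x = 0"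
  by (auto simp: ortho_compl_def)

section \<open>Adjoints\<close>

lemma BH_scaleC: "T \<in> BH \<Longrightarrow> T (c *\<^sub>C x) = c *\<^sub>C T x"
  by (simp add: BH_def)

lemma BH_compose: "S \<in> BH \<Longrightarrow> T \<in> BH \<Longrightarrow> S o\<^sub>L T \<in> BH"
  by (simp add: BH_def)

lemma BH_diff: "S \<in> BH \<Longrightarrow> T \<in> BH \<Longrightarrow> S - T \<in> BH"
  by (simp add: BH_def blinfun.diff_left scaleC.scale_right_diff_distrib)

lemma BH_scalar_op [simp]: "scalar_op c \<in> BH"
  by (simp add: BH_def scaleC_scaleC mult.commute)

lemma cinner_eqI: "(\<And>x. cinner x y = cinner x z) \<Longrightarrow> y = z"
  by (metis cinner_diff_right cinner_self_eq_0 right_minus_eq)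

text \<open>The adjoint of the underlying real operator works: its identity at
  \<open>\<i> *\<^sub>C x\<close> in place of \<open>x\<close> yields the imaginary part, and
  comparing inner products yields complex linearity.\<close>

lemma adjoint_exists:
  fixes T :: "'a::complex_hilbert \<Rightarrow>\<^sub>L 'a"
  assumes T: "T \<in> BH"
  shows "\<exists>S\<in>BH. \<forall>x y. cinner (T x) y = cinner x (S y)"
proof -
  obtain S :: "'a \<Rightarrow>\<^sub>L 'a" where S: "\<And>x y. inner (T x) y = inner x (S y)"
    using real_adjoint_exists by blast
  have c: "cinner (T x) y = cinner x (S y)" for x y
    using S[of x y] S[of "\<i> *\<^sub>C x" y] T
    by (simp add: cinner_eq_Complex complex_eq_iff inner_scaleC_ii_right BH_scaleC)
  have "S (c *\<^sub>C y) = c *\<^sub>C S y" for c y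
    by (rule cinner_eqI) (simp add: cinner_scaleC_right flip: c)
  then show ?thesis using c by (auto simp: BH_def)
qed

lemma adj_unique:
  fixes T S :: "'a::complex_hilbert \<Rightarrow>\<^sub>L 'a"
  assumes "S \<in> BH" "\<And>x y. cinner (T x) y = cinner x (S y)"
  shows "adj T = S"
  unfolding adj_def
proof (rule the_equality)
  fix R assume R: "R \<in> BH \<and> (\<forall>x y. cinner (T x) y = cinner x (R y))"
  show "R = S"
    by (rule blinfun_eqI, rule cinner_eqI) (metis R assms(2))
qed (use assms in auto)

lemma
  fixes T :: "'a::complex_hilbert \<Rightarrow>\<^sub>L 'a"
  assumes "T \<in> BH"
  shows adj_in_BH: "adj T \<in> BH"
    and cinner_adj: "cinner (T x) y = cinner x (adj T y)"
  using adjoint_exists[OF assms] adj_unique by metis+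

lemma cinner_adj_left: "T \<in> BH \<Longrightarrow> cinner (adj T x) y = cinner x (T y)"
  by (metis cinner_adj cinner_commute)

lemma inner_adj: "T \<in> BH \<Longrightarrow> inner (T x) y = inner x (adj T y)"
  by (simp add: inner_eq_Re_cinner cinner_adj)

lemma inner_adj_left: "T \<in> BH \<Longrightarrow> inner (adj T x) y = inner x (T y)"
  by (simp add: inner_eq_Re_cinner cinner_adj_left)

lemma reducingI:
  fixes T :: "'a::complex_hilbert \<Rightarrow>\<^sub>L 'a"
  assumes "T \<in> BH" "closed_csubspace M" "T ` M \<subseteq> M" "adj T ` M \<subseteq> M"
  shows "reducing T M"
  using assms unfolding reducing_def ortho_compl_def
  by (auto simp: image_subset_iff) (metis cinner_adj_left)

lemma invariant_ortho_compl:
  fixes T :: "'a::complex_hilbert \<Rightarrow>\<^sub>L 'a"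
  assumes "T \<in> BH" "adj T ` M \<subseteq> M"
  shows "T ` ortho_compl M \<subseteq> ortho_compl M"
  using assms unfolding ortho_compl_def
  by (auto simp: image_subset_iff) (metis cinner_adj_left)

lemma adj_invariant_ortho_compl:
  fixes T :: "'a::complex_hilbert \<Rightarrow>\<^sub>L 'a"
  assumes "T \<in> BH" "T ` M \<subseteq> M"
  shows "adj T ` ortho_compl M \<subseteq> ortho_compl M"
  using assms unfolding ortho_compl_def
  by (auto simp: image_subset_iff) (metis cinner_adj)

section \<open>Positive square roots\<close>

text \<open>A Cauchy-Schwarz inequality for the form of \<open>S\<close>. It turns smallness of the
  form at \<open>x\<close> into smallness of \<open>S x\<close>, and a lower bound on
  \<open>S x\<close> into one on the form.\<close>

lemma norm_power2_le_positive_form: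
  fixes S :: "'a::real_inner \<Rightarrow>\<^sub>L 'a"
  assumes "subspace W" "\<And>x. x \<in> W \<Longrightarrow> S x \<in> W"
    and sym: "\<And>x y. inner (S x) y = inner x (S y)"
    and pos: "\<And>x. x \<in> W \<Longrightarrow> 0 \<le> inner (S x) x"
    and "x \<in> W"
  shows "(norm (S x))\<^sup>2 \<le> norm S * inner (S x) x"
proof (cases "S = 0")
  case False
  \<comment> \<open>As \<open>t * norm S = 1\<close>, the quadratic term is at most
    \<open>t * (norm (S x))\<^sup>2\<close>, half of the linear term that is subtracted.\<close>
  define t where "t = 1 / norm S"
  have t: "t > 0" "t * norm S = 1" using False by (auto simp: t_def)
  have "x - t *\<^sub>R S x \<in> W" using assms by (simp add: subspace_diff subspace_scale)
  then have "0 \<le> inner (S (x - t *\<^sub>R S x)) (x - t *\<^sub>R S x)" by (rule pos)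
  also have "\<dots> = inner (S x) x - 2 * t * (norm (S x))\<^sup>2 + t\<^sup>2 * inner (S (S x)) (S x)"
    using sym[of "S x" x]
    by (simp add: blinfun.diff_right blinfun.scaleR_right inner_diff_left inner_diff_right
        dot_square_norm power2_eq_square[of t] algebra_simps)
  also have "t\<^sup>2 * inner (S (S x)) (S x) \<le> t\<^sup>2 * (norm S * (norm (S x))\<^sup>2)"
  proof (rule mult_left_mono)
    have "inner (S (S x)) (S x) \<le> norm (S (S x)) * norm (S x)" by (rule norm_cauchy_schwarz)
    also have "\<dots> \<le> norm S * norm (S x) * norm (S x)" by (intro mult_right_mono norm_blinfun) simp
    finally show "inner (S (S x)) (S x) \<le> norm S * (norm (S x))\<^sup>2"
      by (simp add: power2_eq_square mult.assoc)
  qed simp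
  also have "t\<^sup>2 * (norm S * (norm (S x))\<^sup>2) = t * (norm (S x))\<^sup>2"
    using t(2) by (simp add: power2_eq_square)
  finally have "t * (norm (S x))\<^sup>2 \<le> inner (S x) x" by simp
  then have "norm S * (t * (norm (S x))\<^sup>2) \<le> norm S * inner (S x) x" by (rule mult_left_mono) simp
  then show ?thesis using t(2) by (simp add: mult.assoc[symmetric] mult.commute)
qed simp

text \<open>A fixed point Y of this recursion satisfies (1 - Y)^2 = 1 - B, so the limit is 1 minus a
  square root of 1 - B. Each iterate is a polynomial in \<open>B\<close> and commutes with whatever
  commutes with \<open>B\<close>.\<close>

primrec sqrt_iter :: "('a::real_normed_vector \<Rightarrow>\<^sub>L 'a) \<Rightarrow> nat \<Rightarrow> 'a \<Rightarrow>\<^sub>L 'a" where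
  "sqrt_iter B 0 = 0"
| "sqrt_iter B (Suc n) = (1/2) *\<^sub>R (B + (sqrt_iter B n o\<^sub>L sqrt_iter B n))"

text \<open>The scalar recursion at \<open>B = 1\<close>, increasing and bounded by 1. Its values
  dominate the norms of the operator iterates and its increments those of their differences, which
  gives convergence even for \<open>norm B = 1\<close>.\<close>

primrec real_sqrt_iter :: "nat \<Rightarrow> real" where
  "real_sqrt_iter 0 = 0"
| "real_sqrt_iter (Suc n) = (1/2) * (1 + real_sqrt_iter n * real_sqrt_iter n)"

lemma real_sqrt_iter_bounds: "0 \<le> real_sqrt_iter n \<and> real_sqrt_iter n \<le> 1"
proof (induction n)
  case (Suc n)
  then have "real_sqrt_iter n * real_sqrt_iter n \<le> 1" by (simp add: mult_le_one)
  then show ?case by simp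
qed simp

lemma real_sqrt_iter_incseq: "incseq real_sqrt_iter"
proof (rule incseq_SucI)
  fix n
  have "0 \<le> (1 - real_sqrt_iter n)\<^sup>2" by simp
  then show "real_sqrt_iter n \<le> real_sqrt_iter (Suc n)"
    by (simp add: power2_eq_square algebra_simps)
qed

lemma sqrt_iter_commute:
  assumes "S o\<^sub>L B = B o\<^sub>L S"
  shows "S o\<^sub>L sqrt_iter B n = sqrt_iter B n o\<^sub>L S"
proof (induction n)
  case (Suc n)
  have 1: "S (B x) = B (S x)" for x by (metis assms blinfun_apply_blinfun_compose)
  have 2: "S (sqrt_iter B n x) = sqrt_iter B n (S x)" for x
    by (metis Suc blinfun_apply_blinfun_compose)
  show ?case
    by (rule blinfun_eqI) (simp add: 1 2 blinfun.bilinear_simps)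
qed simp

lemma norm_sqrt_iter_le:
  assumes "norm B \<le> 1"
  shows "norm (sqrt_iter B n) \<le> real_sqrt_iter n"
proof (induction n)
  case (Suc n)
  have "norm (sqrt_iter B n o\<^sub>L sqrt_iter B n) \<le> norm (sqrt_iter B n) * norm (sqrt_iter B n)"
    by (rule norm_blinfun_compose)
  also have "\<dots> \<le> real_sqrt_iter n * real_sqrt_iter n"
    using Suc by (intro mult_mono) (auto intro: order_trans[OF norm_ge_zero])
  finally have "norm (B + (sqrt_iter B n o\<^sub>L sqrt_iter B n)) \<le> 1 + real_sqrt_iter n * real_sqrt_iter n"
    using assms norm_triangle_ineq[of B "sqrt_iter B n o\<^sub>L sqrt_iter B n"] by linarith
  then show ?case by simp
qed simp

text \<open>Consecutive iterates commute, so that \<open>Y\<^sub>n\<^sub>+\<^sub>1\<^sup>2 - Y\<^sub>n\<^sup>2\<close> factors as a difference of squares.\<close>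

lemma norm_sqrt_iter_diff_Suc_le:
  assumes "norm B \<le> 1"
  shows "norm (sqrt_iter B (Suc n) - sqrt_iter B n) \<le> real_sqrt_iter (Suc n) - real_sqrt_iter n"
proof (induction n)
  case 0
  then show ?case using assms by simp
next
  case (Suc n)
  let ?Y = "sqrt_iter B (Suc n)" and ?Z = "sqrt_iter B n"
  let ?y = "real_sqrt_iter (Suc n)" and ?z = "real_sqrt_iter n"
  have "?Z o\<^sub>L B = B o\<^sub>L ?Z" using sqrt_iter_commute[of B B n] by simp
  then have "?Z o\<^sub>L ?Y = ?Y o\<^sub>L ?Z" by (rule sqrt_iter_commute)
  then have comm: "?Z (?Y x) = ?Y (?Z x)" for x by (metis blinfun_apply_blinfun_compose)
  have "sqrt_iter B (Suc (Suc n)) - ?Y = (1/2) *\<^sub>R ((?Y o\<^sub>L ?Y) - (?Z o\<^sub>L ?Z))"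
    using sqrt_iter.simps(2)[of B "Suc n"] sqrt_iter.simps(2)[of B n]
    by (metis add_diff_cancel_left scaleR_diff_right)
  also have "(?Y o\<^sub>L ?Y) - (?Z o\<^sub>L ?Z) = (?Y - ?Z) o\<^sub>L (?Y + ?Z)"
    by (rule blinfun_eqI) (simp add: comm blinfun.bilinear_simps del: sqrt_iter.simps)
  finally have "sqrt_iter B (Suc (Suc n)) - ?Y = (1/2) *\<^sub>R ((?Y - ?Z) o\<^sub>L (?Y + ?Z))" .
  then have "norm (sqrt_iter B (Suc (Suc n)) - ?Y) \<le> (1/2) * (norm (?Y - ?Z) * norm (?Y + ?Z))"
    using norm_blinfun_compose[of "?Y - ?Z" "?Y + ?Z"] by simp
  also have "norm (?Y - ?Z) * norm (?Y + ?Z) \<le> (?y - ?z) * (?y + ?z)"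
  proof (intro mult_mono Suc.IH)
    show "norm (?Y + ?Z) \<le> ?y + ?z"
      using norm_triangle_ineq[of ?Y ?Z] norm_sqrt_iter_le[OF assms, of "Suc n"]
        norm_sqrt_iter_le[OF assms, of n] by linarith
    show "0 \<le> ?y - ?z" using real_sqrt_iter_incseq by (simp add: incseq_SucD del: real_sqrt_iter.simps)
  qed simp
  also have "(1/2) * ((?y - ?z) * (?y + ?z)) = real_sqrt_iter (Suc (Suc n)) - ?y"
    using real_sqrt_iter.simps(2)[of "Suc n"] real_sqrt_iter.simps(2)[of n] by algebra
  finally show ?case by simp
qed

lemma sqrt_iter_convergent:
  fixes B :: "'a::banach \<Rightarrow>\<^sub>L 'a"
  assumes "norm B \<le> 1"
  shows "convergent (sqrt_iter B)"
proof -
  have "convergent real_sqrt_iter"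
    using real_sqrt_iter_incseq real_sqrt_iter_bounds incseq_convergent
    by (metis convergent_def)
  then have "summable (\<lambda>n. real_sqrt_iter (Suc n) - real_sqrt_iter n)"
    by (metis convergent_LIMSEQ_iff telescope_summable)
  then have "summable (\<lambda>n. sqrt_iter B (Suc n) - sqrt_iter B n)"
    using norm_sqrt_iter_diff_Suc_le[OF assms] by (rule summable_comparison_test'[where N=0])
  then have "convergent (\<lambda>n. \<Sum>k<n. sqrt_iter B (Suc k) - sqrt_iter B k)"
    by (simp only: summable_iff_convergent)
  then show ?thesis by (simp only: sum_lessThan_telescope sqrt_iter.simps(1) diff_zero)
qed

lemma sqrt_iter_symmetric:
  fixes B :: "'a::real_inner \<Rightarrow>\<^sub>L 'a"
  assumes "\<And>x y. inner (B x) y = inner x (B y)"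
  shows "inner (sqrt_iter B n x) y = inner x (sqrt_iter B n y)"
  by (induction n arbitrary: x y) (simp_all add: assms blinfun.bilinear_simps inner_simps)

lemma exists_sqrt_id_minus:
  fixes B :: "'a::{real_inner,banach} \<Rightarrow>\<^sub>L 'a"
  assumes "norm B \<le> 1" and sym: "\<And>x y. inner (B x) y = inner x (B y)"
  obtains P :: "'a \<Rightarrow>\<^sub>L 'a" where "P o\<^sub>L P = id_blinfun - B" "\<And>x y. inner (P x) y = inner x (P y)"
    "\<And>x. 0 \<le> inner (P x) x" "\<And>S. S o\<^sub>L B = B o\<^sub>L S \<Longrightarrow> S o\<^sub>L P = P o\<^sub>L S"
proof -
  obtain Y where Y: "sqrt_iter B \<longlonglongrightarrow> Y"
    using sqrt_iter_convergent[OF assms(1)] convergent_def by blast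
  have app: "(\<lambda>n. sqrt_iter B n x) \<longlonglongrightarrow> Y x" for x by (intro tendsto_intros Y)
  have "(\<lambda>n. sqrt_iter B (Suc n)) \<longlonglongrightarrow> (1/2) *\<^sub>R (B + (Y o\<^sub>L Y))"
    unfolding sqrt_iter.simps by (intro tendsto_intros Y)
  then have eq: "Y = (1/2) *\<^sub>R (B + (Y o\<^sub>L Y))"
    using LIMSEQ_unique LIMSEQ_Suc[OF Y] by blast
  have eqx: "2 *\<^sub>R Y x = B x + Y (Y x)" for x
    by (subst eq) (simp add: blinfun.bilinear_simps)
  have sy: "inner (Y x) y = inner x (Y y)" for x y
  proof (rule LIMSEQ_unique)
    show "(\<lambda>n. inner (sqrt_iter B n x) y) \<longlonglongrightarrow> inner (Y x) y" by (intro tendsto_intros app)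
    show "(\<lambda>n. inner (sqrt_iter B n x) y) \<longlonglongrightarrow> inner x (Y y)"
      unfolding sqrt_iter_symmetric[OF sym] by (intro tendsto_intros app)
  qed
  have "norm Y \<le> 1"
  proof (rule LIMSEQ_le_const2)
    show "(\<lambda>n. norm (sqrt_iter B n)) \<longlonglongrightarrow> norm Y" by (intro tendsto_intros Y)
    show "\<exists>N. \<forall>n\<ge>N. norm (sqrt_iter B n) \<le> 1"
      using norm_sqrt_iter_le[OF assms(1)] real_sqrt_iter_bounds order_trans by blast
  qed
  have "inner (Y x) x \<le> inner x x" for x
  proof -
    have "inner (Y x) x \<le> norm (Y x) * norm x" by (rule norm_cauchy_schwarz)
    also have "\<dots> \<le> norm Y * norm x * norm x" by (intro mult_right_mono norm_blinfun) simp
    also have "\<dots> \<le> 1 * norm x * norm x" by (intro mult_right_mono \<open>norm Y \<le> 1\<close>) simp_all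
    finally show ?thesis by (simp flip: power2_norm_eq_inner power2_eq_square)
  qed
  then have pos: "0 \<le> inner ((id_blinfun - Y) x) x" for x
    by (simp add: blinfun.bilinear_simps inner_simps)
  have sq: "(id_blinfun - Y) o\<^sub>L (id_blinfun - Y) = id_blinfun - B"
  proof (rule blinfun_eqI)
    fix x
    have "x - Y x - Y (x - Y x) = x - 2 *\<^sub>R Y x + Y (Y x)"
      by (simp add: blinfun.bilinear_simps scaleR_2)
    then show "((id_blinfun - Y) o\<^sub>L (id_blinfun - Y)) x = (id_blinfun - B) x"
      by (simp add: blinfun.bilinear_simps eqx)
  qed
  have comm: "S o\<^sub>L (id_blinfun - Y) = (id_blinfun - Y) o\<^sub>L S" if "S o\<^sub>L B = B o\<^sub>L S" for S
  proof -
    have "S o\<^sub>L Y = Y o\<^sub>L S"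
    proof (rule LIMSEQ_unique)
      show "(\<lambda>n. S o\<^sub>L sqrt_iter B n) \<longlonglongrightarrow> (S o\<^sub>L Y)" by (intro tendsto_intros Y)
      show "(\<lambda>n. S o\<^sub>L sqrt_iter B n) \<longlonglongrightarrow> (Y o\<^sub>L S)"
        unfolding sqrt_iter_commute[OF that] by (intro tendsto_intros Y)
    qed
    then have "S (Y x) = Y (S x)" for x by (metis blinfun_apply_blinfun_compose)
    then show ?thesis by (intro blinfun_eqI) (simp add: blinfun.bilinear_simps)
  qed
  show thesis
    by (rule that[OF sq _ pos comm]) (simp_all add: blinfun.bilinear_simps inner_simps sy)
qed

text \<open>Subtracting \<open>A / norm A\<close> from the identity gives an operator
  \<open>B\<close> to which the iteration applies, and rescaling by \<open>sqrt (norm A)\<close>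
  recovers the root of \<open>A\<close>. The commutation clause later yields uniqueness, complex
  linearity and compatibility with \<open>T\<close>.\<close>

lemma exists_positive_sqrt:
  fixes A :: "'a::{real_inner,banach} \<Rightarrow>\<^sub>L 'a"
  assumes sym: "\<And>x y. inner (A x) y = inner x (A y)" and pos: "\<And>x. 0 \<le> inner (A x) x"
  obtains P :: "'a \<Rightarrow>\<^sub>L 'a" where "P o\<^sub>L P = A" "\<And>x y. inner (P x) y = inner x (P y)"
    "\<And>x. 0 \<le> inner (P x) x" "\<And>S. S o\<^sub>L A = A o\<^sub>L S \<Longrightarrow> S o\<^sub>L P = P o\<^sub>L S"
proof (cases "A = 0")
  case True
  show thesis by (rule that[of 0]) (simp_all add: True)
next
  case False
  define k where "k = norm A"
  have k: "k > 0" using False by (simp add: k_def)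
  define B where "B = id_blinfun - (1 / k) *\<^sub>R A"
  have B: "B x = x - (1 / k) *\<^sub>R A x" for x by (simp add: B_def blinfun.bilinear_simps)
  have Bsym: "inner (B x) y = inner x (B y)" for x y by (simp add: B inner_simps sym)
  have Ale: "inner (A x) x \<le> k * inner x x" for x
  proof -
    have "inner (A x) x \<le> norm (A x) * norm x" by (rule norm_cauchy_schwarz)
    also have "\<dots> \<le> norm A * norm x * norm x" by (intro mult_right_mono norm_blinfun) simp
    finally show ?thesis by (simp add: k_def mult.assoc flip: power2_norm_eq_inner power2_eq_square)
  qed
  have Bpos: "0 \<le> inner (B x) x" for x
    using Ale[of x] k by (simp add: B inner_simps field_simps)
  have Ble: "inner (B x) x \<le> (norm x)\<^sup>2" for x
    using pos[of x] k by (simp add: B inner_simps power2_norm_eq_inner)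
  \<comment> \<open>The form of \<open>B\<close> lies between 0 and \<open>(norm x)\<^sup>2\<close>.
    The Cauchy-Schwarz bound turns this into \<open>norm B * norm B \<le> norm B\<close>, hence into
    the norm bound that the iteration requires.\<close>
  have "norm (B x) \<le> sqrt (norm B) * norm x" for x
  proof -
    have "(norm (B x))\<^sup>2 \<le> norm B * inner (B x) x"
      by (rule norm_power2_le_positive_form[OF subspace_UNIV _ Bsym Bpos]) simp_all
    also have "\<dots> \<le> norm B * (norm x)\<^sup>2" by (intro mult_left_mono Ble) simp
    also have "\<dots> = (sqrt (norm B) * norm x)\<^sup>2" by (simp add: power_mult_distrib)
    finally show ?thesis by (rule power2_le_imp_le) simp
  qed
  then have "norm B \<le> sqrt (norm B)" by (intro norm_blinfun_bound) simp_all
  then have "norm B * norm B \<le> sqrt (norm B) * sqrt (norm B)" by (intro mult_mono) simp_all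
  then have "norm B * norm B \<le> norm B" by simp
  then have B1: "norm B \<le> 1" by (cases "norm B = 0") (auto simp: mult_le_cancel_right1)
  obtain P :: "'a \<Rightarrow>\<^sub>L 'a" where P: "P o\<^sub>L P = id_blinfun - B"
    "\<And>x y. inner (P x) y = inner x (P y)" "\<And>x. 0 \<le> inner (P x) x"
    "\<And>S. S o\<^sub>L B = B o\<^sub>L S \<Longrightarrow> S o\<^sub>L P = P o\<^sub>L S"
    using exists_sqrt_id_minus[OF B1 Bsym] by blast
  have PP: "P (P x) = (1 / k) *\<^sub>R A x" for x
    using arg_cong[OF P(1), of "\<lambda>F. F x"] by (simp add: blinfun.bilinear_simps B)
  show thesis
  proof (rule that[of "sqrt k *\<^sub>R P"])
    show "sqrt k *\<^sub>R P o\<^sub>L sqrt k *\<^sub>R P = A"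
      using k by (intro blinfun_eqI) (simp add: blinfun.bilinear_simps PP)
    show "inner ((sqrt k *\<^sub>R P) x) y = inner x ((sqrt k *\<^sub>R P) y)" for x y
      by (simp add: blinfun.bilinear_simps P(2))
    show "0 \<le> inner ((sqrt k *\<^sub>R P) x) x" for x
      using k P(3) by (simp add: blinfun.bilinear_simps)
  next
    fix S assume "S o\<^sub>L A = A o\<^sub>L S"
    then have "S (A x) = A (S x)" for x by (metis blinfun_apply_blinfun_compose)
    then have "S o\<^sub>L B = B o\<^sub>L S"
      by (intro blinfun_eqI) (simp add: B blinfun.bilinear_simps)
    then have "S o\<^sub>L P = P o\<^sub>L S" by (rule P(4))
    then have "S (P x) = P (S x)" for x by (metis blinfun_apply_blinfun_compose)
    then show "S o\<^sub>L sqrt k *\<^sub>R P = sqrt k *\<^sub>R P o\<^sub>L S"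
      by (intro blinfun_eqI) (simp add: blinfun.bilinear_simps)
  qed
qed

text \<open>For \<open>y = P x - Q x\<close>, commutation gives \<open>P y + Q y = 0\<close>; by
  positivity both forms vanish at \<open>y\<close>, so \<open>P y = Q y = 0\<close>. Then
  \<open>inner y y = inner x (P y - Q y)\<close> is zero.\<close>

lemma positive_sqrt_unique:
  fixes P Q :: "'a::real_inner \<Rightarrow>\<^sub>L 'a"
  assumes sq: "P o\<^sub>L P = Q o\<^sub>L Q" and comm: "P o\<^sub>L Q = Q o\<^sub>L P"
    and symP: "\<And>x y. inner (P x) y = inner x (P y)" and posP: "\<And>x. 0 \<le> inner (P x) x"
    and symQ: "\<And>x y. inner (Q x) y = inner x (Q y)" and posQ: "\<And>x. 0 \<le> inner (Q x) x"
  shows "P = Q"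
proof (rule blinfun_eqI)
  fix x
  have PP: "P (P x) = Q (Q x)" for x by (metis sq blinfun_apply_blinfun_compose)
  have PQ: "P (Q x) = Q (P x)" for x by (metis comm blinfun_apply_blinfun_compose)
  define y where "y = P x - Q x"
  have "P y + Q y = 0" by (simp add: y_def blinfun.diff_right PP PQ)
  then have "inner (P y) y + inner (Q y) y = 0" by (metis inner_add_left inner_zero_left)
  then have *: "inner (P y) y = 0" "inner (Q y) y = 0" using posP[of y] posQ[of y] by linarith+
  have "(norm (P y))\<^sup>2 \<le> norm P * inner (P y) y"
    by (rule norm_power2_le_positive_form[OF subspace_UNIV _ symP posP]) simp_all
  then have Py: "P y = 0" using * by simp
  have "(norm (Q y))\<^sup>2 \<le> norm Q * inner (Q y) y"
    by (rule norm_power2_le_positive_form[OF subspace_UNIV _ symQ posQ]) simp_all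
  then have Qy: "Q y = 0" using * by simp
  have "inner y y = inner x (P y - Q y)"
    unfolding inner_diff_right by (metis y_def inner_diff_left symP symQ)
  then have "y = 0" by (simp add: Py Qy)
  then show "P x = Q x" by (simp add: y_def)
qed

section \<open>Absolutely norm attaining operators\<close>

lemma norm_apply_le_restr_norm:
  assumes "x \<in> M" "norm x = 1"
  shows "norm (blinfun_apply T x) \<le> restr_norm M T"
  unfolding restr_norm_def
proof (rule cSUP_upper)
  show "bdd_above ((\<lambda>x. norm (T x)) ` {x \<in> M. norm x = 1})"
  proof (rule bdd_aboveI2)
    show "norm (T x) \<le> norm T" if "x \<in> {x \<in> M. norm x = 1}" for x
      using norm_blinfun[of T x] that by simp
  qed
qed (use assms in auto)

lemma norm_power2_le_if_maximal:
  assumes "subspace M" "norm_attaining_on M T"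
  obtains e where "e \<in> M" "norm e = 1" "\<And>y. y \<in> M \<Longrightarrow> (norm (T y))\<^sup>2 \<le> (norm (T e))\<^sup>2 * (norm y)\<^sup>2"
proof -
  obtain e where e: "e \<in> M" "norm e = 1" "norm (T e) = restr_norm M T"
    using assms(2) by (auto simp: norm_attaining_on_def)
  have "(norm (T y))\<^sup>2 \<le> (norm (T e))\<^sup>2 * (norm y)\<^sup>2" if "y \<in> M" for y
  proof (cases "y = 0")
    case False
    have "norm (T ((1 / norm y) *\<^sub>R y)) \<le> norm (T e)"
      unfolding e(3) using that False assms(1)
      by (intro norm_apply_le_restr_norm) (auto simp: subspace_scale)
    then have "norm (T y) \<le> norm (T e) * norm y"
      using False by (simp add: blinfun.scaleR_right field_simps)
    then show ?thesis by (metis norm_ge_zero power_mono power_mult_distrib)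
  qed simp
  then show thesis using that e by blast
qed

text \<open>The first-order condition at a maximizer, obtained by perturbing \<open>e\<close> to
  \<open>e + t *\<^sub>R y\<close>. In a Hilbert space it says that \<open>e\<close> is an
  eigenvector of the compression of \<open>adj T o\<^sub>L T\<close> to \<open>M\<close>, with
  eigenvalue \<open>(norm (T e))\<^sup>2\<close>.\<close>

lemma inner_apply_eq_if_maximal:
  fixes T :: "'a::real_inner \<Rightarrow>\<^sub>L 'b::real_inner"
  assumes "subspace M" "e \<in> M" "norm e = 1" "y \<in> M"
    and max: "\<And>y. y \<in> M \<Longrightarrow> (norm (T y))\<^sup>2 \<le> (norm (T e))\<^sup>2 * (norm y)\<^sup>2"
  shows "inner (T e) (T y) = (norm (T e))\<^sup>2 * inner e y"
proof -
  let ?s = "(norm (T e))\<^sup>2"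
  have "0 \<le> 2 * t * (?s * inner e y - inner (T e) (T y)) + t\<^sup>2 * (?s * (norm y)\<^sup>2 - (norm (T y))\<^sup>2)" for t
  proof -
    have "(norm (T (e + t *\<^sub>R y)))\<^sup>2 \<le> ?s * (norm (e + t *\<^sub>R y))\<^sup>2"
      using assms by (intro max) (simp add: subspace_add subspace_scale)
    moreover have "(norm (T (e + t *\<^sub>R y)))\<^sup>2 = ?s + 2 * t * inner (T e) (T y) + t\<^sup>2 * (norm (T y))\<^sup>2"
      by (simp add: blinfun.bilinear_simps power2_norm_eq_inner inner_simps inner_commute
          power2_eq_square[of t] algebra_simps)
    moreover have "(norm (e + t *\<^sub>R y))\<^sup>2 = (norm e)\<^sup>2 + 2 * t * inner e y + t\<^sup>2 * (norm y)\<^sup>2"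
      by (simp add: power2_norm_eq_inner inner_simps inner_commute power2_eq_square[of t] algebra_simps)
    ultimately show ?thesis using assms(3) by (simp add: algebra_simps)
  qed
  from linear_coeff_eq_0_if_quadratic_nonneg[OF this] show ?thesis by simp
qed

text \<open>If \<open>low\<close> and \<open>high\<close> held for \<open>a < b\<close>, one could choose orthonormal \<open>x\<^sub>n\<close>, also orthogonal with
  respect to \<open>\<langle>S _, S _\<rangle>\<close>, such that \<open>\<parallel>S x\<^sub>n\<parallel>\<close> increases strictly. On the closed span of the \<open>x\<^sub>n\<close> the
  operator \<open>S\<close> does not attain its norm: a maximizer would be orthogonal to every \<open>x\<^sub>n\<close>.\<close>

lemma AN_gap:
  fixes S :: "'a::complex_hilbert \<Rightarrow>\<^sub>L 'a"
  assumes S: "S \<in> AN" and "a < b"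
    and low: "\<And>C. finite C \<Longrightarrow> \<exists>x. norm x = 1 \<and> (\<forall>c\<in>C. inner c x = 0) \<and> (norm (S x))\<^sup>2 \<le> a"
    and high: "\<And>C. finite C \<Longrightarrow> \<exists>x. norm x = 1 \<and> (\<forall>c\<in>C. inner c x = 0) \<and> b \<le> (norm (S x))\<^sup>2"
  shows False
proof -
  have SB: "S \<in> BH" using S by (simp add: AN_def)
  define A where "A = adj S o\<^sub>L S"
  have cA: "cinner (S x) (S y) = cinner (A x) y" "cinner (S x) (S y) = cinner x (A y)" for x y
    by (simp_all add: A_def cinner_adj[OF SB] cinner_adj_left[OF SB])
  have iA: "inner (S x) (S y) = inner (A x) y" "inner (S x) (S y) = inner x (A y)" for x y
    by (simp_all add: A_def inner_adj[OF SB] inner_adj_left[OF SB])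
  \<comment> \<open>An intermediate value argument: \<open>f\<close> and \<open>g\<close> are
    orthogonal and so are their images, hence for the vector
    \<open>sqrt t *\<^sub>R f + sqrt (1 - t) *\<^sub>R g\<close> the squared norm of the image is
    affine in \<open>t\<close>.\<close>
  have val: "\<exists>x. (norm x = 1 \<and> (norm (S x))\<^sup>2 = v) \<and> (\<forall>c\<in>C. inner c x = 0)"
    if "finite C" "a \<le> v" "v \<le> b" for C v
  proof -
    obtain f where f: "norm f = 1" "\<forall>c\<in>C. inner c f = 0" "(norm (S f))\<^sup>2 \<le> a"
      using low[OF \<open>finite C\<close>] by blast
    \<comment> \<open>Orthogonality of \<open>g\<close> to \<open>A f\<close> is orthogonality of
      \<open>S g\<close> to \<open>S f\<close>.\<close>
    obtain g where g: "norm g = 1" "\<forall>c\<in>insert f (insert (A f) C). inner c g = 0" "b \<le> (norm (S g))\<^sup>2"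
      using high[of "insert f (insert (A f) C)"] \<open>finite C\<close> by blast
    define p q where "p = (norm (S f))\<^sup>2" and "q = (norm (S g))\<^sup>2"
    define t where "t = (q - v) / (q - p)"
    have "p < q" using f g \<open>a < b\<close> by (simp add: p_def q_def)
    then have t: "0 \<le> t" "t \<le> 1" using that(2,3) f(3) g(3) by (auto simp: t_def simp flip: p_def q_def)
    have "t * (q - p) = q - v" using \<open>p < q\<close> by (simp add: t_def)
    then have tv: "t * p + (1 - t) * q = v" by (simp add: algebra_simps)
    define x where "x = sqrt t *\<^sub>R f + sqrt (1 - t) *\<^sub>R g"
    have fg: "inner f g = 0" "inner (S f) (S g) = 0" using g(2) by (auto simp: iA(1))
    have pyth: "(norm (r *\<^sub>R y + s *\<^sub>R z))\<^sup>2 = r\<^sup>2 * (norm y)\<^sup>2 + s\<^sup>2 * (norm z)\<^sup>2"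
      if "inner y z = 0" for r s and y z :: 'a
      using that by (simp add: power2_norm_eq_inner inner_simps inner_commute power2_eq_square[of r] power2_eq_square[of s])
    have "(norm x)\<^sup>2 = 1" using t f g by (simp add: x_def pyth[OF fg(1)])
    then have "norm x = 1" by (simp add: power2_eq_1_iff) (metis norm_ge_zero not_one_le_zero order.trans le_minus_one_simps(3))
    moreover have "(norm (S x))\<^sup>2 = v"
      using t tv by (simp add: x_def blinfun.bilinear_simps pyth[OF fg(2)] flip: p_def q_def)
    moreover have "\<forall>c\<in>C. inner c x = 0" using f g by (simp add: x_def inner_simps)
    ultimately show ?thesis by blast
  qed
  \<comment> \<open>\<open>v 0 = a\<close>, and the values increase strictly towards
    \<open>b\<close>, so that no \<open>X n\<close> can be maximal.\<close>
  define v where "v n = b - (b - a) * inverse (real (Suc n))" for n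
  have v: "a \<le> v n" "v n \<le> b" "v n < v (Suc n)" for n
  proof -
    have "(b - a) * inverse (real (Suc n)) \<le> (b - a) * 1"
      using \<open>a < b\<close> by (intro mult_left_mono) (auto simp: field_simps)
    then show "a \<le> v n" by (simp add: v_def)
    show "v n \<le> b" using \<open>a < b\<close> by (simp add: v_def)
    have "(b - a) * inverse (real (Suc (Suc n))) < (b - a) * inverse (real (Suc n))"
      using \<open>a < b\<close> by (intro mult_strict_left_mono) (auto simp: field_simps)
    then show "v n < v (Suc n)" by (simp add: v_def)
  qed
  \<comment> \<open>Real orthogonality to these four vectors is complex orthogonality of
    \<open>X n\<close> to \<open>X j\<close> and to \<open>A (X j)\<close>.\<close>
  have "\<exists>X. \<forall>n. (norm (X n) = 1 \<and> (norm (S (X n)))\<^sup>2 = v n) \<and>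
      (\<forall>j<n. \<forall>c\<in>{X j, \<i> *\<^sub>C X j, A (X j), \<i> *\<^sub>C A (X j)}. inner c (X n) = 0)"
    by (rule greedy_sequence) (use val v in auto)
  then obtain X where X: "\<And>n. norm (X n) = 1" "\<And>n. (norm (S (X n)))\<^sup>2 = v n"
    and orth: "\<And>n j. j < n \<Longrightarrow> \<forall>c\<in>{X j, \<i> *\<^sub>C X j, A (X j), \<i> *\<^sub>C A (X j)}. inner c (X n) = 0"
    by blast
  have lt: "cinner (X j) (X n) = 0 \<and> cinner (A (X j)) (X n) = 0" if "j < n" for j n
    using orth[OF that] by (simp add: cinner_eq_0_iff inner_scaleC_ii_right)
  have ne: "cinner (X j) (X n) = 0" "cinner (X j) (A (X n)) = 0" if "j \<noteq> n" for j n
  proof -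
    show "cinner (X j) (X n) = 0"
      using that lt[of j n] lt[of n j] cinner_eq_0_commute by (metis linorder_neqE_nat)
    show "cinner (X j) (A (X n)) = 0"
      using that lt[of j n] lt[of n j] cinner_eq_0_commute cA by (metis linorder_neqE_nat)
  qed
  \<comment> \<open>The double complement is the closed complex span of the sequence; its elements
    are orthogonal to whatever is orthogonal to every \<open>X n\<close>.\<close>
  define M where "M = ortho_compl (ortho_compl (range X))"
  have M: "closed_csubspace M" by (simp add: M_def)
  then have sM: "subspace M" "csubspace M" by (auto simp: closed_csubspace_def csubspace_imp_subspace)
  have XM: "X n \<in> M" for n using subset_ortho_compl_ortho_compl[of "range X"] by (auto simp: M_def)
  have "M \<noteq> {0}" using XM[of 0] X(1)[of 0] by auto
  then have "norm_attaining_on M S" using S M by (auto simp: AN_def)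
  from norm_power2_le_if_maximal[OF sM(1) this] obtain e where e: "e \<in> M" "norm e = 1"
    "\<And>y. y \<in> M \<Longrightarrow> (norm (S y))\<^sup>2 \<le> (norm (S e))\<^sup>2 * (norm y)\<^sup>2" by blast
  define s where "s = (norm (S e))\<^sup>2"
  have vs: "v n < s" for n
    using v(3)[of n] e(3)[OF XM, of "Suc n"] by (simp add: X s_def)
  \<comment> \<open>For the compression of \<open>A\<close> to \<open>M\<close>, \<open>X n\<close>
    is an eigenvector with eigenvalue \<open>v n\<close> and \<open>e\<close> is one with the larger
    eigenvalue \<open>s\<close>; hence they are orthogonal. The values 1 and \<open>\<i>\<close> of
    \<open>c\<close> give the two real conditions.\<close>
  have eX: "inner e (c *\<^sub>C X n) = 0" for c n
  proof -
    let ?z = "c *\<^sub>C X n"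
    have z: "?z \<in> M" using sM XM by (simp add: csubspace_iff)
    have "A ?z - v n *\<^sub>R ?z \<in> ortho_compl (range X)"
    proof -
      have "cinner (X j) (A ?z) = of_real (v n) * cinner (X j) ?z" for j
      proof (cases "j = n")
        case True
        have "cinner (X n) (A ?z) = cnj c * cinner (S (X n)) (S (X n))"
          by (simp add: BH_scaleC[OF SB] cinner_scaleC_right flip: cA(2))
        then show ?thesis using True by (simp add: cinner_self X cinner_scaleC_right)
      next
        case False
        then have "cinner (X j) (A ?z) = cnj c * cinner (X j) (A (X n))"
          by (simp add: BH_scaleC[OF SB] cinner_scaleC_right flip: cA(2))
        then show ?thesis using ne False by (simp add: cinner_scaleC_right)
      qed
      then show ?thesis by (auto simp: ortho_compl_def cinner_diff_right cinner_scaleR_right)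
    qed
    then have "cinner (A ?z - v n *\<^sub>R ?z) e = 0" using e(1) by (simp add: M_def ortho_compl_def)
    then have "inner e (A ?z) = v n * inner e ?z"
      by (simp add: cinner_eq_0_iff inner_diff_right inner_commute[of _ e])
    moreover have "inner e (A ?z) = s * inner e ?z"
      using inner_apply_eq_if_maximal[OF sM(1) e(1,2) z e(3)] by (simp add: iA(2) s_def)
    ultimately have "(s - v n) * inner e ?z = 0" by (simp add: algebra_simps)
    then show ?thesis using vs[of n] by simp
  qed
  have "cinner e (X n) = 0" for n
    using eX[of 1 n] eX[of \<i> n] by (simp add: cinner_eq_0_iff)
  then have "e \<in> ortho_compl (range X)" by (auto simp: ortho_compl_def cinner_eq_0_commute)
  then have "e = 0" using e(1) ortho_compl_Int unfolding M_def by blast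
  then show False using e(2) by simp
qed

lemma closure_AN_gap:
  fixes T :: "'a::complex_hilbert \<Rightarrow>\<^sub>L 'a"
  assumes T: "T \<in> closure AN" and "a < b"
    and low: "\<And>C. finite C \<Longrightarrow> \<exists>x. norm x = 1 \<and> (\<forall>c\<in>C. inner c x = 0) \<and> norm (T x) \<le> a"
    and high: "\<And>C. finite C \<Longrightarrow> \<exists>x. norm x = 1 \<and> (\<forall>c\<in>C. inner c x = 0) \<and> b \<le> norm (T x)"
  shows False
proof -
  \<comment> \<open>Replacing \<open>T\<close> by a nearby member of \<open>AN\<close> moves each
    threshold by at most \<open>d\<close>; a third of the gap leaves
    \<open>a + d < b - d\<close>.\<close>
  define d where "d = (b - a) / 3"
  have d: "d > 0" "a + d < b - d" using \<open>a < b\<close> by (auto simp: d_def field_simps)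
  have "a \<ge> 0" using low[of "{}"] norm_ge_zero order_trans by blast
  obtain S where S: "S \<in> AN" "dist S T < d" using T d(1) by (auto simp: closure_approachable)
  have near: "\<bar>norm (S x) - norm (T x)\<bar> \<le> d" if "norm x = 1" for x
  proof -
    have "\<bar>norm (S x) - norm (T x)\<bar> \<le> norm ((S - T) x)"
      by (simp add: blinfun.diff_left norm_triangle_ineq3)
    also have "\<dots> \<le> d" using norm_blinfun[of "S - T" x] S(2) that by (simp add: dist_norm)
    finally show ?thesis .
  qed
  show False
  proof (rule AN_gap[OF S(1)])
    show "(a + d)\<^sup>2 < (b - d)\<^sup>2" using d \<open>a \<ge> 0\<close> by (intro power_strict_mono) auto
  next
    fix C :: "'a set" assume "finite C"
    then obtain x where x: "norm x = 1" "\<forall>c\<in>C. inner c x = 0" "norm (T x) \<le> a" using low by blast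
    then have "norm (S x) \<le> a + d" using near[OF x(1)] by linarith
    then show "\<exists>x. norm x = 1 \<and> (\<forall>c\<in>C. inner c x = 0) \<and> (norm (S x))\<^sup>2 \<le> (a + d)\<^sup>2"
      using x by (metis norm_ge_zero power_mono)
  next
    fix C :: "'a set" assume "finite C"
    then obtain x where x: "norm x = 1" "\<forall>c\<in>C. inner c x = 0" "b \<le> norm (T x)" using high by blast
    then have "b - d \<le> norm (S x)" using near[OF x(1)] by linarith
    moreover have "0 \<le> b - d" using d \<open>a \<ge> 0\<close> by linarith
    ultimately show "\<exists>x. norm x = 1 \<and> (\<forall>c\<in>C. inner c x = 0) \<and> (b - d)\<^sup>2 \<le> (norm (S x))\<^sup>2"
      using x by (metis power_mono)
  qed
qed

text \<open>\<alpha> is the supremum of those \<open>b\<close> that no finite set of conditions can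
  keep \<open>norm (T x)\<close> below on unit vectors; infinite dimension puts 0 among them. Values
  from \<open>\<alpha> + \<epsilon>\<close> on are excluded by this choice, values up to
  \<open>\<alpha> - \<epsilon>\<close> because they would form a gap with some such
  \<open>b > \<alpha> - \<epsilon>\<close>.\<close>

lemma closure_AN_asymptotic_modulus:
  fixes T :: "'a::complex_hilbert \<Rightarrow>\<^sub>L 'a"
  assumes inf: "\<not> finite_cdim (UNIV :: 'a set)" and T: "T \<in> closure AN"
  obtains \<alpha> where "\<alpha> \<ge> 0" "\<And>\<epsilon>. \<epsilon> > 0 \<Longrightarrow> \<exists>C. finite C \<and>
    (\<forall>x. (\<forall>c\<in>C. inner c x = 0) \<longrightarrow> \<bar>norm (T x) - \<alpha> * norm x\<bar> \<le> \<epsilon> * norm x)"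
proof -
  define U where "U = {b. \<forall>C. finite C \<longrightarrow> (\<exists>x. norm x = 1 \<and> (\<forall>c\<in>C. inner c x = 0) \<and> b \<le> norm (T x))}"
  have "0 \<in> U"
  proof -
    have "\<exists>x. norm x = 1 \<and> (\<forall>c\<in>C. inner c x = 0)" if fin: "finite C" for C :: "'a set"
    proof -
      obtain x :: 'a where "x \<noteq> 0" "\<forall>c\<in>C. inner c x = 0"
        using inf_dim_orthogonal[OF fin subspace_UNIV] inf by (auto simp: finite_cdim_iff_span)
      then show ?thesis by (intro exI[of _ "(1 / norm x) *\<^sub>R x"]) simp
    qed
    then show ?thesis by (auto simp: U_def)
  qed
  have "b \<le> norm T" if "b \<in> U" for b
  proof -
    have "\<exists>x. norm x = 1 \<and> (\<forall>c\<in>{}. inner c x = 0) \<and> b \<le> norm (T x)"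
      using that unfolding U_def by blast
    then obtain x where "norm x = 1" "b \<le> norm (T x)" by blast
    then show ?thesis using norm_blinfun[of T x] by simp
  qed
  then have bdd: "bdd_above U" by (auto simp: bdd_above_def)
  define \<alpha> where "\<alpha> = Sup U"
  have "\<alpha> \<ge> 0" unfolding \<alpha>_def by (rule cSup_upper[OF \<open>0 \<in> U\<close> bdd])
  moreover have "\<exists>C. finite C \<and>
      (\<forall>x. (\<forall>c\<in>C. inner c x = 0) \<longrightarrow> \<bar>norm (T x) - \<alpha> * norm x\<bar> \<le> \<epsilon> * norm x)" if e: "\<epsilon> > 0" for \<epsilon>
  proof -
    have "\<alpha> + \<epsilon> \<notin> U" using cSup_upper[OF _ bdd, of "\<alpha> + \<epsilon>"] e by (auto simp: \<alpha>_def)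
    then have "\<exists>C. finite C \<and> (\<forall>x. norm x = 1 \<and> (\<forall>c\<in>C. inner c x = 0) \<longrightarrow> \<not> \<alpha> + \<epsilon> \<le> norm (T x))"
      unfolding U_def by blast
    then obtain C1 where C1: "finite C1"
      "\<And>x. norm x = 1 \<Longrightarrow> \<forall>c\<in>C1. inner c x = 0 \<Longrightarrow> norm (T x) < \<alpha> + \<epsilon>"
      by (auto simp: not_le)
    obtain b where b: "b \<in> U" "\<alpha> - \<epsilon> < b"
      using less_cSupD[of U "\<alpha> - \<epsilon>"] \<open>0 \<in> U\<close> e by (auto simp: \<alpha>_def)
    have "\<exists>C. finite C \<and> (\<forall>x. norm x = 1 \<and> (\<forall>c\<in>C. inner c x = 0) \<longrightarrow> \<not> norm (T x) \<le> \<alpha> - \<epsilon>)"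
    proof (rule ccontr)
      assume not: "\<not> ?thesis"
      show False
      proof (rule closure_AN_gap[OF T b(2)])
        fix C :: "'a set" assume "finite C"
        then show "\<exists>x. norm x = 1 \<and> (\<forall>c\<in>C. inner c x = 0) \<and> norm (T x) \<le> \<alpha> - \<epsilon>"
          using not by blast
        show "\<exists>x. norm x = 1 \<and> (\<forall>c\<in>C. inner c x = 0) \<and> b \<le> norm (T x)"
          using b(1) \<open>finite C\<close> by (simp add: U_def)
      qed
    qed
    then obtain C2 where C2: "finite C2"
      "\<And>x. norm x = 1 \<Longrightarrow> \<forall>c\<in>C2. inner c x = 0 \<Longrightarrow> \<alpha> - \<epsilon> < norm (T x)"
      by (auto simp: not_le)
    have "\<bar>norm (T x) - \<alpha> * norm x\<bar> \<le> \<epsilon> * norm x" if x: "\<forall>c\<in>C1 \<union> C2. inner c x = 0" for x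
    proof (cases "x = 0")
      case False
      let ?y = "(1 / norm x) *\<^sub>R x"
      have "\<bar>norm (T ?y) - \<alpha>\<bar> \<le> \<epsilon>" using C1(2)[of ?y] C2(2)[of ?y] False x by (simp add: abs_le_iff)
      then have "norm x * \<bar>norm (T ?y) - \<alpha>\<bar> \<le> norm x * \<epsilon>" by (rule mult_left_mono) simp
      moreover have "norm x * \<bar>norm (T ?y) - \<alpha>\<bar> = \<bar>norm x * (norm (T ?y) - \<alpha>)\<bar>"
        by (simp add: abs_mult)
      moreover have "norm x * (norm (T ?y) - \<alpha>) = norm (T x) - \<alpha> * norm x"
        using False by (simp add: blinfun.scaleR_right field_simps)
      ultimately show ?thesis by (simp add: mult.commute)
    qed simp
    then show ?thesis using C1(1) C2(1) by (intro exI[of _ "C1 \<union> C2"]) auto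
  qed
  ultimately show thesis by (rule that)
qed

section \<open>Operators that are asymptotically scalar\<close>

definition asymptotically_scalar :: "('a::real_inner \<Rightarrow>\<^sub>L 'a) \<Rightarrow> real \<Rightarrow> bool" where
  "asymptotically_scalar P \<alpha> \<longleftrightarrow> (\<forall>\<epsilon>>0. \<exists>C. finite C \<and>
     (\<forall>x. (\<forall>c\<in>C. inner c x = 0) \<longrightarrow> norm (P x - \<alpha> *\<^sub>R x) \<le> \<epsilon> * norm x))"

text \<open>Polarization at the unit vectors in the directions of \<open>x\<close> and
  \<open>K x\<close>, with the parallelogram law adding up the two bounds. In place of invariance of
  \<open>V\<close> it asks for \<open>K x \<in> V\<close>, which finitely many further conditions on
  \<open>x\<close> can achieve.\<close>

lemma symmetric_bound_from_form:
  fixes K :: "'a::real_inner \<Rightarrow>\<^sub>L 'a"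
  assumes sym: "\<And>x y. inner (K x) y = inner x (K y)" and V: "subspace V"
    and bound: "\<And>x. x \<in> V \<Longrightarrow> \<bar>inner (K x) x\<bar> \<le> \<eta> * (norm x)\<^sup>2"
    and x: "x \<in> V" "K x \<in> V"
  shows "norm (K x) \<le> \<eta> * norm x"
proof (cases "x = 0 \<or> K x = 0")
  case True
  have "0 \<le> \<eta> * norm x"
  proof (cases "x = 0")
    case False
    then show ?thesis using bound[OF x(1)] by (smt (verit) zero_le_mult_iff norm_ge_zero zero_less_norm_iff zero_less_power)
  qed simp
  then show ?thesis using True by auto
next
  case False
  define u where "u = (1 / norm x) *\<^sub>R x"
  define w where "w = (1 / norm (K x)) *\<^sub>R K x"
  have uw: "u \<in> V" "w \<in> V" "norm u = 1" "norm w = 1"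
    using x V False by (auto simp: u_def w_def subspace_scale)
  have "4 * inner (K u) w = inner (K (u + w)) (u + w) - inner (K (u - w)) (u - w)"
    using sym[of w u] by (simp add: blinfun.bilinear_simps inner_simps inner_commute)
  also have "\<dots> \<le> \<eta> * (norm (u + w))\<^sup>2 + \<eta> * (norm (u - w))\<^sup>2"
    using bound[of "u + w"] bound[of "u - w"] uw V
    by (simp add: subspace_add subspace_diff abs_le_iff)
  also have "\<dots> = \<eta> * ((norm (u + w))\<^sup>2 + (norm (u - w))\<^sup>2)" by (simp add: algebra_simps)
  also have "(norm (u + w))\<^sup>2 + (norm (u - w))\<^sup>2 = 2 * (norm u)\<^sup>2 + 2 * (norm w)\<^sup>2"
    by (simp add: power2_norm_eq_inner inner_simps inner_commute)
  finally have "inner (K u) w \<le> \<eta>" using uw by simp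
  moreover have "inner (K u) w = norm (K x) / norm x"
    using False by (simp add: u_def w_def blinfun.scaleR_right dot_square_norm power2_eq_square)
  ultimately show ?thesis using False by (simp add: field_simps)
qed

text \<open>The form of \<open>K = P\<^sup>2 - \<alpha>\<^sup>2\<close> is
  \<open>(norm (P x))\<^sup>2 - \<alpha>\<^sup>2 * (norm x)\<^sup>2\<close>, hence small, and by
  symmetry \<open>K x\<close> is small as well. Now \<open>K\<close> is \<open>P + \<alpha>\<close>
  applied after \<open>P - \<alpha>\<close>, and positivity of \<open>P\<close> bounds the first
  factor below by \<alpha>. For \<open>\<alpha> = 0\<close> hypothesis and conclusion agree.\<close>

lemma asymptotically_scalar_if_modulus:
  fixes P :: "'a::real_inner \<Rightarrow>\<^sub>L 'a"
  assumes sym: "\<And>x y. inner (P x) y = inner x (P y)" and pos: "\<And>x. 0 \<le> inner (P x) x"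
    and "\<alpha> \<ge> 0" and modulus: "\<And>\<epsilon>. \<epsilon> > 0 \<Longrightarrow> \<exists>C. finite C \<and>
      (\<forall>x. (\<forall>c\<in>C. inner c x = 0) \<longrightarrow> \<bar>norm (P x) - \<alpha> * norm x\<bar> \<le> \<epsilon> * norm x)"
  shows "asymptotically_scalar P \<alpha>"
proof (cases "\<alpha> = 0")
  case True
  then show ?thesis using modulus by (auto simp: asymptotically_scalar_def)
next
  case False
  then have "\<alpha> > 0" using \<open>\<alpha> \<ge> 0\<close> by simp
  define K where "K = (P o\<^sub>L P) - (\<alpha>\<^sup>2) *\<^sub>R id_blinfun"
  have K: "K x = P (P x) - \<alpha>\<^sup>2 *\<^sub>R x" for x by (simp add: K_def blinfun.bilinear_simps)
  have symK: "inner (K x) y = inner x (K y)" for x y by (simp add: K inner_simps sym)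
  show ?thesis
    unfolding asymptotically_scalar_def
  proof (intro allI impI)
    fix \<epsilon> :: real assume "\<epsilon> > 0"
    \<comment> \<open>\<open>M * norm x\<close> dominates
      \<open>norm (P x) + \<alpha> * norm x\<close>, so a tolerance of \<open>\<eta> / M\<close>
      bounds the form by \<eta>; with \<open>\<eta> = \<alpha> * \<epsilon>\<close>, division by
      \<alpha> leaves \<epsilon>.\<close>
    define M where "M = norm P + \<alpha>"
    have "M > 0" using \<open>\<alpha> > 0\<close> by (simp add: M_def add_nonneg_pos)
    define \<eta> where "\<eta> = \<alpha> * \<epsilon>"
    have "\<eta> > 0" using \<open>\<alpha> > 0\<close> \<open>\<epsilon> > 0\<close> by (simp add: \<eta>_def)
    then obtain C where C: "finite C"
      "\<And>x. \<forall>c\<in>C. inner c x = 0 \<Longrightarrow> \<bar>norm (P x) - \<alpha> * norm x\<bar> \<le> \<eta> / M * norm x"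
      using modulus[of "\<eta> / M"] \<open>M > 0\<close> by auto
    define V where "V = {x. \<forall>c\<in>C. inner c x = 0}"
    have V: "subspace V" by (auto simp: V_def subspace_def inner_simps)
    have bound: "\<bar>inner (K x) x\<bar> \<le> \<eta> * (norm x)\<^sup>2" if "x \<in> V" for x
    proof -
      have "inner (K x) x = (norm (P x))\<^sup>2 - \<alpha>\<^sup>2 * (norm x)\<^sup>2"
        by (simp add: K inner_simps sym power2_norm_eq_inner)
      also have "\<dots> = (norm (P x) - \<alpha> * norm x) * (norm (P x) + \<alpha> * norm x)"
        by (simp add: power2_eq_square algebra_simps)
      also have "\<bar>\<dots>\<bar> = \<bar>norm (P x) - \<alpha> * norm x\<bar> * (norm (P x) + \<alpha> * norm x)"
        using \<open>\<alpha> > 0\<close> by (simp add: abs_mult)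
      also have "\<dots> \<le> (\<eta> / M * norm x) * (M * norm x)"
      proof (rule mult_mono)
        show "norm (P x) + \<alpha> * norm x \<le> M * norm x"
          using norm_blinfun[of P x] by (simp add: M_def algebra_simps)
      qed (use C(2) that \<open>\<alpha> > 0\<close> \<open>\<eta> > 0\<close> \<open>M > 0\<close> in \<open>auto simp: V_def\<close>)
      also have "\<dots> = \<eta> * (norm x)\<^sup>2" using \<open>M > 0\<close> by (simp add: power2_eq_square)
      finally show ?thesis .
    qed
    \<comment> \<open>By symmetry, orthogonality of \<open>x\<close> to every \<open>K c\<close>
      puts \<open>K x\<close> into \<open>V\<close>.\<close>
    have "norm (P x - \<alpha> *\<^sub>R x) \<le> \<epsilon> * norm x" if x: "\<forall>c\<in>C \<union> K ` C. inner c x = 0" for x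
    proof -
      have "x \<in> V" "K x \<in> V" using x by (auto simp: V_def simp flip: symK)
      then have Kx: "norm (K x) \<le> \<eta> * norm x" using symmetric_bound_from_form[OF symK V bound] by blast
      define z where "z = P x - \<alpha> *\<^sub>R x"
      have "K x = P z + \<alpha> *\<^sub>R z"
        by (simp add: K z_def blinfun.bilinear_simps power2_eq_square scaleR_diff_right)
      then have "\<alpha> * (norm z)\<^sup>2 \<le> inner (K x) z"
        using pos[of z] by (simp add: inner_simps power2_norm_eq_inner)
      also have "\<dots> \<le> norm (K x) * norm z" by (rule norm_cauchy_schwarz)
      finally have "\<alpha> * norm z \<le> norm (K x)"
        by (cases "z = 0") (simp_all add: power2_eq_square)
      then have "\<alpha> * norm z \<le> \<alpha> * (\<epsilon> * norm x)" using Kx by (simp add: \<eta>_def mult.assoc)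
      then show ?thesis using \<open>\<alpha> > 0\<close> by (simp add: z_def)
    qed
    then show "\<exists>C. finite C \<and> (\<forall>x. (\<forall>c\<in>C. inner c x = 0) \<longrightarrow> norm (P x - \<alpha> *\<^sub>R x) \<le> \<epsilon> * norm x)"
      using C(1) by (intro exI[of _ "C \<union> K ` C"]) auto
  qed
qed

text \<open>The distance \<open>k\<close> between \<alpha> and \<open>N\<close> beats the error of
  \<open>P - \<alpha>\<close>, which is at most \<open>k / 2\<close> under finitely many conditions.
  \<open>N\<close> is general so as to cover real multiples of the identity as well as
  \<open>scalar_op c\<close>.\<close>

lemma asymptotically_scalar_diff_bounded_below:
  fixes P N :: "'a::real_inner \<Rightarrow>\<^sub>L 'a"
  assumes Q: "asymptotically_scalar P \<alpha>" and "k > 0"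
    and N: "\<And>x. k * norm x \<le> norm (\<alpha> *\<^sub>R x - N x)"
  obtains C where "finite C" "\<And>x. \<forall>c\<in>C. inner c x = 0 \<Longrightarrow> k / 2 * norm x \<le> norm ((P - N) x)"
proof -
  obtain C where C: "finite C" "\<And>x. \<forall>c\<in>C. inner c x = 0 \<Longrightarrow> norm (P x - \<alpha> *\<^sub>R x) \<le> k / 2 * norm x"
    using Q \<open>k > 0\<close> unfolding asymptotically_scalar_def by (metis half_gt_zero)
  have "k / 2 * norm x \<le> norm ((P - N) x)" if "\<forall>c\<in>C. inner c x = 0" for x
  proof -
    have "\<alpha> *\<^sub>R x - N x = (P - N) x - (P x - \<alpha> *\<^sub>R x)" by (simp add: blinfun.diff_left)
    then have "norm (\<alpha> *\<^sub>R x - N x) \<le> norm ((P - N) x) + norm (P x - \<alpha> *\<^sub>R x)"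
      by (metis norm_triangle_ineq4)
    then show ?thesis using C(2)[OF that] N[of x] by simp
  qed
  then show thesis using C(1) that by blast
qed

lemma asymptotically_scalar_bounded_below:
  fixes P N :: "'a::{real_inner,banach} \<Rightarrow>\<^sub>L 'a"
  assumes Q: "asymptotically_scalar P \<alpha>" and "k > 0"
    and N: "\<And>x. k * norm x \<le> norm (\<alpha> *\<^sub>R x - N x)"
    and W: "subspace W" "closed W" and inj: "\<And>x. x \<in> W \<Longrightarrow> P x = N x \<Longrightarrow> x = 0"
  shows "\<exists>\<delta>>0. \<forall>x\<in>W. \<delta> * norm x \<le> norm ((P - N) x)"
proof -
  obtain C where "finite C" "\<And>x. \<forall>c\<in>C. inner c x = 0 \<Longrightarrow> k / 2 * norm x \<le> norm ((P - N) x)"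
    using asymptotically_scalar_diff_bounded_below[OF Q \<open>k > 0\<close> N] by blast
  then show ?thesis
    using \<open>k > 0\<close> inj by (intro bounded_below_if_injective[OF _ W, of C "k / 2"]) (auto simp: blinfun.diff_left)
qed

lemma asymptotically_scalar_uminus:
  "asymptotically_scalar P \<alpha> \<Longrightarrow> asymptotically_scalar (- P) (- \<alpha>)"
proof -
  have "norm (- P x + \<alpha> *\<^sub>R x) = norm (P x - \<alpha> *\<^sub>R x)" for x
    by (metis minus_diff_eq norm_minus_cancel uminus_add_conv_diff)
  then show "asymptotically_scalar P \<alpha> \<Longrightarrow> asymptotically_scalar (- P) (- \<alpha>)"
    by (simp add: asymptotically_scalar_def blinfun.minus_left)
qed

text \<open>If the supremum \<open>s\<close> of the quadratic form on the unit sphere of \<open>W\<close> differs from \<open>\<alpha>\<close>, then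
  \<open>s - P\<close> is bounded below on \<open>W\<close>, so that the form stays away from \<open>s\<close>.\<close>

lemma form_le_if_no_eigenvectors:
  fixes P :: "'a::{real_inner,banach} \<Rightarrow>\<^sub>L 'a"
  assumes Q: "asymptotically_scalar P \<alpha>" and sym: "\<And>x y. inner (P x) y = inner x (P y)"
    and W: "subspace W" "closed W" "\<And>x. x \<in> W \<Longrightarrow> P x \<in> W"
    and no_eigen: "\<And>c x. x \<in> W \<Longrightarrow> P x = c *\<^sub>R x \<Longrightarrow> x = 0"
    and "x \<in> W"
  shows "inner (P x) x \<le> \<alpha> * (norm x)\<^sup>2"
proof (rule ccontr)
  assume contr: "\<not> ?thesis"
  define F where "F = (\<lambda>y. inner (P y) y) ` {y\<in>W. norm y = 1}"
  define s where "s = Sup F"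
  have scaled: "inner (P y) y = inner (P ((1 / norm y) *\<^sub>R y)) ((1 / norm y) *\<^sub>R y) * (norm y)\<^sup>2"
    if "y \<noteq> 0" for y using that by (simp add: blinfun.scaleR_right power2_eq_square)
  have "bdd_above F"
    unfolding F_def
  proof (rule bdd_aboveI2)
    show "inner (P y) y \<le> norm P" if "y \<in> {y\<in>W. norm y = 1}" for y
      using that norm_cauchy_schwarz[of "P y" y] norm_blinfun[of P y] by simp
  qed
  then have le_s: "inner (P y) y \<le> s * (norm y)\<^sup>2" if "y \<in> W" for y
  proof (cases "y = 0")
    case False
    have "inner (P ((1 / norm y) *\<^sub>R y)) ((1 / norm y) *\<^sub>R y) \<in> F"
      unfolding F_def using False that W(1) by (intro imageI) (simp add: subspace_scale)
    then have "inner (P ((1 / norm y) *\<^sub>R y)) ((1 / norm y) *\<^sub>R y) \<le> s"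
      using \<open>bdd_above F\<close> unfolding s_def by (rule cSup_upper)
    then show ?thesis unfolding scaled[OF False] by (rule mult_right_mono) simp
  qed simp
  have "x \<noteq> 0" using contr by auto
  have "\<alpha> * (norm x)\<^sup>2 < s * (norm x)\<^sup>2" using contr le_s[OF \<open>x \<in> W\<close>] by linarith
  then have "\<alpha> < s" using \<open>x \<noteq> 0\<close> by simp
  define S where "S = s *\<^sub>R id_blinfun - P"
  have S: "S y = s *\<^sub>R y - P y" for y by (simp add: S_def blinfun.bilinear_simps)
  have symS: "inner (S y) z = inner y (S z)" for y z by (simp add: S inner_simps sym)
  have posS: "0 \<le> inner (S y) y" if "y \<in> W" for y
    using le_s[OF that] by (simp add: S inner_simps power2_norm_eq_inner)
  have SW: "S y \<in> W" if "y \<in> W" for y using that W by (simp add: S subspace_diff subspace_scale)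
  have "\<exists>\<delta>>0. \<forall>y\<in>W. \<delta> * norm y \<le> norm ((P - s *\<^sub>R id_blinfun) y)"
  proof (rule asymptotically_scalar_bounded_below[OF Q _ _ W(1,2), of "s - \<alpha>"])
    show "(s - \<alpha>) * norm y \<le> norm (\<alpha> *\<^sub>R y - (s *\<^sub>R id_blinfun) y)" for y
      using \<open>\<alpha> < s\<close> by (simp add: blinfun.bilinear_simps flip: scaleR_diff_left)
  qed (use \<open>\<alpha> < s\<close> no_eigen in \<open>auto simp: blinfun.bilinear_simps\<close>)
  then obtain \<delta> where "\<delta> > 0" "\<And>y. y \<in> W \<Longrightarrow> \<delta> * norm y \<le> norm (P y - s *\<^sub>R y)"
    by (auto simp: blinfun.bilinear_simps)
  then have \<delta>: "\<delta> > 0" "\<And>y. y \<in> W \<Longrightarrow> \<delta> * norm y \<le> norm (S y)"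
    by (auto simp: S norm_minus_commute)
  have "0 < norm S * norm x"
    using \<delta>(1) \<delta>(2)[OF \<open>x \<in> W\<close>] \<open>x \<noteq> 0\<close> norm_blinfun[of S x]
    by (meson less_le_trans mult_pos_pos order_trans zero_less_norm_iff)
  then have "norm S > 0" by (simp add: zero_less_mult_iff)
  \<comment> \<open>The lower bound \<delta> on \<open>S\<close> passes to its form through
    \<open>(norm (S y))\<^sup>2 \<le> norm S * inner (S y) y\<close>, which keeps the values of the
    form of \<open>P\<close> below \<open>s\<close> by a fixed amount.\<close>
  have le: "f \<le> s - \<delta>\<^sup>2 / norm S" if "f \<in> F" for f
  proof -
    obtain y where y: "y \<in> W" "norm y = 1" "f = inner (P y) y" using \<open>f \<in> F\<close> by (auto simp: F_def)
    have "\<delta>\<^sup>2 \<le> (norm (S y))\<^sup>2" using \<delta>(2)[OF y(1)] \<delta>(1) y(2) by (intro power_mono) auto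
    also have "\<dots> \<le> norm S * inner (S y) y"
      by (rule norm_power2_le_positive_form[OF W(1) SW symS posS y(1)])
    also have "inner (S y) y = s - f" using y by (simp add: S inner_simps dot_square_norm)
    finally show ?thesis using \<open>norm S > 0\<close> by (simp add: field_simps)
  qed
  have "F \<noteq> {}"
    using \<open>x \<in> W\<close> \<open>x \<noteq> 0\<close> W(1) unfolding F_def
    by (auto intro!: exI[of _ "(1 / norm x) *\<^sub>R x"] simp: subspace_scale)
  then have "s \<le> s - \<delta>\<^sup>2 / norm S" unfolding s_def by (rule cSup_least) (use le in \<open>simp add: s_def\<close>)
  then show False using \<delta>(1) \<open>norm S > 0\<close> by (simp add: divide_le_0_iff)
qed

text \<open>On the orthogonal complement \<open>W\<close> of all eigenvectors the bound for
  \<open>P\<close> and the one for \<open>- P\<close> squeeze the form to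
  \<open>\<alpha> * (norm x)\<^sup>2\<close>. Hence \<open>P\<close> is \<alpha> on
  \<open>W\<close>, so a vector of \<open>W\<close> is an eigenvector and orthogonal to
  itself.\<close>

lemma eigenvectors_total:
  fixes P :: "'a::{real_inner,banach} \<Rightarrow>\<^sub>L 'a"
  assumes Q: "asymptotically_scalar P \<alpha>" and sym: "\<And>x y. inner (P x) y = inner x (P y)"
    and x: "\<And>\<mu> y. P y = \<mu> *\<^sub>R y \<Longrightarrow> inner y x = 0"
  shows "x = 0"
proof -
  define E where "E = {y. \<exists>\<mu>. P y = \<mu> *\<^sub>R y}"
  define W where "W = {x. \<forall>y\<in>E. inner y x = 0}"
  have sW: "subspace W" by (auto simp: W_def subspace_def inner_simps)
  have "W = (\<Inter>y\<in>E. {x. inner y x = 0})" by (auto simp: W_def)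
  moreover have "closed \<dots>"
    by (intro closed_INT ballI closed_Collect_eq continuous_intros)
  ultimately have cW: "closed W" by simp
  have PW: "P x \<in> W" if "x \<in> W" for x using that by (auto simp: W_def E_def simp flip: sym)
  have no: "x = 0" if "x \<in> W" "P x = c *\<^sub>R x" for c x
    using that unfolding W_def E_def by force
  have up: "inner (P x) x \<le> \<alpha> * (norm x)\<^sup>2" if "x \<in> W" for x
    by (rule form_le_if_no_eigenvectors[OF Q sym sW cW PW no that])
  have down: "inner ((- P) x) x \<le> - \<alpha> * (norm x)\<^sup>2" if "x \<in> W" for x
  proof (rule form_le_if_no_eigenvectors[OF asymptotically_scalar_uminus[OF Q] _ sW cW _ _ that])
    show "inner ((- P) x) y = inner x ((- P) y)" for x y by (simp add: blinfun.minus_left sym)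
    show "(- P) x \<in> W" if "x \<in> W" for x
      using PW[OF that] sW by (simp add: blinfun.minus_left subspace_neg)
    show "x = 0" if "x \<in> W" "(- P) x = c *\<^sub>R x" for c x
      using no[OF that(1), of "- c"] that(2)
      by (metis blinfun.minus_left minus_minus scaleR_minus_left)
  qed
  define K where "K = P - \<alpha> *\<^sub>R id_blinfun"
  have K: "K x = P x - \<alpha> *\<^sub>R x" for x by (simp add: K_def blinfun.bilinear_simps)
  have "x \<in> W" using x by (auto simp: W_def E_def)
  have "norm (K x) \<le> 0 * norm x"
  proof (rule symmetric_bound_from_form[OF _ sW])
    show "inner (K x) y = inner x (K y)" for x y by (simp add: K inner_simps sym)
    show "\<bar>inner (K x) x\<bar> \<le> 0 * (norm x)\<^sup>2" if "x \<in> W" for x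
      using up[OF that] down[OF that] by (simp add: K inner_simps blinfun.minus_left power2_norm_eq_inner)
    show "K x \<in> W" using \<open>x \<in> W\<close> PW sW by (simp add: K subspace_diff subspace_scale)
  qed fact
  then show ?thesis using no[OF \<open>x \<in> W\<close>, of \<alpha>] by (simp add: K)
qed

section \<open>Orthogonal direct sums\<close>

lemma span_UN_finite_sum:
  assumes M: "\<And>i. i \<in> I \<Longrightarrow> subspace (M i)" and y: "y \<in> span (\<Union>i\<in>I. M i)"
  shows "\<exists>F g. finite F \<and> F \<subseteq> I \<and> (\<forall>i\<in>I. g i \<in> M i) \<and> y = sum g F"
  using y
proof (induction rule: span_induct_alt)
  case base
  show ?case using M by (intro exI[of _ "{}"] exI[of _ "\<lambda>_. 0"]) (auto simp: subspace_0)
next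
  case (step c x y)
  then obtain F g i where F: "finite F" "F \<subseteq> I" "\<forall>i\<in>I. g i \<in> M i" "y = sum g F" "i \<in> I" "x \<in> M i"
    by blast
  let ?g = "\<lambda>j. (if j \<in> F then g j else 0) + (if j = i then c *\<^sub>R x else 0)"
  have "sum ?g (insert i F) = (\<Sum>j\<in>insert i F. if j \<in> F then g j else 0) +
      (\<Sum>j\<in>insert i F. if j = i then c *\<^sub>R x else 0)"
    by (rule sum.distrib)
  also have "(\<Sum>j\<in>insert i F. if j \<in> F then g j else 0) = sum g F"
    using F(1) by (intro sum.mono_neutral_cong_right) auto
  also have "(\<Sum>j\<in>insert i F. if j = i then c *\<^sub>R x else 0) = c *\<^sub>R x"
    using F(1) by simp
  finally have "sum ?g (insert i F) = c *\<^sub>R x + y" using F(4) by (simp add: add.commute)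
  moreover have "\<forall>j\<in>I. ?g j \<in> M j" using F M by (auto simp: subspace_0 subspace_add subspace_scale)
  ultimately show ?case using F by (intro exI[of _ "insert i F"] exI[of _ ?g]) auto
qed

lemma subspace_closure:
  fixes S :: "'a::real_normed_vector set"
  assumes "subspace S"
  shows "subspace (closure S)"
  unfolding subspace_def
proof (intro conjI ballI allI)
  show "0 \<in> closure S" using subspace_0[OF assms] closure_subset by blast
next
  fix x y assume "x \<in> closure S" "y \<in> closure S"
  then obtain f g where "\<And>n. f n \<in> S" "f \<longlonglongrightarrow> x" "\<And>n. g n \<in> S" "g \<longlonglongrightarrow> y"
    by (auto simp: closure_sequential)
  then have "\<And>n. f n + g n \<in> S" "(\<lambda>n. f n + g n) \<longlonglongrightarrow> x + y"
    using assms by (auto intro: subspace_add tendsto_add)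
  then show "x + y \<in> closure S" unfolding closure_sequential by (intro exI[of _ "\<lambda>n. f n + g n"]) blast
next
  fix c x assume "x \<in> closure S"
  then obtain f where "\<And>n. f n \<in> S" "f \<longlonglongrightarrow> x" by (auto simp: closure_sequential)
  then have "\<And>n. c *\<^sub>R f n \<in> S" "(\<lambda>n. c *\<^sub>R f n) \<longlonglongrightarrow> c *\<^sub>R x"
    using assms by (auto intro: subspace_scale tendsto_intros)
  then show "c *\<^sub>R x \<in> closure S" unfolding closure_sequential by (intro exI[of _ "\<lambda>n. c *\<^sub>R f n"]) blast
qed

text \<open>The partial sums over \<open>F\<close> of the projections are best approximations from the sum of the
  subspaces with index in \<open>F\<close>.\<close>

lemma has_sum_orthogonal_projections:
  fixes M :: "'i \<Rightarrow> 'a::{real_inner,banach} set"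
  assumes M: "\<And>i. i \<in> I \<Longrightarrow> subspace (M i)" "\<And>i. i \<in> I \<Longrightarrow> closed (M i)"
    and orth: "\<And>i j x y. i \<in> I \<Longrightarrow> j \<in> I \<Longrightarrow> i \<noteq> j \<Longrightarrow> x \<in> M i \<Longrightarrow> y \<in> M j \<Longrightarrow> inner x y = 0"
    and x: "x \<in> closure (span (\<Union>i\<in>I. M i))"
  shows "\<exists>f. (\<forall>i\<in>I. f i \<in> M i) \<and> (f has_sum x) I"
proof -
  have "\<exists>p. p \<in> M i \<and> (\<forall>y\<in>M i. inner y (x - p) = 0)" if "i \<in> I" for i
    by (rule projection_exists[OF M(1)[OF that] M(2)[OF that], of x]) blast
  then obtain f where f: "\<And>i. i \<in> I \<Longrightarrow> f i \<in> M i"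
    "\<And>i y. i \<in> I \<Longrightarrow> y \<in> M i \<Longrightarrow> inner y (x - f i) = 0" by metis
  have best: "norm (x - sum f F) \<le> norm (x - sum g F)"
    if F: "finite F" "F \<subseteq> I" and g: "\<And>i. i \<in> I \<Longrightarrow> g i \<in> M i" for F g
  proof -
    have 0: "inner y (x - sum f F) = 0" if "i \<in> F" "y \<in> M i" for i y
    proof -
      have "inner y (sum f F) = inner y (f i) + inner y (sum f (F - {i}))"
        using F that by (simp add: sum.remove[of F i] inner_add_right)
      also have "inner y (sum f (F - {i})) = 0"
        unfolding inner_sum_right using F that f(1) orth[of i _ y] by (intro sum.neutral) blast
      finally show ?thesis using f(2)[of i y] that F by (auto simp: inner_diff_right)
    qed
    define w where "w = sum f F - sum g F"
    have "w = (\<Sum>i\<in>F. f i - g i)" by (simp add: w_def sum_subtractf)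
    moreover have "inner (f i - g i) (x - sum f F) = 0" if "i \<in> F" for i
      using that F f(1) g M(1) by (intro 0[OF that]) (auto intro!: subspace_diff)
    ultimately have "inner w (x - sum f F) = 0" by (simp add: inner_sum_left)
    moreover have "x - sum g F = (x - sum f F) + w" by (simp add: w_def)
    moreover have "(norm (u + w))\<^sup>2 = (norm u)\<^sup>2 + 2 * inner w u + (norm w)\<^sup>2" for u
      by (simp add: power2_norm_eq_inner inner_add_left inner_add_right inner_commute)
    ultimately have "(norm (x - sum g F))\<^sup>2 = (norm (x - sum f F))\<^sup>2 + (norm w)\<^sup>2"
      by (metis add.right_neutral mult_zero_right)
    then have "(norm (x - sum f F))\<^sup>2 \<le> (norm (x - sum g F))\<^sup>2" by simp
    then show ?thesis by (rule power2_le_imp_le) simp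
  qed
  have "(f has_sum x) I"
    unfolding has_sum_def
  proof (rule tendstoI)
    fix e :: real assume "e > 0"
    then obtain y where y: "y \<in> span (\<Union>i\<in>I. M i)" "dist y x < e"
      using x by (auto simp: closure_approachable)
    obtain F g where F: "finite F" "F \<subseteq> I" "\<forall>i\<in>I. g i \<in> M i" "y = sum g F"
      using span_UN_finite_sum[OF M(1) y(1)] by blast
    have "dist (sum f F') x < e" if F': "finite F'" "F \<subseteq> F'" "F' \<subseteq> I" for F'
    proof -
      let ?g = "\<lambda>i. if i \<in> F then g i else 0"
      have "sum ?g F' = y"
        unfolding F(4) using F' by (intro sum.mono_neutral_cong_right) auto
      moreover have "norm (x - sum f F') \<le> norm (x - sum ?g F')"
        using F F' M(1) by (intro best) (auto simp: subspace_0)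
      ultimately show ?thesis using y(2) by (simp add: dist_norm norm_minus_commute)
    qed
    then show "\<forall>\<^sub>F F in finite_subsets_at_top I. dist (sum f F) x < e"
      using F by (auto simp: eventually_finite_subsets_at_top)
  qed
  then show ?thesis using f(1) by blast
qed

lemma has_sum_mem_closed_subspace:
  assumes "(f has_sum x) I" "\<And>i. i \<in> I \<Longrightarrow> f i \<in> S" "subspace S" "closed S"
  shows "x \<in> S"
proof (rule Lim_in_closed_set[OF assms(4)])
  show "(sum f \<longlongrightarrow> x) (finite_subsets_at_top I)" using assms(1) by (simp add: has_sum_def)
  show "\<forall>\<^sub>F F in finite_subsets_at_top I. sum f F \<in> S"
    using assms(2,3) by (intro eventually_finite_subsets_at_top_weakI subspace_sum) auto
qed simp

text \<open>Totality yields the expansions: the residual of projecting \<open>x \<in> S\<close> onto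
  the closed span of the \<open>M i\<close> stays in \<open>S\<close> and is orthogonal to every
  \<open>M i\<close>, so it vanishes and \<open>x\<close> lies in that closed span.\<close>

lemma direct_sumI:
  fixes M :: "'i \<Rightarrow> 'a::complex_hilbert set"
  assumes S: "closed_csubspace S" and M: "\<And>i. i \<in> I \<Longrightarrow> closed_csubspace (M i)"
    and sub: "\<And>i. i \<in> I \<Longrightarrow> M i \<subseteq> S"
    and orth: "\<And>i j x y. i \<in> I \<Longrightarrow> j \<in> I \<Longrightarrow> i \<noteq> j \<Longrightarrow> x \<in> M i \<Longrightarrow> y \<in> M j \<Longrightarrow> cinner x y = 0"
    and total: "\<And>x. x \<in> S \<Longrightarrow> (\<And>i y. i \<in> I \<Longrightarrow> y \<in> M i \<Longrightarrow> cinner y x = 0) \<Longrightarrow> x = 0"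
  shows "direct_sum I M S"
proof -
  have sM: "subspace (M i)" "closed (M i)" if "i \<in> I" for i
    using M[OF that] by (auto simp: closed_csubspace_def csubspace_imp_subspace)
  have sS: "subspace S" "closed S" using S by (auto simp: closed_csubspace_def csubspace_imp_subspace)
  let ?N = "closure (span (\<Union>i\<in>I. M i))"
  have NS: "?N \<subseteq> S" using sS sub by (intro closure_minimal span_minimal) auto
  have MN: "M i \<subseteq> ?N" if "i \<in> I" for i
    using that by (auto intro!: subsetD[OF closure_subset] span_base)
  have N: "subspace ?N" "closed ?N" by (auto intro: subspace_closure)
  have io: "inner x y = 0" if "i \<in> I" "j \<in> I" "i \<noteq> j" "x \<in> M i" "y \<in> M j" for i j x y
    using orth[OF that] by (simp add: cinner_eq_0_iff)
  have SN: "S \<subseteq> ?N"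
  proof
    fix x assume "x \<in> S"
    obtain p where p: "p \<in> ?N" "\<And>y. y \<in> ?N \<Longrightarrow> inner y (x - p) = 0"
      using projection_exists[OF N, of x] by blast
    have "x - p = 0"
    proof (rule total)
      show "x - p \<in> S" using \<open>x \<in> S\<close> p(1) NS sS by (auto intro: subspace_diff)
      fix i y assume i: "i \<in> I" and y: "y \<in> M i"
      have "x - p \<in> ortho_compl (M i)"
        using M[OF i] MN[OF i] p(2) by (subst mem_ortho_compl_iff) (auto simp: closed_csubspace_def)
      then show "cinner y (x - p) = 0" using y by (simp add: ortho_compl_def)
    qed
    then show "x \<in> ?N" using p(1) by simp
  qed
  have "\<exists>f. (\<forall>i\<in>I. f i \<in> M i) \<and> (f has_sum x) I" if "x \<in> S" for x
  proof -
    have "x \<in> closure (span (\<Union>i\<in>I. M i))" using SN that by blast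
    show ?thesis
    proof (rule has_sum_orthogonal_projections[OF sM _ \<open>x \<in> closure (span (\<Union>i\<in>I. M i))\<close>])
      show "inner x y = 0" if "i \<in> I" "j \<in> I" "i \<noteq> j" "x \<in> M i" "y \<in> M j" for i j x y
        by (rule io[OF that])
    qed
  qed
  moreover have "x \<in> S" if "\<forall>i\<in>I. f i \<in> M i" "(f has_sum x) I" for f x
    using has_sum_mem_closed_subspace[OF that(2) _ sS] that(1) sub by blast
  ultimately show ?thesis using S M orth unfolding direct_sum_def by blast
qed

lemma bounded_op_on_blinfun:
  fixes T :: "'a::complex_hilbert \<Rightarrow>\<^sub>L 'a"
  assumes "T \<in> BH" "T ` M \<subseteq> M"
  shows "bounded_op_on M T"
  using assms norm_blinfun[of T]
  by (auto simp: bounded_op_on_def blinfun.add_right BH_scaleC image_subset_iff)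

lemma bounded_op_on_cong:
  assumes "csubspace M" "\<And>x. x \<in> M \<Longrightarrow> A x = B x" "bounded_op_on M B"
  shows "bounded_op_on M A"
  using assms unfolding bounded_op_on_def csubspace_iff image_subset_iff by simp

lemma op_direct_sum_blinfun:
  fixes T :: "'a::complex_hilbert \<Rightarrow>\<^sub>L 'a"
  assumes T: "T \<in> BH" "T ` S \<subseteq> S" and ds: "direct_sum I M S"
    and M: "\<And>i. i \<in> I \<Longrightarrow> T ` M i \<subseteq> M i" and A: "\<And>i x. i \<in> I \<Longrightarrow> x \<in> M i \<Longrightarrow> A i x = T x"
  shows "op_direct_sum I M A S T"
proof -
  have "bounded_op_on (M i) (A i)" if "i \<in> I" for i
    using ds A that by (intro bounded_op_on_cong[OF _ _ bounded_op_on_blinfun[OF T(1) M[OF that]]])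
      (auto simp: direct_sum_def closed_csubspace_def)
  moreover have "((\<lambda>i. A i (f i)) has_sum T x) I" if "\<forall>i\<in>I. f i \<in> M i" "(f has_sum x) I" for f x
  proof -
    have "((\<lambda>i. T (f i)) has_sum T x) I"
      using has_sum_bounded_linear[OF blinfun.bounded_linear_right that(2), of T] by (simp add: o_def)
    then show ?thesis using that(1) A by (subst has_sum_cong[where g = "\<lambda>i. T (f i)"]) auto
  qed
  ultimately show ?thesis
    using bounded_op_on_blinfun[OF T] ds by (auto simp: op_direct_sum_def)
qed

section \<open>The modulus of an operator\<close>

text \<open>Over the complex numbers a real-valued form forces symmetry: polarizing at
  \<open>u + w\<close> gives an antisymmetry against \<open>\<i> *\<^sub>C w\<close>, which becomes
  symmetry for \<open>w = \<i> *\<^sub>C y\<close>.\<close>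

lemma positive_op_symmetric:
  assumes "positive_op P"
  shows "inner (P x) y = inner x (P y)"
proof -
  have BH: "P \<in> BH" and nn: "\<And>x. cinner (P x) x \<in> \<real>\<^sub>\<ge>\<^sub>0"
    using assms by (auto simp: positive_op_def)
  have z: "inner (P u) (\<i> *\<^sub>C u) = 0" for u
    using nn[of u] by (simp add: cinner_eq_Complex complex_nonneg_Reals_iff)
  have anti: "inner (P u) (\<i> *\<^sub>C w) = - inner (P w) (\<i> *\<^sub>C u)" for u w
    using z[of "u + w"] z[of u] z[of w]
    by (simp add: blinfun.add_right scaleC_add_right inner_simps)
  have "inner (P x) (\<i> *\<^sub>C \<i> *\<^sub>C y) = - inner (\<i> *\<^sub>C P y) (\<i> *\<^sub>C x)"
    using anti[of x "\<i> *\<^sub>C y"] by (simp only: BH_scaleC[OF BH])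
  moreover have "\<i> *\<^sub>C \<i> *\<^sub>C y = - y" by (simp add: scaleC_scaleC)
  ultimately show ?thesis by (simp add: inner_scaleC_ii inner_commute)
qed

lemma positive_op_inner_nonneg: "positive_op P \<Longrightarrow> 0 \<le> inner (P x) x"
  by (simp add: positive_op_def cinner_eq_Complex complex_nonneg_Reals_iff)

lemma positive_op_BH: "positive_op P \<Longrightarrow> P \<in> BH"
  by (simp add: positive_op_def)

lemma positive_opI:
  assumes "P \<in> BH" "\<And>x y. inner (P x) y = inner x (P y)" "\<And>x. 0 \<le> inner (P x) x"
  shows "positive_op P"
proof -
  have "inner (P x) (\<i> *\<^sub>C x) = 0" for x
    using assms(2)[of x "\<i> *\<^sub>C x"] BH_scaleC[OF assms(1), of \<i> x]
      inner_scaleC_ii_right[of x "P x"] inner_commute[of "P x" "\<i> *\<^sub>C x"] by simp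
  then show ?thesis
    using assms(1,3) by (simp add: positive_op_def cinner_eq_Complex complex_nonneg_Reals_iff)
qed

text \<open>The commutation property of the root \<open>P\<close> does the work. Commuting with
  \<open>scalar_op c\<close> makes it complex linear, and any other positive root \<open>Q\<close>
  commutes with its own square, hence with \<open>P\<close>, which gives uniqueness.\<close>

lemma
  fixes T :: "'a::complex_hilbert \<Rightarrow>\<^sub>L 'a"
  assumes T: "T \<in> BH"
  shows positive_abs_op: "positive_op (abs_op T)"
    and abs_op_square: "abs_op T o\<^sub>L abs_op T = adj T o\<^sub>L T"
    and abs_op_commute: "\<And>S. S o\<^sub>L (adj T o\<^sub>L T) = (adj T o\<^sub>L T) o\<^sub>L S \<Longrightarrow> S o\<^sub>L abs_op T = abs_op T o\<^sub>L S"
proof -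
  define A where "A = adj T o\<^sub>L T"
  have symA: "inner (A x) y = inner x (A y)" for x y
    by (simp add: A_def inner_adj[OF T] inner_adj_left[OF T])
  have posA: "0 \<le> inner (A x) x" for x by (simp add: A_def inner_adj_left[OF T])
  obtain P :: "'a \<Rightarrow>\<^sub>L 'a" where P: "P o\<^sub>L P = A" "\<And>x y. inner (P x) y = inner x (P y)"
    "\<And>x. 0 \<le> inner (P x) x" "\<And>S. S o\<^sub>L A = A o\<^sub>L S \<Longrightarrow> S o\<^sub>L P = P o\<^sub>L S"
    using exists_positive_sqrt[OF symA posA] by blast
  have A: "A \<in> BH" by (simp add: A_def BH_compose adj_in_BH T)
  have "P \<in> BH"
  proof -
    have "scalar_op c o\<^sub>L P = P o\<^sub>L scalar_op c" for c
      by (intro P(4) blinfun_eqI) (simp add: BH_scaleC[OF A])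
    then have "P (c *\<^sub>C x) = c *\<^sub>C P x" for c x
      by (metis blinfun_apply_blinfun_compose scalar_op_apply)
    then show ?thesis by (simp add: BH_def)
  qed
  then have pos: "positive_op P" using P by (intro positive_opI)
  have eq: "abs_op T = P"
    unfolding abs_op_def
  proof (rule the_equality)
    show "positive_op P \<and> P o\<^sub>L P = adj T o\<^sub>L T" using pos P(1) by (simp add: A_def)
  next
    fix Q assume Q: "positive_op Q \<and> Q o\<^sub>L Q = adj T o\<^sub>L T"
    then have QQ: "Q o\<^sub>L Q = A" by (simp add: A_def)
    have "Q o\<^sub>L P = P o\<^sub>L Q"
      by (rule P(4), rule blinfun_eqI) (simp flip: QQ)
    show "Q = P"
    proof (rule positive_sqrt_unique)
      show "Q o\<^sub>L Q = P o\<^sub>L P" by (simp add: QQ P(1))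
    qed (use Q P(2,3) \<open>Q o\<^sub>L P = P o\<^sub>L Q\<close> positive_op_symmetric positive_op_inner_nonneg in blast)+
  qed
  show "positive_op (abs_op T)" unfolding eq by (rule pos)
  show "abs_op T o\<^sub>L abs_op T = adj T o\<^sub>L T" unfolding eq P(1) A_def ..
  show "S o\<^sub>L abs_op T = abs_op T o\<^sub>L S" if "S o\<^sub>L (adj T o\<^sub>L T) = (adj T o\<^sub>L T) o\<^sub>L S" for S
    unfolding eq using that by (intro P(4)) (simp only: A_def)
qed

lemma norm_abs_op_apply:
  fixes T :: "'a::complex_hilbert \<Rightarrow>\<^sub>L 'a"
  assumes T: "T \<in> BH"
  shows "norm (abs_op T x) = norm (T x)"
proof -
  have "abs_op T (abs_op T x) = adj T (T x)"
    using abs_op_square[OF T] by (metis blinfun_apply_blinfun_compose)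
  then have "inner (abs_op T x) (abs_op T x) = inner (T x) (T x)"
    by (simp add: positive_op_symmetric[OF positive_abs_op[OF T]] inner_adj[OF T])
  then show ?thesis by (simp add: norm_eq_sqrt_inner)
qed

section \<open>Eigenspaces and spectrum\<close>

lemma mem_eigenspace: "x \<in> eigenspace P r \<longleftrightarrow> P x = r *\<^sub>R x"
  by (simp add: eigenspace_def null_space_def blinfun.diff_left scaleC_of_real)

lemma eigenspace_neq_0_iff: "eigenspace P r \<noteq> {0} \<longleftrightarrow> (\<exists>x. x \<noteq> 0 \<and> P x = r *\<^sub>R x)"
  by (auto simp: set_eq_iff mem_eigenspace)

lemma closed_csubspace_null_space:
  assumes "T \<in> BH"
  shows "closed_csubspace (null_space T)"
proof -
  have "csubspace (null_space T)"
    by (auto simp: csubspace_iff null_space_def blinfun.add_right BH_scaleC[OF assms])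
  moreover have "closed (null_space T)"
    unfolding null_space_def by (intro closed_Collect_eq continuous_intros)
  ultimately show ?thesis by (simp add: closed_csubspace_def)
qed

lemma closed_csubspace_eigenspace: "P \<in> BH \<Longrightarrow> closed_csubspace (eigenspace P r)"
  unfolding eigenspace_def by (intro closed_csubspace_null_space BH_diff) auto

lemma eigenspace_orthogonal:
  assumes P: "positive_op P" and "r \<noteq> s" "x \<in> eigenspace P r" "y \<in> eigenspace P s"
  shows "cinner x y = 0"
proof -
  have *: "inner x z = 0" if "z \<in> eigenspace P s" for z
    using positive_op_symmetric[OF P, of x z] assms that by (simp add: mem_eigenspace)
  have "\<i> *\<^sub>C y \<in> eigenspace P s"
    using closed_csubspace_eigenspace[OF positive_op_BH[OF P], of s] assms(4)
    by (simp add: closed_csubspace_def csubspace_iff)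
  then show ?thesis using * assms(4) by (simp add: cinner_eq_0_iff)
qed

lemma eigenspaces_total:
  fixes P :: "'a::complex_hilbert \<Rightarrow>\<^sub>L 'a"
  assumes "positive_op P" "asymptotically_scalar P \<alpha>"
    and "\<And>r y. y \<in> eigenspace P r \<Longrightarrow> cinner y x = 0"
  shows "x = 0"
  by (rule eigenvectors_total[OF assms(2) positive_op_symmetric[OF assms(1)]])
    (use assms(3) in \<open>auto simp: mem_eigenspace cinner_eq_0_iff\<close>)

lemma eigenvalue_in_spectrum:
  assumes "eigenspace P r \<noteq> {0}" "P \<in> BH"
  shows "complex_of_real r \<in> spectrum P"
proof -
  obtain x where "x \<noteq> 0" "P x = r *\<^sub>R x" using assms(1) eigenspace_neq_0_iff by blast
  then have x: "x \<noteq> 0" "(P - scalar_op (of_real r)) x = 0"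
    by (simp_all add: blinfun.diff_left scaleC_of_real)
  have "S o\<^sub>L (P - scalar_op (of_real r)) \<noteq> id_blinfun" for S
    using x by (metis blinfun.zero_right blinfun_apply_blinfun_compose blinfun_apply_id_blinfun)
  then show ?thesis by (auto simp: spectrum_def)
qed

lemma invertible_if_bounded_below:
  fixes L :: "'a::complex_hilbert \<Rightarrow>\<^sub>L 'a"
  assumes L: "L \<in> BH" and "\<delta> > 0" and below: "\<And>x. \<delta> * norm x \<le> norm (L x)"
    and dense: "\<And>y. (\<And>x. inner (L x) y = 0) \<Longrightarrow> y = 0"
  shows "\<exists>S\<in>BH. S o\<^sub>L L = id_blinfun \<and> L o\<^sub>L S = id_blinfun"
proof -
  have cl: "closed (range L)"
    using bounded_below_image_closed[of UNIV \<delta> L] \<open>\<delta> > 0\<close> below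
    by (simp add: complete_imp_closed complete_UNIV)
  have sub: "subspace (range L)"
    by (simp add: linear_subspace_image blinfun.bounded_linear_right bounded_linear.linear)
  have surj: "\<exists>x. L x = y" for y
  proof -
    obtain p where p: "p \<in> range L" "\<And>z. z \<in> range L \<Longrightarrow> inner z (y - p) = 0"
      using projection_exists[OF sub cl, of y] by blast
    have "y - p = 0" by (rule dense) (use p(2) in blast)
    then show ?thesis using p(1) by auto
  qed
  then obtain S where S: "\<And>y. L (S y) = y" by metis
  have inj: "x = y" if "L x = L y" for x y
    using below[of "x - y"] that \<open>\<delta> > 0\<close>
    by (simp add: blinfun.diff_right) (metis less_le_not_le mult_pos_pos right_minus_eq zero_less_norm_iff)
  have "bounded_linear S"
  proof (rule bounded_linear_intro[where K = "1 / \<delta>"])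
    show "S (x + y) = S x + S y" for x y by (rule inj) (simp add: S blinfun.add_right)
    show "S (r *\<^sub>R x) = r *\<^sub>R S x" for r x by (rule inj) (simp add: S blinfun.scaleR_right)
    show "norm (S x) \<le> norm x * (1 / \<delta>)" for x
      using below[of "S x"] \<open>\<delta> > 0\<close> by (simp add: S field_simps)
  qed
  then have app: "blinfun_apply (Blinfun S) = S" by (rule bounded_linear_Blinfun_apply)
  have "S (c *\<^sub>C x) = c *\<^sub>C S x" for c x by (rule inj) (simp add: S BH_scaleC[OF L])
  moreover have "S (L x) = x" for x by (rule inj) (simp add: S)
  ultimately show ?thesis
    by (intro bexI[of _ "Blinfun S"] conjI blinfun_eqI) (simp_all add: BH_def app S)
qed

lemma norm_scaleR_diff_scaleC:
  "norm (\<alpha> *\<^sub>R x - scalar_op c x) = cmod (of_real \<alpha> - c) * norm (x::'a::complex_hilbert)"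
  by (simp add: norm_scaleC flip: scaleC_of_real scaleC.scale_left_diff_distrib)

text \<open>A Fredholm alternative: if \<open>r \<noteq> \<alpha>\<close> is no eigenvalue,
  \<open>P - r\<close> is injective and therefore bounded below; by symmetry its range is also
  dense, so it is invertible.\<close>

lemma spectrum_iff_eigenvalue:
  fixes P :: "'a::complex_hilbert \<Rightarrow>\<^sub>L 'a"
  assumes P: "positive_op P" and Q: "asymptotically_scalar P \<alpha>" and "r \<noteq> \<alpha>"
  shows "complex_of_real r \<in> spectrum P \<longleftrightarrow> eigenspace P r \<noteq> {0}"
proof
  show "complex_of_real r \<in> spectrum P" if "eigenspace P r \<noteq> {0}"
    using that positive_op_BH[OF P] by (rule eigenvalue_in_spectrum)
next
  assume r: "complex_of_real r \<in> spectrum P"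
  show "eigenspace P r \<noteq> {0}"
  proof
    assume E: "eigenspace P r = {0}"
    let ?N = "scalar_op (complex_of_real r) :: 'a \<Rightarrow>\<^sub>L 'a"
    have zero: "x = 0" if "P x = ?N x" for x
      using that E by (simp add: mem_eigenspace scaleC_of_real set_eq_iff)
    have sym: "inner ((P - ?N) x) y = inner x ((P - ?N) y)" for x y
      by (simp add: blinfun.diff_left inner_simps positive_op_symmetric[OF P] scaleC_of_real)
    have "\<exists>\<delta>>0. \<forall>x\<in>UNIV. \<delta> * norm x \<le> norm ((P - ?N) x)"
      by (rule asymptotically_scalar_bounded_below[OF Q, of "cmod (of_real \<alpha> - of_real r)"])
        (use \<open>r \<noteq> \<alpha>\<close> zero in \<open>auto simp: norm_scaleR_diff_scaleC simp del: scalar_op_apply\<close>)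
    then obtain \<delta> where \<delta>: "\<delta> > 0" "\<And>x. \<delta> * norm x \<le> norm ((P - ?N) x)" by blast
    have "\<exists>S\<in>BH. S o\<^sub>L (P - ?N) = id_blinfun \<and> (P - ?N) o\<^sub>L S = id_blinfun"
    proof (rule invertible_if_bounded_below[OF _ \<delta>])
      show "P - ?N \<in> BH" using P by (simp add: BH_diff positive_op_BH)
      show "y = 0" if "\<And>x. inner ((P - ?N) x) y = 0" for y
      proof (rule zero)
        have "inner ((P - ?N) y) ((P - ?N) y) = 0" using that[of "(P - ?N) y"] by (simp only: sym)
        then show "P y = ?N y" by (simp add: blinfun.diff_left)
      qed
    qed
    then show False using r unfolding spectrum_def by blast
  qed
qed

text \<open>The last two bounds ensure that \<open>{\<alpha><..norm T}\<close> and
  \<open>{min_modulus T..<\<alpha>}\<close> contain every eigenvalue on their side of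
  \<alpha>.\<close>

lemma eigenvalue_bounds:
  fixes T :: "'a::complex_hilbert \<Rightarrow>\<^sub>L 'a"
  assumes T: "T \<in> BH" and "eigenspace (abs_op T) r \<noteq> {0}"
  shows "0 \<le> r" "min_modulus T \<le> r" "r \<le> norm T"
proof -
  let ?P = "abs_op T"
  obtain y where y: "y \<noteq> 0" "?P y = r *\<^sub>R y" using assms(2) eigenspace_neq_0_iff by blast
  define x where "x = (1 / norm y) *\<^sub>R y"
  have x: "norm x = 1" "?P x = r *\<^sub>R x" using y by (auto simp: x_def blinfun.scaleR_right)
  have "0 \<le> inner (?P x) x" by (rule positive_op_inner_nonneg[OF positive_abs_op[OF T]])
  then show "0 \<le> r" using x by (simp add: dot_square_norm)
  then have Tx: "norm (T x) = r" using x by (simp flip: norm_abs_op_apply[OF T])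
  have "min_modulus T \<le> norm (T x)"
    unfolding min_modulus_def using x(1)
    by (intro cINF_lower) (auto intro: bdd_belowI2[where m = 0])
  then show "min_modulus T \<le> r" by (simp add: Tx)
  show "r \<le> norm T" using norm_blinfun[of T x] x by (simp add: Tx)
qed

section \<open>The essential spectrum\<close>

text \<open>An infinite-dimensional kernel would contain a nonzero vector satisfying the finitely
  many conditions under which \<open>P - scalar_op c\<close> is bounded below.\<close>

lemma finite_cdim_null_space_diff:
  fixes P :: "'a::complex_hilbert \<Rightarrow>\<^sub>L 'a"
  assumes P: "P \<in> BH" and Q: "asymptotically_scalar P \<alpha>" and c: "c \<noteq> complex_of_real \<alpha>"
  shows "finite_cdim (null_space (P - scalar_op c))"
proof (rule ccontr)
  let ?k = "cmod (of_real \<alpha> - c)"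
  assume inf: "\<not> ?thesis"
  obtain C where C: "finite C"
    "\<And>x. \<forall>d\<in>C. inner d x = 0 \<Longrightarrow> ?k / 2 * norm x \<le> norm ((P - scalar_op c) x)"
    using asymptotically_scalar_diff_bounded_below[OF Q, of ?k "scalar_op c"] c
    by (auto simp: norm_scaleR_diff_scaleC simp del: scalar_op_apply)
  have "subspace (null_space (P - scalar_op c))"
    using closed_csubspace_null_space[of "P - scalar_op c"] P
    by (simp add: closed_csubspace_def csubspace_imp_subspace BH_diff)
  then obtain x where "x \<in> null_space (P - scalar_op c)" "x \<noteq> 0" "\<forall>d\<in>C. inner d x = 0"
    using inf_dim_orthogonal[OF C(1)] inf unfolding finite_cdim_iff_span by blast
  then show False using C(2)[of x] c by (simp add: null_space_def mult_le_0_iff)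
qed

lemma adj_diff_scalar_op:
  assumes "positive_op P"
  shows "adj (P - scalar_op c) = P - scalar_op (cnj c)"
proof (rule adj_unique)
  have BH: "P \<in> BH" using assms by (rule positive_op_BH)
  show "P - scalar_op (cnj c) \<in> BH" using BH by (simp add: BH_diff)
  fix x y
  have "cinner (P x) y = cinner x (P y)"
    using positive_op_symmetric[OF assms, of x y] positive_op_symmetric[OF assms, of x "\<i> *\<^sub>C y"]
    by (simp add: cinner_eq_Complex BH_scaleC[OF BH])
  then show "cinner ((P - scalar_op c) x) y = cinner x ((P - scalar_op (cnj c)) y)"
    by (simp add: blinfun.diff_left cinner_diff_left cinner_diff_right cinner_scaleC_left cinner_scaleC_right)
qed

text \<open>Restriction to the complement of the kernel makes the operator injective, hence bounded
  below with closed image, and keeps its range. The adjoint subtracts \<open>cnj c\<close>, which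
  differs from the real number \<alpha> as \<open>c\<close> does.\<close>

lemma Fredholm_diff_scalar_op:
  fixes P :: "'a::complex_hilbert \<Rightarrow>\<^sub>L 'a"
  assumes P: "positive_op P" and Q: "asymptotically_scalar P \<alpha>" and c: "c \<noteq> complex_of_real \<alpha>"
  shows "Fredholm (P - scalar_op c)"
proof -
  define L where "L = P - scalar_op c"
  define N where "N = null_space L"
  have L: "L \<in> BH" using P by (simp add: L_def BH_diff positive_op_BH)
  have N: "csubspace N" "subspace N" "closed N"
    using closed_csubspace_null_space[OF L]
    by (auto simp: N_def closed_csubspace_def csubspace_imp_subspace)
  define W where "W = ortho_compl N"
  have W: "subspace W" "closed W"
    using closed_csubspace_ortho_compl[of N]
    by (auto simp: W_def closed_csubspace_def csubspace_imp_subspace)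
  have "\<exists>\<delta>>0. \<forall>x\<in>W. \<delta> * norm x \<le> norm (L x)"
    unfolding L_def
  proof (rule asymptotically_scalar_bounded_below[OF Q _ _ W])
    show "0 < cmod (of_real \<alpha> - c)" using c by simp
    show "cmod (of_real \<alpha> - c) * norm x \<le> norm (\<alpha> *\<^sub>R x - scalar_op c x)" for x :: 'a
      by (simp only: norm_scaleR_diff_scaleC)
    show "x = 0" if "x \<in> W" "P x = scalar_op c x" for x
    proof -
      have "x \<in> N" using that(2) by (simp add: N_def null_space_def L_def blinfun.diff_left)
      then show ?thesis using that(1) by (auto simp: W_def ortho_compl_def)
    qed
  qed
  then obtain \<delta> where \<delta>: "\<delta> > 0" "\<And>x. x \<in> W \<Longrightarrow> \<delta> * norm x \<le> norm (L x)" by blast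
  have "complete (L ` W)"
    using bounded_below_image_closed[OF _ W(1) \<delta>] W(2) by (simp add: complete_eq_closed)
  moreover have "range L = L ` W"
  proof -
    have "L x \<in> L ` W" for x
    proof -
      obtain p where p: "p \<in> N" "\<And>y. y \<in> N \<Longrightarrow> inner y (x - p) = 0"
        using projection_exists[OF N(2,3), of x] by blast
      have "x - p \<in> W" unfolding W_def mem_ortho_compl_iff[OF N(1)] using p(2) by blast
      moreover have "L (x - p) = L x" using p(1) by (simp add: blinfun.diff_right N_def null_space_def)
      ultimately show ?thesis by (metis imageI)
    qed
    then show ?thesis by blast
  qed
  ultimately have "closed (range L)" by (simp add: complete_imp_closed)
  moreover have "cnj c \<noteq> of_real \<alpha>" using c by (metis complex_cnj_cnj complex_cnj_complex_of_real)
  ultimately show ?thesis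
    using finite_cdim_null_space_diff[OF positive_op_BH[OF P] Q] c
    by (simp add: Fredholm_def L_def adj_diff_scalar_op[OF P])
qed

text \<open>On the span \<open>F\<close> of these eigenspaces, orthogonality makes
  \<open>P - \<alpha>\<close> bounded below by \<epsilon>, while finitely many conditions make it at
  most \<open>\<epsilon> / 2\<close>. So \<open>F\<close> is finite dimensional, and one eigenvector
  per eigenvalue gives an independent set in it.\<close>

lemma finite_eigenvalues_away:
  fixes P :: "'a::complex_hilbert \<Rightarrow>\<^sub>L 'a"
  assumes P: "positive_op P" and Q: "asymptotically_scalar P \<alpha>" and "\<epsilon> > 0"
  shows "finite {r. \<epsilon> \<le> \<bar>r - \<alpha>\<bar> \<and> eigenspace P r \<noteq> {0}}"
proof -
  define I where "I = {r. \<epsilon> \<le> \<bar>r - \<alpha>\<bar> \<and> eigenspace P r \<noteq> {0}}"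
  define F where "F = span (\<Union>r\<in>I. eigenspace P r)"
  have sE: "subspace (eigenspace P r)" for r
    using closed_csubspace_eigenspace[OF positive_op_BH[OF P]]
    by (simp add: closed_csubspace_def csubspace_imp_subspace)
  have orth: "inner x y = 0" if "r \<noteq> s" "x \<in> eigenspace P r" "y \<in> eigenspace P s" for r s x y
    using eigenspace_orthogonal[OF P that] by (simp add: cinner_eq_0_iff)
  have below: "\<epsilon> * norm x \<le> norm (P x - \<alpha> *\<^sub>R x)" if xF: "x \<in> F" for x
  proof -
    obtain R g where R: "finite R" "R \<subseteq> I" "\<forall>r\<in>I. g r \<in> eigenspace P r" "x = sum g R"
      using span_UN_finite_sum[of I "eigenspace P" x, OF sE xF[unfolded F_def]] by blast
    have o1: "pairwise (\<lambda>r s. orthogonal (g r) (g s)) R"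
    proof (rule pairwiseI)
      show "orthogonal (g r) (g s)" if "r \<in> R" "s \<in> R" "r \<noteq> s" for r s
        using orth[OF that(3), of "g r" "g s"] R(2,3) that by (auto simp: orthogonal_def)
    qed
    have o2: "pairwise (\<lambda>r s. orthogonal ((r - \<alpha>) *\<^sub>R g r) ((s - \<alpha>) *\<^sub>R g s)) R"
      using o1 by (simp add: pairwise_def orthogonal_def)
    have "P x - \<alpha> *\<^sub>R x = (\<Sum>r\<in>R. (r - \<alpha>) *\<^sub>R g r)"
    proof -
      have "P x = (\<Sum>r\<in>R. r *\<^sub>R g r)"
        unfolding R(4) blinfun.sum_right using R(2,3) by (intro sum.cong) (auto simp: mem_eigenspace)
      then show ?thesis by (simp add: R(4) scaleR_sum_right scaleR_diff_left sum_subtractf)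
    qed
    then have "(norm (P x - \<alpha> *\<^sub>R x))\<^sup>2 = (\<Sum>r\<in>R. (norm ((r - \<alpha>) *\<^sub>R g r))\<^sup>2)"
      using norm_sum_Pythagorean[OF R(1) o2] by simp
    also have "\<dots> \<ge> (\<Sum>r\<in>R. \<epsilon>\<^sup>2 * (norm (g r))\<^sup>2)"
    proof (rule sum_mono)
      fix r assume "r \<in> R"
      then have "\<epsilon> \<le> \<bar>r - \<alpha>\<bar>" using R(2) by (auto simp: I_def)
      then have "(\<epsilon> * norm (g r))\<^sup>2 \<le> (norm ((r - \<alpha>) *\<^sub>R g r))\<^sup>2"
        using \<open>\<epsilon> > 0\<close> by (intro power_mono) (auto intro: mult_right_mono)
      then show "\<epsilon>\<^sup>2 * (norm (g r))\<^sup>2 \<le> (norm ((r - \<alpha>) *\<^sub>R g r))\<^sup>2" by (simp only: power_mult_distrib)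
    qed
    also have "(\<Sum>r\<in>R. \<epsilon>\<^sup>2 * (norm (g r))\<^sup>2) = (\<epsilon> * norm x)\<^sup>2"
      using norm_sum_Pythagorean[OF R(1) o1] by (simp add: R(4) power_mult_distrib sum_distrib_left)
    finally show ?thesis by (rule power2_le_imp_le) simp
  qed
  obtain C where C: "finite C" "\<And>x. \<forall>c\<in>C. inner c x = 0 \<Longrightarrow> norm (P x - \<alpha> *\<^sub>R x) \<le> \<epsilon> / 2 * norm x"
    using Q \<open>\<epsilon> > 0\<close> unfolding asymptotically_scalar_def by (metis half_gt_zero)
  have "\<exists>B. finite B \<and> F \<subseteq> span B"
  proof (rule ccontr)
    assume "\<not> ?thesis"
    then obtain x where x: "x \<in> F" "x \<noteq> 0" "\<forall>c\<in>C. inner c x = 0"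
      using inf_dim_orthogonal[OF C(1), of F] by (auto simp: F_def)
    then have "\<epsilon> * norm x \<le> \<epsilon> / 2 * norm x" using below[of x] C(2)[of x] by linarith
    then show False using \<open>x \<noteq> 0\<close> \<open>\<epsilon> > 0\<close> by simp
  qed
  then obtain B where B: "finite B" "F \<subseteq> span B" by blast
  have "\<exists>x. x \<noteq> 0 \<and> x \<in> eigenspace P r" if "r \<in> I" for r
    using that eigenspace_neq_0_iff[of P r] unfolding I_def mem_eigenspace by blast
  then obtain e where e: "\<And>r. r \<in> I \<Longrightarrow> e r \<noteq> 0" "\<And>r. r \<in> I \<Longrightarrow> e r \<in> eigenspace P r" by metis
  have eo: "inner (e r) (e s) = 0" if "r \<in> I" "s \<in> I" "r \<noteq> s" for r s
    using orth[OF that(3) e(2) e(2)] that by blast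
  have inj: "inj_on e I"
  proof (rule inj_onI)
    fix r s assume "r \<in> I" "s \<in> I" "e r = e s"
    then show "r = s" using eo[of r s] e(1)[of r] by (cases "r = s") auto
  qed
  have "pairwise orthogonal (e ` I)" "0 \<notin> e ` I"
    using eo e(1) by (auto simp: pairwise_def orthogonal_def)
  then have "independent (e ` I)" by (rule pairwise_orthogonal_independent)
  moreover have "e ` I \<subseteq> span B" using B(2) e(2) unfolding F_def by (blast intro: span_base)
  ultimately have "finite (e ` I)" using independent_span_bound[OF B(1)] by blast
  then show ?thesis using inj finite_imageD unfolding I_def by blast
qed

text \<open>Otherwise there would be finitely many eigenvalues in all, each with a
  finite-dimensional eigenspace, and a nonzero vector orthogonal to all these spaces would
  contradict totality.\<close>

lemma infinite_eigenvalues_near: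
  fixes P :: "'a::complex_hilbert \<Rightarrow>\<^sub>L 'a"
  assumes inf: "\<not> finite_cdim (UNIV :: 'a set)"
    and P: "positive_op P" and Q: "asymptotically_scalar P \<alpha>"
    and null: "finite_cdim (eigenspace P \<alpha>)" and "\<epsilon> > 0"
  shows "infinite {r. r \<noteq> \<alpha> \<and> \<bar>r - \<alpha>\<bar> < \<epsilon> \<and> eigenspace P r \<noteq> {0}}"
proof
  assume fin: "finite {r. r \<noteq> \<alpha> \<and> \<bar>r - \<alpha>\<bar> < \<epsilon> \<and> eigenspace P r \<noteq> {0}}"
  let ?J = "{r. eigenspace P r \<noteq> {0}}"
  have "?J \<subseteq> insert \<alpha> ({r. r \<noteq> \<alpha> \<and> \<bar>r - \<alpha>\<bar> < \<epsilon> \<and> eigenspace P r \<noteq> {0}} \<union>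
      {r. \<epsilon> \<le> \<bar>r - \<alpha>\<bar> \<and> eigenspace P r \<noteq> {0}})" by auto
  then have J: "finite ?J"
    using fin finite_eigenvalues_away[OF P Q \<open>\<epsilon> > 0\<close>] by (auto intro: finite_subset)
  have "finite_cdim (eigenspace P r)" for r
  proof (cases "r = \<alpha>")
    case False
    then show ?thesis
      unfolding eigenspace_def using finite_cdim_null_space_diff[OF positive_op_BH[OF P] Q] by simp
  qed (use null in simp)
  then obtain B where B: "\<And>r. finite (B r)" "\<And>r. eigenspace P r \<subseteq> span (B r)"
    unfolding finite_cdim_iff_span by metis
  have fin_B: "finite (\<Union>r\<in>?J. B r)" using J B(1) by blast
  have "\<exists>x\<in>UNIV. x \<noteq> 0 \<and> (\<forall>c\<in>(\<Union>r\<in>?J. B r). inner c x = 0)"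
    by (rule inf_dim_orthogonal[OF fin_B subspace_UNIV]) (use inf in \<open>simp add: finite_cdim_iff_span\<close>)
  then obtain x :: 'a where x: "x \<noteq> 0" "\<forall>c\<in>(\<Union>r\<in>?J. B r). inner c x = 0" by blast
  have xE: "inner y x = 0" if "y \<in> eigenspace P r" for r y
  proof (cases "y = 0")
    case False
    then have r: "r \<in> ?J" using that by auto
    have "subspace {y. inner y x = 0}" by (auto simp: subspace_def inner_simps)
    moreover have "B r \<subseteq> {y. inner y x = 0}" using x(2) r by auto
    ultimately have "span (B r) \<subseteq> {y. inner y x = 0}" by (intro span_minimal)
    then show ?thesis using that B(2) by blast
  qed simp
  have "x = 0"
    by (rule eigenvectors_total[OF Q positive_op_symmetric[OF P]]) (use xE in \<open>auto simp: mem_eigenspace\<close>)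
  then show False using x(1) by simp
qed

text \<open>With unit eigenvectors \<open>e\<^sub>n\<close> for eigenvalues \<open>\<rho>\<^sub>n\<close> that converge rapidly to \<open>\<alpha>\<close>, the vector
  \<open>\<Sum>n. 2\<^sup>n (\<rho>\<^sub>n - \<alpha>) e\<^sub>n\<close> lies in the closure of the range of \<open>P - \<alpha>\<close>, but its only possible
  preimage would have the unbounded coefficients \<open>2\<^sup>n\<close>.\<close>

lemma not_Fredholm_diff_asymptotic_scalar:
  fixes P :: "'a::complex_hilbert \<Rightarrow>\<^sub>L 'a"
  assumes inf: "\<not> finite_cdim (UNIV :: 'a set)"
    and P: "positive_op P" and Q: "asymptotically_scalar P \<alpha>"
  shows "\<not> Fredholm (P - scalar_op (of_real \<alpha>))"
proof
  define L where "L = P - scalar_op (of_real \<alpha>)"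
  have L: "L x = P x - \<alpha> *\<^sub>R x" for x by (simp add: L_def blinfun.diff_left scaleC_of_real)
  assume "Fredholm (P - scalar_op (of_real \<alpha>))"
  then have cl: "closed (range L)" and null: "finite_cdim (eigenspace P \<alpha>)"
    by (auto simp: Fredholm_def L_def eigenspace_def)
  \<comment> \<open>The rate \<open>(1/4) ^ n\<close> outweighs the factors \<open>2 ^ n\<close>,
    leaving terms of norm at most \<open>(1/2) ^ n\<close>; avoiding \<open>C\<close> makes the
    eigenvalues distinct.\<close>
  have ex: "\<exists>r. (r \<noteq> \<alpha> \<and> \<bar>r - \<alpha>\<bar> < (1/4) ^ n \<and> eigenspace P r \<noteq> {0}) \<and> (\<forall>c\<in>C. c \<noteq> r)"
    if "finite C" for n :: nat and C
  proof -
    have "\<not> {r. r \<noteq> \<alpha> \<and> \<bar>r - \<alpha>\<bar> < (1/4) ^ n \<and> eigenspace P r \<noteq> {0}} \<subseteq> C"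
      using infinite_eigenvalues_near[OF inf P Q null, of "(1/4)^n"] that finite_subset by auto
    then show ?thesis by blast
  qed
  have "\<exists>\<rho>. \<forall>n. (\<rho> n \<noteq> \<alpha> \<and> \<bar>\<rho> n - \<alpha>\<bar> < (1/4) ^ n \<and> eigenspace P (\<rho> n) \<noteq> {0}) \<and>
      (\<forall>j<n. \<forall>c\<in>{\<rho> j}. c \<noteq> \<rho> n)"
    by (rule greedy_sequence[where P = "\<lambda>n r. r \<noteq> \<alpha> \<and> \<bar>r - \<alpha>\<bar> < (1/4) ^ n \<and> eigenspace P r \<noteq> {0}"
          and Q = "(\<noteq>)" and R = "\<lambda>r. {r}", OF ex]) auto
  then obtain \<rho> where all: "\<forall>n. (\<rho> n \<noteq> \<alpha> \<and> \<bar>\<rho> n - \<alpha>\<bar> < (1/4) ^ n \<and> eigenspace P (\<rho> n) \<noteq> {0}) \<and>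
      (\<forall>j<n. \<forall>c\<in>{\<rho> j}. c \<noteq> \<rho> n)" ..
  have \<rho>: "\<And>n. \<rho> n \<noteq> \<alpha>" "\<And>n. \<bar>\<rho> n - \<alpha>\<bar> < (1/4) ^ n" "\<And>n. eigenspace P (\<rho> n) \<noteq> {0}"
    and less: "\<And>j n. j < n \<Longrightarrow> \<rho> j \<noteq> \<rho> n"
    using all by simp_all
  have neq: "\<rho> j \<noteq> \<rho> n" if "j \<noteq> n" for j n
    using less[of j n] less[of n j] that by (cases j n rule: linorder_cases) auto
  have "\<exists>x. norm x = 1 \<and> P x = \<rho> n *\<^sub>R x" for n
  proof -
    obtain x where "x \<noteq> 0" "P x = \<rho> n *\<^sub>R x" using \<rho>(3) eigenspace_neq_0_iff by blast
    then show ?thesis by (intro exI[of _ "(1 / norm x) *\<^sub>R x"]) (simp add: blinfun.scaleR_right)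
  qed
  then obtain e where e: "\<And>n. norm (e n) = 1" "\<And>n. P (e n) = \<rho> n *\<^sub>R e n" by metis
  have orth: "inner (e j) (e n) = 0" if "j \<noteq> n" for j n
    using eigenspace_orthogonal[OF P neq[OF that], of "e j" "e n"] e(2)
    by (simp add: mem_eigenspace cinner_eq_0_iff)
  define h where "h n = (2 ^ n * (\<rho> n - \<alpha>)) *\<^sub>R e n" for n
  have Le: "L (e n) = (\<rho> n - \<alpha>) *\<^sub>R e n" for n by (simp add: L e(2) scaleR_diff_left)
  have hL: "h n = L (2 ^ n *\<^sub>R e n)" for n by (simp add: h_def blinfun.scaleR_right Le)
  have "norm (h n) \<le> (1/2) ^ n" for n
  proof -
    have "norm (h n) = 2 ^ n * \<bar>\<rho> n - \<alpha>\<bar>" by (simp add: h_def e(1) abs_mult)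
    also have "\<dots> \<le> 2 ^ n * (1/4) ^ n" using \<rho>(2)[of n] by (intro mult_left_mono) auto
    also have "\<dots> = (1/2) ^ n" by (simp flip: power_mult_distrib)
    finally show ?thesis .
  qed
  moreover have "summable (\<lambda>n. (1/2) ^ n :: real)" by (rule summable_geometric) simp
  ultimately have "summable h" by (intro summable_comparison_test'[of "\<lambda>n. (1/2) ^ n" 0 h])
  then obtain y where y: "h sums y" by (auto simp: summable_def)
  have "y \<in> range L"
  proof (rule Lim_in_closed_set[OF cl])
    show "(\<lambda>n. sum h {..<n}) \<longlonglongrightarrow> y" using y by (simp add: sums_def)
    have "sum h {..<n} = L (\<Sum>k<n. 2 ^ k *\<^sub>R e k)" for n by (simp add: hL blinfun.sum_right)
    then show "\<forall>\<^sub>F n in sequentially. sum h {..<n} \<in> range L" by auto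
  qed simp
  then obtain x where x: "y = L x" by blast
  \<comment> \<open>By symmetry of \<open>L\<close> the coefficient of \<open>L x\<close> at
    \<open>e k\<close> is \<open>\<rho> k - \<alpha>\<close> times that of \<open>x\<close>, and
    this nonzero factor cancels.\<close>
  have coeff: "inner x (e k) = 2 ^ k" for k
  proof -
    have "(\<lambda>n. inner (h n) (e k)) sums inner y (e k)"
      by (rule bounded_linear.sums[OF bounded_linear_inner_left y])
    moreover have "inner (h n) (e k) = (if n = k then 2 ^ k * (\<rho> k - \<alpha>) else 0)" for n
      using orth[of n k] e(1)[of k] by (auto simp: h_def dot_square_norm)
    ultimately have "(\<lambda>n. if n = k then 2 ^ k * (\<rho> k - \<alpha>) else 0) sums inner y (e k)" by simp
    then have "inner y (e k) = 2 ^ k * (\<rho> k - \<alpha>)"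
      using sums_single[of k "\<lambda>_. 2 ^ k * (\<rho> k - \<alpha>)"] sums_unique2 by blast
    moreover have "inner y (e k) = (\<rho> k - \<alpha>) * inner x (e k)"
    proof -
      have "inner (L x) (e k) = inner x (L (e k))"
        by (simp add: L inner_simps positive_op_symmetric[OF P])
      then show ?thesis by (simp add: x Le)
    qed
    ultimately show ?thesis using \<rho>(1)[of k] by simp
  qed
  obtain k where "norm x < 2 ^ k" using real_arch_pow[of 2 "norm x"] by auto
  moreover have "inner x (e k) \<le> norm x" using norm_cauchy_schwarz[of x "e k"] e(1) by simp
  ultimately show False by (simp add: coeff)
qed

lemma ess_spectrum_asymptotically_scalar:
  fixes P :: "'a::complex_hilbert \<Rightarrow>\<^sub>L 'a"
  assumes "\<not> finite_cdim (UNIV :: 'a set)" "positive_op P" "asymptotically_scalar P \<alpha>"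
  shows "ess_spectrum P = {of_real \<alpha>}"
  unfolding ess_spectrum_def
  using not_Fredholm_diff_asymptotic_scalar[OF assms] Fredholm_diff_scalar_op[OF assms(2,3)] by blast

section \<open>Quasinormal operators\<close>

lemma injective_imp_surjective_finite_dim:
  fixes f :: "'a::real_vector \<Rightarrow> 'a"
  assumes f: "linear f" and M: "subspace M" "finite B" "M \<subseteq> span B"
    and inv: "f ` M \<subseteq> M" and inj: "inj_on f M"
  shows "f ` M = M"
proof -
  obtain D where D: "D \<subseteq> M" "independent D" "M \<subseteq> span D"
    using maximal_independent_subset[of M] by blast
  have "finite D" using independent_span_bound[OF M(2) D(2)] D(1) M(3) by blast
  have span: "span D = M" using D M(1) by (simp add: span_minimal subset_antisym)
  have ind: "independent (f ` D)"
    by (rule linear_independent_injective_image[OF f D(2)]) (simp add: span inj)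
  have card: "card (f ` D) = card D" using inj D(1) by (intro card_image) (auto intro: inj_on_subset)
  have "y \<in> f ` M" if "y \<in> M" for y
  proof (rule ccontr)
    assume "y \<notin> f ` M"
    then have y: "y \<notin> span (f ` D)" by (simp add: linear_span_image[OF f] span)
    then have "independent (insert y (f ` D))" using ind by (simp add: independent_insert)
    moreover have "insert y (f ` D) \<subseteq> span D" using that inv D(1) by (auto simp: span)
    ultimately have "card (insert y (f ` D)) \<le> card D"
      using independent_span_bound[OF \<open>finite D\<close>] by blast
    moreover have "y \<notin> f ` D" using y span_base[of y "f ` D"] by blast
    then have "card (insert y (f ` D)) = Suc (card (f ` D))"
      by (rule card_insert_disjoint[OF finite_imageI[OF \<open>finite D\<close>]])
    ultimately show False using card by linarith
  qed
  then show ?thesis using inv by blast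
qed

text \<open>\<open>T\<close> commutes with the self-adjoint product
  \<open>adj T o\<^sub>L T\<close>; taking adjoints, so does \<open>adj T\<close>. Both therefore
  commute with its positive root.\<close>

lemma quasinormal_commute:
  fixes T :: "'a::complex_hilbert \<Rightarrow>\<^sub>L 'a"
  assumes "quasinormal T"
  shows "abs_op T (T x) = T (abs_op T x)" "abs_op T (adj T x) = adj T (abs_op T x)"
proof -
  have T: "T \<in> BH" and eq: "T o\<^sub>L (adj T o\<^sub>L T) = (adj T o\<^sub>L T) o\<^sub>L T"
    using assms by (auto simp: quasinormal_def)
  show "abs_op T (T x) = T (abs_op T x)"
    using abs_op_commute[OF T eq] by (metis blinfun_apply_blinfun_compose)
  have A: "adj T (T (T x)) = T (adj T (T x))" for x
    using eq by (metis blinfun_apply_blinfun_compose)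
  have "adj T o\<^sub>L (adj T o\<^sub>L T) = (adj T o\<^sub>L T) o\<^sub>L adj T"
  proof (rule blinfun_eqI, rule cinner_eqI)
    fix y z
    have "cinner z (adj T (adj T (T y))) = cinner (adj T (T (T z))) y"
      by (simp add: cinner_adj[OF T] cinner_adj_left[OF T] flip: cinner_adj[OF T])
    also have "\<dots> = cinner (T (adj T (T z))) y" by (simp only: A)
    also have "\<dots> = cinner z (adj T (T (adj T y)))"
      by (simp only: cinner_adj[OF T] cinner_adj_left[OF T])
    finally show "cinner z ((adj T o\<^sub>L (adj T o\<^sub>L T)) y) = cinner z (((adj T o\<^sub>L T) o\<^sub>L adj T) y)"
      by simp
  qed
  from abs_op_commute[OF T this] show "abs_op T (adj T x) = adj T (abs_op T x)"
    by (metis blinfun_apply_blinfun_compose)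
qed

lemma quasinormal_eigenspace_invariant:
  fixes T :: "'a::complex_hilbert \<Rightarrow>\<^sub>L 'a"
  assumes "quasinormal T"
  shows "T ` eigenspace (abs_op T) r \<subseteq> eigenspace (abs_op T) r"
    and "adj T ` eigenspace (abs_op T) r \<subseteq> eigenspace (abs_op T) r"
  by (auto simp: mem_eigenspace quasinormal_commute[OF assms] blinfun.scaleR_right)

text \<open>On the eigenspace for \<open>r = 0\<close> the operator \<open>T\<close> vanishes, so that any unitary operator serves.\<close>

definition polar_part :: "('a::complex_hilbert \<Rightarrow>\<^sub>L 'a) \<Rightarrow> real \<Rightarrow> 'a \<Rightarrow>\<^sub>L 'a" where
  "polar_part T r = (if r = 0 then id_blinfun else (1 / r) *\<^sub>R T)"

lemma polar_part_BH: "T \<in> BH \<Longrightarrow> polar_part T r \<in> BH"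
  by (simp add: polar_part_def BH_def blinfun.scaleR_left)
    (metis mult.commute scaleC_of_real scaleC_scaleC)

lemma polar_part_invariant:
  fixes T :: "'a::complex_hilbert \<Rightarrow>\<^sub>L 'a"
  assumes "quasinormal T"
  shows "polar_part T r ` eigenspace (abs_op T) r \<subseteq> eigenspace (abs_op T) r"
  by (auto simp: polar_part_def blinfun.scaleR_left mem_eigenspace
      quasinormal_commute[OF assms] blinfun.scaleR_right)

lemma scaleR_polar_part:
  fixes T :: "'a::complex_hilbert \<Rightarrow>\<^sub>L 'a"
  assumes "T \<in> BH" "x \<in> eigenspace (abs_op T) r"
  shows "r *\<^sub>R polar_part T r x = T x"
  using assms norm_abs_op_apply[OF assms(1), of x]
  by (auto simp: polar_part_def blinfun.scaleR_left mem_eigenspace)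

lemma norm_polar_part:
  fixes T :: "'a::complex_hilbert \<Rightarrow>\<^sub>L 'a"
  assumes "T \<in> BH" "0 \<le> r" "x \<in> eigenspace (abs_op T) r"
  shows "norm (polar_part T r x) = norm x"
  using assms norm_abs_op_apply[OF assms(1), of x]
  by (auto simp: polar_part_def blinfun.scaleR_left mem_eigenspace divide_eq_eq mult.commute)

lemma isometry_polar_part:
  fixes T :: "'a::complex_hilbert \<Rightarrow>\<^sub>L 'a"
  assumes q: "quasinormal T" and "0 \<le> r"
  shows "isometry_op_on (eigenspace (abs_op T) r) (polar_part T r)"
proof -
  have T: "T \<in> BH" using q by (simp add: quasinormal_def)
  show ?thesis
    unfolding isometry_op_on_def
    using bounded_op_on_blinfun[OF polar_part_BH[OF T] polar_part_invariant[OF q]]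
      norm_polar_part[OF T \<open>0 \<le> r\<close>] by blast
qed

text \<open>Only the surjectivity of the isometry uses that the eigenspace is finite dimensional.\<close>

lemma unitary_polar_part:
  fixes T :: "'a::complex_hilbert \<Rightarrow>\<^sub>L 'a"
  assumes q: "quasinormal T" and "0 \<le> r" and fin: "finite_cdim (eigenspace (abs_op T) r)"
  shows "unitary_op_on (eigenspace (abs_op T) r) (polar_part T r)"
proof -
  have T: "T \<in> BH" using q by (simp add: quasinormal_def)
  define E where "E = eigenspace (abs_op T) r"
  define U where "U = polar_part T r"
  define W where "W = polar_part (adj T) r"
  have sE: "subspace E"
    using closed_csubspace_eigenspace[OF positive_op_BH[OF positive_abs_op[OF T]], of r]
    by (simp add: E_def closed_csubspace_def csubspace_imp_subspace)
  have bU: "bounded_op_on E U"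
    unfolding E_def U_def by (intro bounded_op_on_blinfun polar_part_BH polar_part_invariant T q)
  have WE: "W ` E \<subseteq> E"
    unfolding E_def W_def
    by (auto simp: polar_part_def blinfun.scaleR_left mem_eigenspace
        quasinormal_commute[OF q] blinfun.scaleR_right)
  then have bW: "bounded_op_on E W"
    unfolding W_def by (intro bounded_op_on_blinfun polar_part_BH adj_in_BH T)
  have adj: "cinner (U x) y = cinner x (W y)" for x y
    by (simp add: U_def W_def polar_part_def blinfun.scaleR_left cinner_scaleR_left
        cinner_scaleR_right cinner_adj[OF T])
  have WU: "W (U x) = x" if "x \<in> E" for x
  proof (cases "r = 0")
    case False
    have "adj T (T x) = abs_op T (abs_op T x)"
      using abs_op_square[OF T] by (metis blinfun_apply_blinfun_compose)
    also have "\<dots> = (r * r) *\<^sub>R x" using that by (simp add: E_def mem_eigenspace blinfun.scaleR_right)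
    finally show ?thesis
      using False by (simp add: U_def W_def polar_part_def blinfun.scaleR_left blinfun.scaleR_right)
  qed (simp add: U_def W_def polar_part_def)
  obtain B where B: "finite B" "E \<subseteq> span B" using fin by (auto simp: E_def finite_cdim_iff_span)
  have "U ` E = E"
  proof (rule injective_imp_surjective_finite_dim[OF _ sE B])
    show "linear U" by (simp add: blinfun.bounded_linear_right bounded_linear.linear)
    show "U ` E \<subseteq> E" using bU by (simp add: bounded_op_on_def)
    show "inj_on U E" using WU by (metis inj_onI)
  qed
  then have "U (W x) = x" if "x \<in> E" for x using WU that by (metis imageE)
  then show ?thesis using bU bW adj WU unfolding unitary_op_on_def E_def U_def by blast
qed

section \<open>Sums of eigenspaces\<close>

text \<open>The closed linear span of these eigenspaces. As a double complement it is closed at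
  once, inherits invariance through each complement, and is \<open>{0}\<close> for
  \<open>\<Lambda> = {}\<close>.\<close>

definition eigenspace_sum :: "('a::complex_hilbert \<Rightarrow>\<^sub>L 'a) \<Rightarrow> real set \<Rightarrow> 'a set" where
  "eigenspace_sum P \<Lambda> = ortho_compl (ortho_compl (\<Union>r\<in>\<Lambda>. eigenspace P r))"

lemma closed_csubspace_eigenspace_sum: "closed_csubspace (eigenspace_sum P \<Lambda>)"
  by (simp add: eigenspace_sum_def)

lemma eigenspace_subset_eigenspace_sum: "r \<in> \<Lambda> \<Longrightarrow> eigenspace P r \<subseteq> eigenspace_sum P \<Lambda>"
  using subset_ortho_compl_ortho_compl[of "\<Union>r\<in>\<Lambda>. eigenspace P r"] unfolding eigenspace_sum_def by blast

lemma eigenspace_orthogonal_eigenspace_sum: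
  assumes "positive_op P" "r \<notin> \<Lambda>" "x \<in> eigenspace P r" "y \<in> eigenspace_sum P \<Lambda>"
  shows "cinner x y = 0"
proof -
  have "x \<in> ortho_compl (\<Union>s\<in>\<Lambda>. eigenspace P s)"
  proof -
    have "cinner z x = 0" if "s \<in> \<Lambda>" "z \<in> eigenspace P s" for s z
      using eigenspace_orthogonal[OF assms(1) _ that(2) assms(3)] that(1) assms(2) by metis
    then show ?thesis by (auto simp: ortho_compl_def)
  qed
  then show ?thesis using assms(4) by (simp add: eigenspace_sum_def ortho_compl_def)
qed

lemma eigenspace_sum_orthogonal:
  assumes "positive_op P" "\<Lambda> \<inter> \<Lambda>' = {}" "x \<in> eigenspace_sum P \<Lambda>" "y \<in> eigenspace_sum P \<Lambda>'"
  shows "cinner x y = 0"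
proof -
  have "y \<in> ortho_compl (\<Union>r\<in>\<Lambda>. eigenspace P r)"
    using eigenspace_orthogonal_eigenspace_sum[OF assms(1) _ _ assms(4)] assms(2)
    by (auto simp: ortho_compl_def)
  then have "cinner y x = 0" using assms(3) by (simp add: eigenspace_sum_def ortho_compl_def)
  then show ?thesis by (simp add: cinner_eq_0_commute)
qed

lemma reducing_eigenspace:
  fixes T :: "'a::complex_hilbert \<Rightarrow>\<^sub>L 'a"
  assumes q: "quasinormal T"
  shows "reducing T (eigenspace (abs_op T) r)"
proof -
  have T: "T \<in> BH" using q by (simp add: quasinormal_def)
  show ?thesis
    by (intro reducingI T closed_csubspace_eigenspace positive_op_BH positive_abs_op
        quasinormal_eigenspace_invariant q)
qed

text \<open>Passing to a complement exchanges invariance under \<open>T\<close> and under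
  \<open>adj T\<close>; doing so twice returns both.\<close>

lemma reducing_eigenspace_sum:
  fixes T :: "'a::complex_hilbert \<Rightarrow>\<^sub>L 'a"
  assumes q: "quasinormal T"
  shows "reducing T (eigenspace_sum (abs_op T) \<Lambda>)"
proof -
  have T: "T \<in> BH" using q by (simp add: quasinormal_def)
  let ?U = "\<Union>r\<in>\<Lambda>. eigenspace (abs_op T) r"
  have "T ` ?U \<subseteq> ?U" "adj T ` ?U \<subseteq> ?U"
    using quasinormal_eigenspace_invariant[OF q] by fast+
  note ortho = adj_invariant_ortho_compl[OF T this(1)] invariant_ortho_compl[OF T this(2)]
  from adj_invariant_ortho_compl[OF T ortho(2)] invariant_ortho_compl[OF T ortho(1)]
  show ?thesis unfolding eigenspace_sum_def by (intro reducingI T) auto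
qed

lemma op_direct_sum_eigenspace_sum:
  fixes T :: "'a::complex_hilbert \<Rightarrow>\<^sub>L 'a"
  assumes q: "quasinormal T" and inj: "inj_on a I"
  shows "op_direct_sum I (\<lambda>i. eigenspace (abs_op T) (a i)) (\<lambda>i x. a i *\<^sub>R polar_part T (a i) x)
    (eigenspace_sum (abs_op T) (a ` I)) T"
proof -
  have T: "T \<in> BH" using q by (simp add: quasinormal_def)
  have P: "positive_op (abs_op T)" by (rule positive_abs_op[OF T])
  have "direct_sum I (\<lambda>i. eigenspace (abs_op T) (a i)) (eigenspace_sum (abs_op T) (a ` I))"
  proof (rule direct_sumI)
    show "closed_csubspace (eigenspace_sum (abs_op T) (a ` I))" by (rule closed_csubspace_eigenspace_sum)
    show "closed_csubspace (eigenspace (abs_op T) (a i))" for i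
      by (rule closed_csubspace_eigenspace[OF positive_op_BH[OF P]])
    show "eigenspace (abs_op T) (a i) \<subseteq> eigenspace_sum (abs_op T) (a ` I)" if "i \<in> I" for i
      using that by (intro eigenspace_subset_eigenspace_sum) blast
    show "cinner x y = 0" if "i \<in> I" "j \<in> I" "i \<noteq> j"
      "x \<in> eigenspace (abs_op T) (a i)" "y \<in> eigenspace (abs_op T) (a j)" for i j x y
      using that inj by (intro eigenspace_orthogonal[OF P, of "a i" "a j"]) (auto dest: inj_onD)
    show "x = 0" if "x \<in> eigenspace_sum (abs_op T) (a ` I)"
      and "\<And>i y. i \<in> I \<Longrightarrow> y \<in> eigenspace (abs_op T) (a i) \<Longrightarrow> cinner y x = 0" for x
    proof (rule ortho_compl_Int)
      show "x \<in> ortho_compl (\<Union>r\<in>a ` I. eigenspace (abs_op T) r)"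
        using that(2) by (auto simp: ortho_compl_def)
    qed (use that(1) in \<open>simp add: eigenspace_sum_def\<close>)
  qed
  moreover have "T ` eigenspace_sum (abs_op T) (a ` I) \<subseteq> eigenspace_sum (abs_op T) (a ` I)"
    using reducing_eigenspace_sum[OF q] by (simp add: reducing_def)
  ultimately show ?thesis
    using quasinormal_eigenspace_invariant(1)[OF q] scaleR_polar_part[OF T]
    by (intro op_direct_sum_blinfun T) blast+
qed

lemma enumeration_upto_enat:
  assumes "countable \<Lambda>"
  shows "\<exists>n a. inj_on a (upto_enat n) \<and> a ` upto_enat n = \<Lambda>"
proof (cases "finite \<Lambda>")
  case True
  then obtain h where "bij_betw h {1..card \<Lambda>} \<Lambda>" using ex_bij_betw_nat_finite_1 by blast
  moreover have "upto_enat (enat (card \<Lambda>)) = {1..card \<Lambda>}" by (auto simp: upto_enat_def)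
  ultimately show ?thesis by (metis bij_betw_def)
next
  case False
  \<comment> \<open>\<open>upto_enat \<infinity>\<close> starts at 1, whereas
    \<open>from_nat_into\<close> counts from 0.\<close>
  have "bij_betw (\<lambda>i. i - 1) (upto_enat \<infinity>) (UNIV :: nat set)"
    by (rule bij_betw_byWitness[where f' = Suc]) (auto simp: upto_enat_def)
  then have "bij_betw (from_nat_into \<Lambda> \<circ> (\<lambda>i. i - 1)) (upto_enat \<infinity>) \<Lambda>"
    using bij_betw_from_nat_into[OF assms False] by (rule bij_betw_trans)
  then show ?thesis unfolding bij_betw_def by blast
qed

lemma countable_eigenvalues:
  fixes P :: "'a::complex_hilbert \<Rightarrow>\<^sub>L 'a"
  assumes "positive_op P" "asymptotically_scalar P \<alpha>"
  shows "countable {r. r \<noteq> \<alpha> \<and> eigenspace P r \<noteq> {0}}"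
proof -
  have "{r. r \<noteq> \<alpha> \<and> eigenspace P r \<noteq> {0}} \<subseteq>
      (\<Union>n. {r. inverse (real (Suc n)) \<le> \<bar>r - \<alpha>\<bar> \<and> eigenspace P r \<noteq> {0}})"
  proof
    fix r assume r: "r \<in> {r. r \<noteq> \<alpha> \<and> eigenspace P r \<noteq> {0}}"
    then obtain n where "inverse (real (Suc n)) < \<bar>r - \<alpha>\<bar>" using reals_Archimedean[of "\<bar>r - \<alpha>\<bar>"] by auto
    then show "r \<in> (\<Union>n. {r. inverse (real (Suc n)) \<le> \<bar>r - \<alpha>\<bar> \<and> eigenspace P r \<noteq> {0}})"
      using r by (auto intro: less_imp_le)
  qed
  moreover have "countable \<dots>"
  proof (rule countable_UN)
    show "countable {r. inverse (real (Suc n)) \<le> \<bar>r - \<alpha>\<bar> \<and> eigenspace P r \<noteq> {0}}" for n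
      by (intro countable_finite finite_eigenvalues_away[OF assms]) simp
  qed simp
  ultimately show ?thesis by (rule countable_subset)
qed

theorem theorem3p6:
  fixes T :: "'a::complex_hilbert \<Rightarrow>\<^sub>L 'a"
  assumes infinite_dim: "\<not> finite_cdim (UNIV :: 'a set)"
    and T_closure_AN: "T \<in> closure AN"
    and T_quasinormal: "quasinormal T"
  shows "\<exists>H1 Hinf H2 (n::enat) (m::enat) (\<alpha>::real) (a::nat \<Rightarrow> real) (b::nat \<Rightarrow> real) U V Vinf T1 T2.
      reducing T H1 \<and> reducing T Hinf \<and> reducing T H2 \<and>
      op_direct_sum {0, 1, 2 :: nat} ((!) [H1, Hinf, H2])
        ((!) [T1, \<lambda>x. \<alpha> *\<^sub>R Vinf x, T2]) UNIV (blinfun_apply T) \<and>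
      op_direct_sum (upto_enat n) (\<lambda>i. eigenspace (abs_op T) (a i)) (\<lambda>i x. a i *\<^sub>R U i x) H1 T1 \<and>
      op_direct_sum (upto_enat m) (\<lambda>j. eigenspace (abs_op T) (b j)) (\<lambda>j x. b j *\<^sub>R V j x) H2 T2 \<and>
      ess_spectrum (abs_op T) = {complex_of_real \<alpha>} \<and> \<alpha> \<ge> 0 \<and>
      Hinf = eigenspace (abs_op T) \<alpha> \<and> isometry_op_on Hinf Vinf \<and>
      inj_on a (upto_enat n) \<and>
      complex_of_real ` {\<alpha><..norm T} \<inter> spectrum (abs_op T) = complex_of_real ` a ` upto_enat n \<and>
      (\<forall>i\<in>upto_enat n. unitary_op_on (eigenspace (abs_op T) (a i)) (U i)) \<and>
      inj_on b (upto_enat m) \<and>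
      complex_of_real ` {min_modulus T..<\<alpha>} \<inter> spectrum (abs_op T) = complex_of_real ` b ` upto_enat m \<and>
      (\<forall>j\<in>upto_enat m. unitary_op_on (eigenspace (abs_op T) (b j)) (V j))"
proof -
  note q = T_quasinormal
  have T: "T \<in> BH" using q by (simp add: quasinormal_def)
  define P where "P = abs_op T"
  have P: "positive_op P" unfolding P_def by (rule positive_abs_op[OF T])
  obtain \<alpha> where \<alpha>: "\<alpha> \<ge> 0" and modulus: "\<And>\<epsilon>. \<epsilon> > 0 \<Longrightarrow> \<exists>C. finite C \<and>
      (\<forall>x. (\<forall>c\<in>C. inner c x = 0) \<longrightarrow> \<bar>norm (T x) - \<alpha> * norm x\<bar> \<le> \<epsilon> * norm x)"
    using closure_AN_asymptotic_modulus[OF infinite_dim T_closure_AN] by blast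
  have Q: "asymptotically_scalar P \<alpha>"
  proof (rule asymptotically_scalar_if_modulus[OF positive_op_symmetric[OF P] positive_op_inner_nonneg[OF P] \<alpha>])
    show "\<exists>C. finite C \<and> (\<forall>x. (\<forall>c\<in>C. inner c x = 0) \<longrightarrow> \<bar>norm (P x) - \<alpha> * norm x\<bar> \<le> \<epsilon> * norm x)"
      if "\<epsilon> > 0" for \<epsilon>
      using modulus[OF that] by (simp only: P_def norm_abs_op_apply[OF T])
  qed
  \<comment> \<open>The bounds by \<open>norm T\<close> and \<open>min_modulus T\<close> hold for
    every eigenvalue and reappear only when the spectrum is described.\<close>
  define \<Lambda>1 where "\<Lambda>1 = {r. \<alpha> < r \<and> eigenspace P r \<noteq> {0}}"
  define \<Lambda>2 where "\<Lambda>2 = {r. r < \<alpha> \<and> eigenspace P r \<noteq> {0}}"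
  have "countable \<Lambda>1" "countable \<Lambda>2"
    by (rule countable_subset[OF _ countable_eigenvalues[OF P Q]]; auto simp: \<Lambda>1_def \<Lambda>2_def)+
  then obtain n a m b where a: "inj_on a (upto_enat n)" "a ` upto_enat n = \<Lambda>1"
    and b: "inj_on b (upto_enat m)" "b ` upto_enat m = \<Lambda>2"
    using enumeration_upto_enat by metis
  have bounds: "0 \<le> r" "min_modulus T \<le> r" "r \<le> norm T" if "eigenspace P r \<noteq> {0}" for r
    using eigenvalue_bounds[OF T] that unfolding P_def by blast+
  have unitary: "unitary_op_on (eigenspace P r) (polar_part T r)" if "r \<in> \<Lambda>1 \<union> \<Lambda>2" for r
  proof -
    have "r \<noteq> \<alpha>" "0 \<le> r" using that bounds(1)[of r] by (auto simp: \<Lambda>1_def \<Lambda>2_def)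
    then show ?thesis
      using unitary_polar_part[OF q] finite_cdim_null_space_diff[OF positive_op_BH[OF P] Q]
      by (simp add: P_def eigenspace_def)
  qed
  have spec1: "complex_of_real ` {\<alpha><..norm T} \<inter> spectrum P = complex_of_real ` \<Lambda>1"
    using spectrum_iff_eigenvalue[OF P Q] bounds(3) by (fastforce simp: \<Lambda>1_def)
  have spec2: "complex_of_real ` {min_modulus T..<\<alpha>} \<inter> spectrum P = complex_of_real ` \<Lambda>2"
    using spectrum_iff_eigenvalue[OF P Q] bounds(2) by (fastforce simp: \<Lambda>2_def)
  define H1 where "H1 = eigenspace_sum P \<Lambda>1"
  define H2 where "H2 = eigenspace_sum P \<Lambda>2"
  define E where "E = eigenspace P \<alpha>"
  have red: "reducing T H1" "reducing T E" "reducing T H2"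
    unfolding H1_def H2_def E_def P_def by (intro reducing_eigenspace_sum reducing_eigenspace q)+
  have notin: "\<alpha> \<notin> \<Lambda>1" "\<alpha> \<notin> \<Lambda>2" "\<Lambda>1 \<inter> \<Lambda>2 = {}" by (auto simp: \<Lambda>1_def \<Lambda>2_def)
  have orth: "cinner x y = 0" "cinner y x = 0" if "x \<in> H1" "y \<in> E" for x y
    using eigenspace_orthogonal_eigenspace_sum[OF P notin(1)] that cinner_eq_0_commute
    unfolding H1_def E_def by blast+
  have orth': "cinner x y = 0" "cinner y x = 0" if "x \<in> H2" "y \<in> E" for x y
    using eigenspace_orthogonal_eigenspace_sum[OF P notin(2)] that cinner_eq_0_commute
    unfolding H2_def E_def by blast+
  have orth'': "cinner x y = 0" "cinner y x = 0" if "x \<in> H1" "y \<in> H2" for x y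
    using eigenspace_sum_orthogonal[OF P notin(3)] that cinner_eq_0_commute
    unfolding H1_def H2_def by blast+
  have ds: "direct_sum {0, 1, 2 :: nat} ((!) [H1, E, H2]) UNIV"
  proof (rule direct_sumI)
    show "closed_csubspace (UNIV :: 'a set)" by (simp add: closed_csubspace_def csubspace_iff)
    show "closed_csubspace ([H1, E, H2] ! i)" if "i \<in> {0, 1, 2}" for i
      using that red by (auto simp: reducing_def)
    show "cinner x y = 0" if "i \<in> {0, 1, 2}" "j \<in> {0, 1, 2}" "i \<noteq> j"
      "x \<in> [H1, E, H2] ! i" "y \<in> [H1, E, H2] ! j" for i j x y
      using that orth orth' orth'' by auto
    show "x = 0" if x: "\<And>i y. i \<in> {0, 1, 2} \<Longrightarrow> y \<in> [H1, E, H2] ! i \<Longrightarrow> cinner y x = 0" for x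
    proof (rule eigenspaces_total[OF P Q])
      fix r y assume y: "y \<in> eigenspace P r"
      \<comment> \<open>The case \<open>y = 0\<close> covers those \<open>r\<close> that are no
        eigenvalues and belong to neither index set.\<close>
      have "y = 0 \<or> y \<in> H1 \<or> y \<in> E \<or> y \<in> H2"
      proof (cases r \<alpha> rule: linorder_cases)
        case less
        then show ?thesis
          using y eigenspace_subset_eigenspace_sum[of r \<Lambda>2 P] by (auto simp: \<Lambda>2_def H2_def)
      next
        case greater
        then show ?thesis
          using y eigenspace_subset_eigenspace_sum[of r \<Lambda>1 P] by (auto simp: \<Lambda>1_def H1_def)
      qed (use y in \<open>simp add: E_def\<close>)
      then show "cinner y x = 0" using x[of 0 y] x[of 1 y] x[of 2 y] by auto
    qed
  qed simp
  \<comment> \<open>\<open>T\<close> itself serves as the operator on \<open>H1\<close> and on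
    \<open>H2\<close>, since only its values there matter; the sums over the eigenspaces split it
    into scalars and unitary parts.\<close>
  have sum: "op_direct_sum {0, 1, 2 :: nat} ((!) [H1, E, H2])
      ((!) [blinfun_apply T, \<lambda>x. \<alpha> *\<^sub>R polar_part T \<alpha> x, blinfun_apply T]) UNIV T"
  proof (rule op_direct_sum_blinfun[OF T _ ds])
    show "T ` ([H1, E, H2] ! i) \<subseteq> [H1, E, H2] ! i" if "i \<in> {0, 1, 2}" for i
    proof -
      have "\<forall>M\<in>set [H1, E, H2]. T ` M \<subseteq> M" using red by (simp add: reducing_def)
      moreover have "[H1, E, H2] ! i \<in> set [H1, E, H2]" using that by (intro nth_mem) auto
      ultimately show ?thesis by blast
    qed
    show "([blinfun_apply T, \<lambda>x. \<alpha> *\<^sub>R polar_part T \<alpha> x, blinfun_apply T] ! i) x = T x"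
      if "i \<in> {0, 1, 2}" "x \<in> [H1, E, H2] ! i" for i x
      using that scaleR_polar_part[OF T, of x \<alpha>] by (auto simp: E_def P_def)
  qed simp
  have sum1: "op_direct_sum (upto_enat n) (\<lambda>i. eigenspace P (a i)) (\<lambda>i x. a i *\<^sub>R polar_part T (a i) x) H1 T"
    using op_direct_sum_eigenspace_sum[OF q a(1)] by (simp add: P_def H1_def a(2))
  have sum2: "op_direct_sum (upto_enat m) (\<lambda>j. eigenspace P (b j)) (\<lambda>j x. b j *\<^sub>R polar_part T (b j) x) H2 T"
    using op_direct_sum_eigenspace_sum[OF q b(1)] by (simp add: P_def H2_def b(2))
  have iso: "isometry_op_on E (polar_part T \<alpha>)"
    unfolding E_def P_def by (rule isometry_polar_part[OF q \<alpha>])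
  have unitary1: "\<forall>i\<in>upto_enat n. unitary_op_on (eigenspace P (a i)) (polar_part T (a i))"
    using unitary a(2) by blast
  have unitary2: "\<forall>j\<in>upto_enat m. unitary_op_on (eigenspace P (b j)) (polar_part T (b j))"
    using unitary b(2) by blast
  note spec = spec1[folded a(2)] spec2[folded b(2)]
  note ess = ess_spectrum_asymptotically_scalar[OF infinite_dim P Q]
  show ?thesis
    by (rule exI[of _ H1], rule exI[of _ E], rule exI[of _ H2], rule exI[of _ n], rule exI[of _ m],
        rule exI[of _ \<alpha>], rule exI[of _ a], rule exI[of _ b],
        rule exI[of _ "\<lambda>i. blinfun_apply (polar_part T (a i))"], rule exI[of _ "\<lambda>j. blinfun_apply (polar_part T (b j))"],
        rule exI[of _ "blinfun_apply (polar_part T \<alpha>)"], rule exI[of _ "blinfun_apply T"],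
        rule exI[of _ "blinfun_apply T"], unfold P_def[symmetric],
        intro conjI red sum sum1 sum2 ess \<alpha> E_def iso a(1) spec unitary1 b(1) unitary2)
qed

end
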